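(* Let $m,n$ be nonnegative integers and let $\Lambda$ be an $(m,n)$-Igusa-Todorov artin algebra. Then $\mathrm{tri.dim}\, D^{b}(\mathrm{mod}\,\Lambda) \leqslant 2m+n+1$.
   Context: $\mathrm{mod}\,\Lambda$ is the category of finitely generated right $\Lambda$-modules, $D^{b}(\mathrm{mod}\,\Lambda)$ its bounded derived category, and $\Omega^{n}(M)$ the $n$-th syzygy of $M$ (taken with respect to projective covers, $\Omega^0(M)=M$). $(m,n)$-Igusa-Todorov algebra: for nonnegative integers $m,n$, an artin algebra $\Lambda$ is $(m,n)$-Igusa-Todorov if there is a module $V\in\mathrm{mod}\,\Lambda$ such that for every $M\in \mathrm{mod}\,\Lambda$ there is an exact sequence $$0\to V_{m}\to V_{m-1}\to\cdots\to V_{1}\to V_{0}\to \Omega^{n}(M)\to 0$$ with $V_{i}\in [V]_1$ for each $0\leqslant i\leqslant m$, where $[V]_1=\mathrm{add}\,V$ is the class of direct summands of finite direct sums of copies of $V$. Dimension of a triangulated category $\mathcal{T}$: for $\mathcal{I}\subseteq \mathrm{Ob}\,\mathcal{T}$, let $\langle\mathcal{I}\rangle_1$ be the full subcategory of all direct summands of finite direct sums of shifts of objects in $\mathcal{I}$. For $\mathcal{I}_1,\mathcal{I}_2\subseteq\mathrm{Ob}\,\mathcal{T}$, let $\mathcal{I}_1*\mathcal{I}_2$ be the full subcategory of objects $X$ fitting in a triangle $X_1\to X\to X_2\to X_1[1]$ with $X_1\in\mathcal{I}_1$, $X_2\in\mathcal{I}_2$, and let $\mathcal{I}_1\diamond\mathcal{I}_2=\langle\mathcal{I}_1*\mathcal{I}_2\rangle_1$.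 Set $\langle\mathcal{I}\rangle_0=0$ and $\langle\mathcal{I}\rangle_{k+1}=\langle\mathcal{I}\rangle_k\diamond\langle\mathcal{I}\rangle_1$ for $k\geqslant 1$; write $\langle M\rangle_k$ for $\langle\{M\}\rangle_k$. Then $\mathrm{tri.dim}\,\mathcal{T}$ is the minimal $d\geqslant 0$ such that $\mathcal{T}=\langle M\rangle_{d+1}$ for some object $M\in\mathcal{T}$, and $\infty$ if there is no such $d$. *)

theory Defs
  imports "HOL-Algebra.Module" "HOL-Algebra.Ideal" "HOL-Library.Extended_Nat"
begin

section \<open>Artin algebras\<close>

definition artinian_cring :: "('k, 'p) ring_scheme \<Rightarrow> bool" where
  "artinian_cring K \<longleftrightarrow> cring K \<and>
     (\<forall>I :: nat \<Rightarrow> 'k set. (\<forall>n. ideal (I n) K) \<and> (\<forall>n. I (Suc n) \<subseteq> I n)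
        \<longrightarrow> (\<exists>N. \<forall>n\<ge>N. I n = I N))"

text \<open>The structure map \<open>\<phi>\<close> makes \<open>L\<close> an algebra over the commutative artinian ring \<open>K\<close>,
  finitely generated as a \<open>K\<close>-module.\<close>

definition artin_algebra ::
  "('k, 'p) ring_scheme \<Rightarrow> ('a, 'q) ring_scheme \<Rightarrow> ('k \<Rightarrow> 'a) \<Rightarrow> bool" where
  "artin_algebra K L \<phi> \<longleftrightarrow>
     artinian_cring K \<and> ring L \<and> \<phi> \<in> ring_hom K L \<and>
     (\<forall>c\<in>carrier K. \<forall>x\<in>carrier L. \<phi> c \<otimes>\<^bsub>L\<^esub> x = x \<otimes>\<^bsub>L\<^esub> \<phi> c) \<and>
     (\<exists>S. finite S \<and> S \<subseteq> carrier L \<and>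
        (\<forall>x\<in>carrier L. \<exists>c\<in>S \<rightarrow> carrier K. x = (\<Oplus>\<^bsub>L\<^esub>s\<in>S. \<phi> (c s) \<otimes>\<^bsub>L\<^esub> s)))"


section \<open>Finitely generated right modules\<close>

text \<open>The library's \<open>module\<close> record is reused as a carrier of data; its locale \<open>module\<close>
  requires a commutative ring. The term \<open>a \<odot>\<^bsub>M\<^esub> x\<close> stands for the right action
  \<open>x \<cdot> a\<close>, which is what \<open>smult_assoc\<close> expresses. The ring fields \<open>mult\<close> and \<open>one\<close>
  of the record play no role.\<close>

locale right_module = R?: ring R + M?: abelian_group M
  for R :: "('a, 'q) ring_scheme" (structure) and M :: "('a, 'b, 'c) module_scheme" (structure) +
  assumes smult_closed: "\<lbrakk>a \<in> carrier R; x \<in> carrier M\<rbrakk> \<Longrightarrow> a \<odot>\<^bsub>M\<^esub> x \<in> carrier M"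
    and smult_l_distr: "\<lbrakk>a \<in> carrier R; b \<in> carrier R; x \<in> carrier M\<rbrakk> \<Longrightarrow>
      (a \<oplus> b) \<odot>\<^bsub>M\<^esub> x = a \<odot>\<^bsub>M\<^esub> x \<oplus>\<^bsub>M\<^esub> b \<odot>\<^bsub>M\<^esub> x"
    and smult_r_distr: "\<lbrakk>a \<in> carrier R; x \<in> carrier M; y \<in> carrier M\<rbrakk> \<Longrightarrow>
      a \<odot>\<^bsub>M\<^esub> (x \<oplus>\<^bsub>M\<^esub> y) = a \<odot>\<^bsub>M\<^esub> x \<oplus>\<^bsub>M\<^esub> a \<odot>\<^bsub>M\<^esub> y"
    and smult_assoc: "\<lbrakk>a \<in> carrier R; b \<in> carrier R; x \<in> carrier M\<rbrakk> \<Longrightarrow>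
      (a \<otimes> b) \<odot>\<^bsub>M\<^esub> x = b \<odot>\<^bsub>M\<^esub> (a \<odot>\<^bsub>M\<^esub> x)"
    and smult_one: "x \<in> carrier M \<Longrightarrow> \<one> \<odot>\<^bsub>M\<^esub> x = x"

definition mod_hom ::
  "('a, 'q) ring_scheme \<Rightarrow> ('a, 'b) module \<Rightarrow> ('a, 'c) module \<Rightarrow> ('b \<Rightarrow> 'c) set" where
  "mod_hom L M N = {f \<in> carrier M \<rightarrow> carrier N.
     (\<forall>x\<in>carrier M. \<forall>y\<in>carrier M. f (x \<oplus>\<^bsub>M\<^esub> y) = f x \<oplus>\<^bsub>N\<^esub> f y) \<and>
     (\<forall>a\<in>carrier L. \<forall>x\<in>carrier M. f (a \<odot>\<^bsub>M\<^esub> x) = a \<odot>\<^bsub>N\<^esub> f x)}"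

definition mod_ker :: "('a, 'b) module \<Rightarrow> ('a, 'c) module \<Rightarrow> ('b \<Rightarrow> 'c) \<Rightarrow> 'b set" where
  "mod_ker M N f = {x \<in> carrier M. f x = \<zero>\<^bsub>N\<^esub>}"

definition mod_iso ::
  "('a, 'q) ring_scheme \<Rightarrow> ('a, 'b) module \<Rightarrow> ('a, 'c) module \<Rightarrow> bool" where
  "mod_iso L M N \<longleftrightarrow> (\<exists>f\<in>mod_hom L M N. bij_betw f (carrier M) (carrier N))"

definition fin_gen :: "('a, 'q) ring_scheme \<Rightarrow> ('a, 'b) module \<Rightarrow> bool" where
  "fin_gen L M \<longleftrightarrow> (\<exists>S. finite S \<and> S \<subseteq> carrier M \<and>
     (\<forall>x\<in>carrier M. \<exists>c\<in>S \<rightarrow> carrier L. x = (\<Oplus>\<^bsub>M\<^esub>s\<in>S. c s \<odot>\<^bsub>M\<^esub> s)))"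

text \<open>The elements of all modules under consideration are taken from one type \<open>'a melt\<close>, closed
  under pairing so that direct sums exist within it. Up to isomorphism every finitely generated
  right \<open>L\<close>-module occurs there (\<open>fin_gen_module_representable\<close> below), so \<open>mod_cat L\<close> is
  equivalent to the category of all finitely generated right \<open>L\<close>-modules.\<close>

datatype 'a melt = Atom 'a | Join (lft: "'a melt") (rgt: "'a melt")

definition mod_cat :: "('a, 'q) ring_scheme \<Rightarrow> ('a, 'a melt) module set" where
  "mod_cat L = {M. right_module L M \<and> fin_gen L M}"

primrec melt_of_list :: "'a list \<Rightarrow> 'a melt" where
  "melt_of_list [] = Atom undefined"
| "melt_of_list (a # as) = Join (Atom a) (melt_of_list as)"

lemma melt_of_list_inj: "melt_of_list xs = melt_of_list ys \<Longrightarrow> xs = ys"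
proof (induction xs arbitrary: ys)
  case Nil
  then show ?case by (cases ys) auto
next
  case (Cons a xs)
  then show ?case by (cases ys) auto
qed

lemma fin_gen_module_representable:
  fixes L :: "('a, 'q) ring_scheme" and M :: "('a, 'b) module"
  assumes "right_module L M" and "fin_gen L M"
  shows "\<exists>N\<in>mod_cat L. mod_iso L M N"
proof -
  interpret M: right_module L M by fact
  obtain S where S: "finite S" "S \<subseteq> carrier M"
    and gen: "\<forall>x\<in>carrier M. \<exists>c\<in>S \<rightarrow> carrier L. x = (\<Oplus>\<^bsub>M\<^esub>s\<in>S. c s \<odot>\<^bsub>M\<^esub> s)"
    using assms(2) unfolding fin_gen_def by blast
  obtain xs where xs: "set xs = S" using finite_list[OF S(1)] by blast
  from gen have "\<forall>x\<in>carrier M. \<exists>c. c \<in> S \<rightarrow> carrier L \<and> x = (\<Oplus>\<^bsub>M\<^esub>s\<in>S. c s \<odot>\<^bsub>M\<^esub> s)"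
    by blast
  from bchoice[OF this] obtain c where
    c: "\<And>x. x \<in> carrier M \<Longrightarrow> c x \<in> S \<rightarrow> carrier L"
       "\<And>x. x \<in> carrier M \<Longrightarrow> x = (\<Oplus>\<^bsub>M\<^esub>s\<in>S. c x s \<odot>\<^bsub>M\<^esub> s)"
    by blast
  define e where "e x = melt_of_list (map (c x) xs)" for x
  have inj: "inj_on e (carrier M)"
  proof (rule inj_onI)
    fix x y assume x: "x \<in> carrier M" and y: "y \<in> carrier M" and "e x = e y"
    then have "map (c x) xs = map (c y) xs" unfolding e_def by (blast dest: melt_of_list_inj)
    then have eq: "c x s = c y s" if "s \<in> S" for s using that xs by simp
    have "x = (\<Oplus>\<^bsub>M\<^esub>s\<in>S. c x s \<odot>\<^bsub>M\<^esub> s)" by (rule c(2)[OF x])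
    also have "\<dots> = (\<Oplus>\<^bsub>M\<^esub>s\<in>S. c y s \<odot>\<^bsub>M\<^esub> s)"
      using eq S(2) c(1)[OF y] by (intro M.finsum_cong') (auto intro!: M.smult_closed)
    also have "\<dots> = y" by (rule c(2)[OF y, symmetric])
    finally show "x = y" .
  qed
  define g where "g = inv_into (carrier M) e"
  have ge [simp]: "g (e x) = x" if "x \<in> carrier M" for x
    unfolding g_def by (rule inv_into_f_f[OF inj that])
  define N :: "('a, 'a melt) module" where
    "N = \<lparr>carrier = e ` carrier M, mult = undefined, one = undefined, zero = e \<zero>\<^bsub>M\<^esub>,
      add = (\<lambda>p q. e (g p \<oplus>\<^bsub>M\<^esub> g q)), smult = (\<lambda>a p. e (a \<odot>\<^bsub>M\<^esub> g p))\<rparr>"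
  have N [simp]: "carrier N = e ` carrier M" "\<zero>\<^bsub>N\<^esub> = e \<zero>\<^bsub>M\<^esub>"
    "p \<oplus>\<^bsub>N\<^esub> q = e (g p \<oplus>\<^bsub>M\<^esub> g q)" "a \<odot>\<^bsub>N\<^esub> p = e (a \<odot>\<^bsub>M\<^esub> g p)" for p q a
    by (simp_all add: N_def)
  have ab: "abelian_group N"
  proof (rule abelian_groupI)
    fix p assume "p \<in> carrier N"
    then obtain x where "x \<in> carrier M" "p = e x" by auto
    then show "\<exists>q\<in>carrier N. q \<oplus>\<^bsub>N\<^esub> p = \<zero>\<^bsub>N\<^esub>"
      by (intro bexI[of _ "e (\<ominus>\<^bsub>M\<^esub> x)"]) (auto simp: M.l_neg)
  qed (auto simp: M.a_ac)
  interpret N: abelian_group N by (rule ab)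
  have rm: "right_module L N"
    by unfold_locales
      (auto simp: M.smult_closed M.smult_l_distr M.smult_r_distr M.smult_assoc M.smult_one)
  have sum: "(\<Oplus>\<^bsub>N\<^esub>s\<in>T. e (f s)) = e (\<Oplus>\<^bsub>M\<^esub>s\<in>T. f s)"
    if "finite T" "f \<in> T \<rightarrow> carrier M" for T and f :: "'b \<Rightarrow> 'b"
    using that
  proof (induction T rule: finite_induct)
    case empty
    then show ?case by simp
  next
    case (insert t T)
    have "(\<Oplus>\<^bsub>N\<^esub>s\<in>insert t T. e (f s)) = e (f t) \<oplus>\<^bsub>N\<^esub> (\<Oplus>\<^bsub>N\<^esub>s\<in>T. e (f s))"
      using insert by (intro N.finsum_insert) auto
    also have "\<dots> = e (\<Oplus>\<^bsub>M\<^esub>s\<in>insert t T. f s)"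
      using insert by (subst M.finsum_insert) (auto simp: M.finsum_closed)
    finally show ?case .
  qed
  have "fin_gen L N"
    unfolding fin_gen_def
  proof (intro exI[of _ "e ` S"] conjI ballI)
    show "finite (e ` S)" "e ` S \<subseteq> carrier N" using S by auto
    fix p assume "p \<in> carrier N"
    then obtain x where x: "x \<in> carrier M" "p = e x" by auto
    have mem: "c x s \<odot>\<^bsub>M\<^esub> s \<in> carrier M" if "s \<in> S" for s
      using that c(1)[OF x(1)] S(2) by (auto intro!: M.smult_closed)
    have "(\<Oplus>\<^bsub>N\<^esub>q\<in>e ` S. c x (g q) \<odot>\<^bsub>N\<^esub> q) = (\<Oplus>\<^bsub>N\<^esub>s\<in>S. c x (g (e s)) \<odot>\<^bsub>N\<^esub> e s)"
      using mem S(2) inj by (intro N.finsum_reindex) (auto simp: subset_iff intro: inj_on_subset)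
    also have "\<dots> = (\<Oplus>\<^bsub>N\<^esub>s\<in>S. e (c x s \<odot>\<^bsub>M\<^esub> s))"
      using mem S(2) by (intro N.finsum_cong') (auto simp: subset_iff)
    also have "\<dots> = e (\<Oplus>\<^bsub>M\<^esub>s\<in>S. c x s \<odot>\<^bsub>M\<^esub> s)"
      using mem by (intro sum S(1)) auto
    also have "\<dots> = p" using c(2)[OF x(1)] x(2) by simp
    finally have "p = (\<Oplus>\<^bsub>N\<^esub>q\<in>e ` S. c x (g q) \<odot>\<^bsub>N\<^esub> q)" ..
    moreover have "(\<lambda>q. c x (g q)) \<in> e ` S \<rightarrow> carrier L"
      using c(1)[OF x(1)] S(2) by (auto simp: subset_iff Pi_iff)
    ultimately show "\<exists>d\<in>e ` S \<rightarrow> carrier L. p = (\<Oplus>\<^bsub>N\<^esub>q\<in>e ` S. d q \<odot>\<^bsub>N\<^esub> q)" by (rule bexI)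
  qed
  with rm have "N \<in> mod_cat L" by (simp add: mod_cat_def)
  moreover have "mod_iso L M N"
    unfolding mod_iso_def mod_hom_def using inj
    by (intro bexI[of _ e]) (auto simp: bij_betw_def)
  ultimately show ?thesis by blast
qed

text \<open>The fields \<open>mult\<close> and \<open>one\<close> are irrelevant.\<close>

definition zero_mod :: "('a, 'q) ring_scheme \<Rightarrow> ('a, 'a melt) module" where
  "zero_mod L = \<lparr>carrier = {Atom \<zero>\<^bsub>L\<^esub>}, mult = (\<lambda>_ _. Atom \<zero>\<^bsub>L\<^esub>), one = Atom \<zero>\<^bsub>L\<^esub>,
     zero = Atom \<zero>\<^bsub>L\<^esub>, add = (\<lambda>_ _. Atom \<zero>\<^bsub>L\<^esub>), smult = (\<lambda>_ _. Atom \<zero>\<^bsub>L\<^esub>)\<rparr>"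

definition mod_sum ::
  "('a, 'a melt) module \<Rightarrow> ('a, 'a melt) module \<Rightarrow> ('a, 'a melt) module" where
  "mod_sum M N = \<lparr>carrier = {Join x y | x y. x \<in> carrier M \<and> y \<in> carrier N},
     mult = (\<lambda>_ _. Join \<zero>\<^bsub>M\<^esub> \<zero>\<^bsub>N\<^esub>), one = Join \<zero>\<^bsub>M\<^esub> \<zero>\<^bsub>N\<^esub>,
     zero = Join \<zero>\<^bsub>M\<^esub> \<zero>\<^bsub>N\<^esub>,
     add = (\<lambda>p q. Join (lft p \<oplus>\<^bsub>M\<^esub> lft q) (rgt p \<oplus>\<^bsub>N\<^esub> rgt q)),
     smult = (\<lambda>a p. Join (a \<odot>\<^bsub>M\<^esub> lft p) (a \<odot>\<^bsub>N\<^esub> rgt p))\<rparr>"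

primrec mod_power ::
  "('a, 'q) ring_scheme \<Rightarrow> ('a, 'a melt) module \<Rightarrow> nat \<Rightarrow> ('a, 'a melt) module" where
  "mod_power L V 0 = zero_mod L"
| "mod_power L V (Suc k) = mod_sum V (mod_power L V k)"

definition add_closure ::
  "('a, 'q) ring_scheme \<Rightarrow> ('a, 'a melt) module \<Rightarrow> ('a, 'a melt) module set" where
  "add_closure L V = {W \<in> mod_cat L. \<exists>W'\<in>mod_cat L. \<exists>k. mod_iso L (mod_sum W W') (mod_power L V k)}"


section \<open>Projective covers, syzygies and Igusa--Todorov algebras\<close>

definition projective_mod :: "('a, 'q) ring_scheme \<Rightarrow> ('a, 'a melt) module \<Rightarrow> bool" where
  "projective_mod L P \<longleftrightarrow> P \<in> mod_cat L \<and>
     (\<forall>M\<in>mod_cat L. \<forall>N\<in>mod_cat L. \<forall>g\<in>mod_hom L M N. \<forall>f\<in>mod_hom L P N.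
        g ` carrier M = carrier N \<longrightarrow>
        (\<exists>h\<in>mod_hom L P M. \<forall>x\<in>carrier P. g (h x) = f x))"

definition projective_cover ::
  "('a, 'q) ring_scheme \<Rightarrow> ('a, 'a melt) module \<Rightarrow> ('a, 'a melt) module \<Rightarrow>
   ('a melt \<Rightarrow> 'a melt) \<Rightarrow> bool" where
  "projective_cover L P M p \<longleftrightarrow> projective_mod L P \<and> M \<in> mod_cat L \<and> p \<in> mod_hom L P M \<and>
     p ` carrier P = carrier M \<and>
     (\<forall>U. submodule U L P \<and> U <+>\<^bsub>P\<^esub> mod_ker P M p = carrier P \<longrightarrow> U = carrier P)"

text \<open>\<open>is_syzygy L n M N\<close>: the module \<open>N\<close> is (isomorphic to) the \<open>n\<close>-th syzygy of \<open>M\<close>.\<close>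

inductive is_syzygy ::
  "('a, 'q) ring_scheme \<Rightarrow> nat \<Rightarrow> ('a, 'a melt) module \<Rightarrow> ('a, 'a melt) module \<Rightarrow> bool"
  for L where
  zeroth: "M \<in> mod_cat L \<Longrightarrow> is_syzygy L 0 M M"
| step: "\<lbrakk>is_syzygy L n M N; projective_cover L P N p; K \<in> mod_cat L; j \<in> mod_hom L K P;
    inj_on j (carrier K); j ` carrier K = mod_ker P N p\<rbrakk> \<Longrightarrow> is_syzygy L (Suc n) M K"

text \<open>Exactness of
  \<open>0 \<rightarrow> W m \<rightarrow> \<dots> \<rightarrow> W 1 \<rightarrow> W 0 \<rightarrow> N \<rightarrow> 0\<close>, where \<open>\<delta> 0 : W 0 \<rightarrow> N\<close> and
  \<open>\<delta> (i + 1) : W (i + 1) \<rightarrow> W i\<close>.\<close>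

definition exact_resolution ::
  "('a, 'q) ring_scheme \<Rightarrow> nat \<Rightarrow> (nat \<Rightarrow> ('a, 'a melt) module) \<Rightarrow>
   (nat \<Rightarrow> 'a melt \<Rightarrow> 'a melt) \<Rightarrow> ('a, 'a melt) module \<Rightarrow> bool" where
  "exact_resolution L m W \<delta> N \<longleftrightarrow>
     \<delta> 0 \<in> mod_hom L (W 0) N \<and> (\<forall>i<m. \<delta> (Suc i) \<in> mod_hom L (W (Suc i)) (W i)) \<and>
     \<delta> 0 ` carrier (W 0) = carrier N \<and>
     (\<forall>i<m. \<delta> (Suc i) ` carrier (W (Suc i)) = mod_ker (W i) (if i = 0 then N else W (i - 1)) (\<delta> i)) \<and>
     inj_on (\<delta> m) (carrier (W m))"

text \<open>Over an artin algebra the \<open>n\<close>-th syzygy exists and is unique up to isomorphism, so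
  the quantifier over \<open>N\<close> just names a copy of it.\<close>

definition igusa_todorov :: "nat \<Rightarrow> nat \<Rightarrow> ('a, 'q) ring_scheme \<Rightarrow> bool" where
  "igusa_todorov m n L \<longleftrightarrow>
     (\<exists>V\<in>mod_cat L. \<forall>M\<in>mod_cat L. \<exists>N. is_syzygy L n M N \<and>
        (\<exists>W \<delta>. (\<forall>i\<le>m. W i \<in> add_closure L V) \<and> exact_resolution L m W \<delta> N))"


section \<open>Bounded complexes\<close>

text \<open>Cohomological grading: \<open>cdiff X i\<close> maps \<open>cobj X i\<close> to \<open>cobj X (i + 1)\<close>. All maps are
  relevant only on the carriers.\<close>

record 'a cpx =
  cobj :: "int \<Rightarrow> ('a, 'a melt) module"
  cdiff :: "int \<Rightarrow> 'a melt \<Rightarrow> 'a melt"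

type_synonym 'a gmap = "int \<Rightarrow> 'a melt \<Rightarrow> 'a melt"

definition bcpx :: "('a, 'q) ring_scheme \<Rightarrow> 'a cpx set" where
  "bcpx L = {X. (\<forall>i. cobj X i \<in> mod_cat L) \<and>
     (\<forall>i. cdiff X i \<in> mod_hom L (cobj X i) (cobj X (i + 1))) \<and>
     (\<forall>i. \<forall>x\<in>carrier (cobj X i). cdiff X (i + 1) (cdiff X i x) = \<zero>\<^bsub>cobj X (i + 1 + 1)\<^esub>) \<and>
     (\<exists>b. \<forall>i. \<bar>i\<bar> > b \<longrightarrow> carrier (cobj X i) = {\<zero>\<^bsub>cobj X i\<^esub>})}"

definition chain_map :: "('a, 'q) ring_scheme \<Rightarrow> 'a cpx \<Rightarrow> 'a cpx \<Rightarrow> 'a gmap \<Rightarrow> bool" where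
  "chain_map L X Y f \<longleftrightarrow> (\<forall>i. f i \<in> mod_hom L (cobj X i) (cobj Y i)) \<and>
     (\<forall>i. \<forall>x\<in>carrier (cobj X i). f (i + 1) (cdiff X i x) = cdiff Y i (f i x))"

definition homotopic ::
  "('a, 'q) ring_scheme \<Rightarrow> 'a cpx \<Rightarrow> 'a cpx \<Rightarrow> 'a gmap \<Rightarrow> 'a gmap \<Rightarrow> bool" where
  "homotopic L X Y f g \<longleftrightarrow>
     (\<exists>h. (\<forall>i. h i \<in> mod_hom L (cobj X i) (cobj Y (i - 1))) \<and>
        (\<forall>i. \<forall>x\<in>carrier (cobj X i).
           f i x = g i x \<oplus>\<^bsub>cobj Y i\<^esub> (cdiff Y (i - 1) (h i x) \<oplus>\<^bsub>cobj Y i\<^esub> h (i + 1) (cdiff X i x))))"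

definition gid :: "'a gmap" where
  "gid = (\<lambda>i x. x)"

definition gcomp :: "'a gmap \<Rightarrow> 'a gmap \<Rightarrow> 'a gmap" where
  "gcomp g f = (\<lambda>i x. g i (f i x))"

definition cocycles :: "'a cpx \<Rightarrow> int \<Rightarrow> 'a melt set" where
  "cocycles X i = mod_ker (cobj X i) (cobj X (i + 1)) (cdiff X i)"

definition coboundaries :: "'a cpx \<Rightarrow> int \<Rightarrow> 'a melt set" where
  "coboundaries X i = cdiff X (i - 1) ` carrier (cobj X (i - 1))"

definition cohomology :: "'a cpx \<Rightarrow> int \<Rightarrow> 'a melt set set" where
  "cohomology X i = (\<lambda>x. coboundaries X i +>\<^bsub>cobj X i\<^esub> x) ` cocycles X i"

text \<open>The induced map on cohomology; for a chain map \<open>f\<close> all cosets in the union coincide.\<close>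

definition cohomology_map :: "'a cpx \<Rightarrow> 'a gmap \<Rightarrow> int \<Rightarrow> 'a melt set \<Rightarrow> 'a melt set" where
  "cohomology_map Y f i C = (\<Union>x\<in>C. coboundaries Y i +>\<^bsub>cobj Y i\<^esub> f i x)"

definition quasi_iso :: "('a, 'q) ring_scheme \<Rightarrow> 'a cpx \<Rightarrow> 'a cpx \<Rightarrow> 'a gmap \<Rightarrow> bool" where
  "quasi_iso L X Y f \<longleftrightarrow> chain_map L X Y f \<and>
     (\<forall>i. bij_betw (cohomology_map Y f i) (cohomology X i) (cohomology Y i))"

definition cpx_zero :: "('a, 'q) ring_scheme \<Rightarrow> 'a cpx" where
  "cpx_zero L = \<lparr>cobj = (\<lambda>i. zero_mod L), cdiff = (\<lambda>i x. x)\<rparr>"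

definition cpx_sum :: "'a cpx \<Rightarrow> 'a cpx \<Rightarrow> 'a cpx" where
  "cpx_sum X Y = \<lparr>cobj = (\<lambda>i. mod_sum (cobj X i) (cobj Y i)),
     cdiff = (\<lambda>i p. Join (cdiff X i (lft p)) (cdiff Y i (rgt p)))\<rparr>"

primrec cpx_sum_list :: "('a, 'q) ring_scheme \<Rightarrow> 'a cpx list \<Rightarrow> 'a cpx" where
  "cpx_sum_list L [] = cpx_zero L"
| "cpx_sum_list L (X # Xs) = cpx_sum X (cpx_sum_list L Xs)"

text \<open>The shift \<open>X[n]\<close> has differential \<open>(-1)\<^sup>n d\<close>.\<close>

definition cpx_shift :: "int \<Rightarrow> 'a cpx \<Rightarrow> 'a cpx" where
  "cpx_shift n X = \<lparr>cobj = (\<lambda>i. cobj X (i + n)),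
     cdiff = (\<lambda>i x. if even n then cdiff X (i + n) x
                    else \<ominus>\<^bsub>cobj X (i + n + 1)\<^esub> cdiff X (i + n) x)\<rparr>"

definition gshift :: "int \<Rightarrow> 'a gmap \<Rightarrow> 'a gmap" where
  "gshift n f = (\<lambda>i. f (i + n))"

text \<open>The cone of \<open>f : X \<rightarrow> Y\<close> is \<open>X[1] \<oplus> Y\<close> with differential
  \<open>(x, y) \<mapsto> (- d x, f x + d y)\<close>.\<close>

definition cone :: "'a cpx \<Rightarrow> 'a cpx \<Rightarrow> 'a gmap \<Rightarrow> 'a cpx" where
  "cone X Y f = \<lparr>cobj = (\<lambda>i. mod_sum (cobj X (i + 1)) (cobj Y i)),
     cdiff = (\<lambda>i p. Join (\<ominus>\<^bsub>cobj X (i + 1 + 1)\<^esub> cdiff X (i + 1) (lft p))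
                         (f (i + 1) (lft p) \<oplus>\<^bsub>cobj Y (i + 1)\<^esub> cdiff Y i (rgt p)))\<rparr>"

definition cone_in :: "'a cpx \<Rightarrow> 'a gmap" where
  "cone_in X = (\<lambda>i y. Join \<zero>\<^bsub>cobj X (i + 1)\<^esub> y)"

definition cone_out :: "'a gmap" where
  "cone_out = (\<lambda>i p. lft p)"


section \<open>The bounded derived category\<close>

text \<open>The category \<open>D\<^sup>b(mod L)\<close> is the localization of the homotopy category of bounded complexes
  at the quasi-isomorphisms, described by the calculus of fractions. A morphism \<open>X \<rightarrow> Y\<close> is
  represented by a roof \<open>X \<leftarrow> Z \<rightarrow> Y\<close> whose left leg \<open>den\<close> is a quasi-isomorphism;
  \<open>db_eq\<close> is equality of the represented morphisms, and \<open>db_comp L X Y Z r t c\<close> says that \<open>c\<close>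
  represents the composite of \<open>r : X \<rightarrow> Y\<close> followed by \<open>t : Y \<rightarrow> Z\<close>. Morphisms are
  thus handled through representatives rather than as equivalence classes.\<close>

record 'a roof =
  apex :: "'a cpx"
  den :: "'a gmap"
  num :: "'a gmap"

definition db_hom :: "('a, 'q) ring_scheme \<Rightarrow> 'a cpx \<Rightarrow> 'a cpx \<Rightarrow> 'a roof set" where
  "db_hom L X Y = {r. X \<in> bcpx L \<and> Y \<in> bcpx L \<and> apex r \<in> bcpx L \<and>
     quasi_iso L (apex r) X (den r) \<and> chain_map L (apex r) Y (num r)}"

definition db_eq ::
  "('a, 'q) ring_scheme \<Rightarrow> 'a cpx \<Rightarrow> 'a cpx \<Rightarrow> 'a roof \<Rightarrow> 'a roof \<Rightarrow> bool" where
  "db_eq L X Y r r' \<longleftrightarrow> r \<in> db_hom L X Y \<and> r' \<in> db_hom L X Y \<and>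
     (\<exists>W\<in>bcpx L. \<exists>u v. chain_map L W (apex r) u \<and> chain_map L W (apex r') v \<and>
        quasi_iso L W X (gcomp (den r) u) \<and>
        homotopic L W X (gcomp (den r) u) (gcomp (den r') v) \<and>
        homotopic L W Y (gcomp (num r) u) (gcomp (num r') v))"

definition db_comp ::
  "('a, 'q) ring_scheme \<Rightarrow> 'a cpx \<Rightarrow> 'a cpx \<Rightarrow> 'a cpx \<Rightarrow> 'a roof \<Rightarrow> 'a roof \<Rightarrow> 'a roof \<Rightarrow> bool" where
  "db_comp L X Y Z r t c \<longleftrightarrow> r \<in> db_hom L X Y \<and> t \<in> db_hom L Y Z \<and> c \<in> db_hom L X Z \<and>
     (\<exists>W\<in>bcpx L. \<exists>u v. quasi_iso L W (apex r) u \<and> chain_map L W (apex t) v \<and>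
        homotopic L W Y (gcomp (num r) u) (gcomp (den t) v) \<and>
        db_eq L X Z c \<lparr>apex = W, den = gcomp (den r) u, num = gcomp (num t) v\<rparr>)"

definition db_of_map :: "'a cpx \<Rightarrow> 'a gmap \<Rightarrow> 'a roof" where
  "db_of_map X f = \<lparr>apex = X, den = gid, num = f\<rparr>"

definition db_shift :: "int \<Rightarrow> 'a roof \<Rightarrow> 'a roof" where
  "db_shift n r = \<lparr>apex = cpx_shift n (apex r), den = gshift n (den r), num = gshift n (num r)\<rparr>"

definition db_iso :: "('a, 'q) ring_scheme \<Rightarrow> 'a cpx \<Rightarrow> 'a cpx \<Rightarrow> 'a roof \<Rightarrow> bool" where
  "db_iso L X Y r \<longleftrightarrow>
     (\<exists>t. db_comp L X Y X r t (db_of_map X gid) \<and> db_comp L Y X Y t r (db_of_map Y gid))"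

definition db_isomorphic :: "('a, 'q) ring_scheme \<Rightarrow> 'a cpx \<Rightarrow> 'a cpx \<Rightarrow> bool" where
  "db_isomorphic L X Y \<longleftrightarrow> (\<exists>r. db_iso L X Y r)"

text \<open>\<open>db_square L X Y X' Y' a b s t\<close>: the square with horizontal arrows \<open>a : X \<rightarrow> Y\<close>,
  \<open>b : X' \<rightarrow> Y'\<close> and vertical arrows \<open>s : X \<rightarrow> X'\<close>, \<open>t : Y \<rightarrow> Y'\<close> commutes.\<close>

definition db_square ::
  "('a, 'q) ring_scheme \<Rightarrow> 'a cpx \<Rightarrow> 'a cpx \<Rightarrow> 'a cpx \<Rightarrow> 'a cpx \<Rightarrow>
   'a roof \<Rightarrow> 'a roof \<Rightarrow> 'a roof \<Rightarrow> 'a roof \<Rightarrow> bool" where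
  "db_square L X Y X' Y' a b s t \<longleftrightarrow>
     (\<exists>c. db_comp L X Y Y' a t c \<and> db_comp L X X' Y' s b c)"

text \<open>A triangle \<open>X \<rightarrow> Y \<rightarrow> Z \<rightarrow> X[1]\<close> is distinguished if it is isomorphic in the derived
  category to \<open>A \<rightarrow> B \<rightarrow> cone f \<rightarrow> A[1]\<close> for a chain map \<open>f : A \<rightarrow> B\<close>.\<close>

definition db_triangle ::
  "('a, 'q) ring_scheme \<Rightarrow> 'a cpx \<Rightarrow> 'a cpx \<Rightarrow> 'a cpx \<Rightarrow>
   'a roof \<Rightarrow> 'a roof \<Rightarrow> 'a roof \<Rightarrow> bool" where
  "db_triangle L X Y Z a b c \<longleftrightarrow>
     a \<in> db_hom L X Y \<and> b \<in> db_hom L Y Z \<and> c \<in> db_hom L Z (cpx_shift 1 X) \<and>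
     (\<exists>A\<in>bcpx L. \<exists>B\<in>bcpx L. \<exists>f. chain_map L A B f \<and>
        (\<exists>\<alpha> \<beta> \<gamma>. db_iso L A X \<alpha> \<and> db_iso L B Y \<beta> \<and> db_iso L (cone A B f) Z \<gamma> \<and>
           db_square L A B X Y (db_of_map A f) a \<alpha> \<beta> \<and>
           db_square L B (cone A B f) Y Z (db_of_map B (cone_in A)) b \<beta> \<gamma> \<and>
           db_square L (cone A B f) (cpx_shift 1 A) Z (cpx_shift 1 X)
             (db_of_map (cone A B f) cone_out) c \<gamma> (db_shift 1 \<alpha>)))"


section \<open>Dimension of the bounded derived category\<close>

definition db_gen_one :: "('a, 'q) ring_scheme \<Rightarrow> 'a cpx set \<Rightarrow> 'a cpx set" where
  "db_gen_one L I = {X \<in> bcpx L. \<exists>X'\<in>bcpx L. \<exists>Ys.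
     set Ys \<subseteq> {cpx_shift n Y | n Y. Y \<in> I} \<and>
     db_isomorphic L (cpx_sum X X') (cpx_sum_list L Ys)}"

definition db_star :: "('a, 'q) ring_scheme \<Rightarrow> 'a cpx set \<Rightarrow> 'a cpx set \<Rightarrow> 'a cpx set" where
  "db_star L I1 I2 = {X \<in> bcpx L. \<exists>X1\<in>I1. \<exists>X2\<in>I2. \<exists>a b c. db_triangle L X1 X X2 a b c}"

definition db_diamond :: "('a, 'q) ring_scheme \<Rightarrow> 'a cpx set \<Rightarrow> 'a cpx set \<Rightarrow> 'a cpx set" where
  "db_diamond L I1 I2 = db_gen_one L (db_star L I1 I2)"

fun db_gen :: "('a, 'q) ring_scheme \<Rightarrow> 'a cpx set \<Rightarrow> nat \<Rightarrow> 'a cpx set" where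
  "db_gen L I 0 = {X \<in> bcpx L. db_isomorphic L X (cpx_zero L)}"
| "db_gen L I (Suc 0) = db_gen_one L I"
| "db_gen L I (Suc (Suc k)) = db_diamond L (db_gen L I (Suc k)) (db_gen_one L I)"

text \<open>In \<open>enat\<close> the infimum of the empty set is \<open>\<infinity>\<close>.\<close>

definition tri_dim_db :: "('a, 'q) ring_scheme \<Rightarrow> enat" where
  "tri_dim_db L = Inf {enat d | d. \<exists>M\<in>bcpx L. db_gen L {M} (d + 1) = bcpx L}"

end

theory Submission
  imports Defs
begin

text \<open>For a bounded complex \<open>X\<close>, the cocycles \<open>Z\<close> and the coboundaries \<open>B\<close>, taken with zero
  differential, form an exact sequence \<open>0 \<rightarrow> Z \<rightarrow> X \<rightarrow> B[1] \<rightarrow> 0\<close>. In the first \<open>n\<close> steps of a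
  Cartan--Eilenberg resolution of \<open>X\<close> each term is isomorphic in the derived category to a sum of shifted
  projectives and costs one step of generation; the cocycles and coboundaries of the remaining kernel
  are \<open>n\<close>-th syzygies up to projective summands. Resolving these two by \<open>add V\<close> costs \<open>m + 1\<close> steps
  each, so that \<open>V \<oplus> \<Lambda>\<close> generates in \<open>n + 2 (m + 1)\<close> steps.\<close>

section \<open>Artin algebras are noetherian\<close>

text \<open>Adding lengths in a triangulated category usually rests on the octahedral axiom. It is
  avoided by measuring generation with degreewise exact sequences of complexes and honest chain
  maps, and by charging an object for what it adds to an arbitrary extension; roofs enter only when
  such sequences are turned into triangles. A projective step costs one and not two because the
  projectives covering the coboundaries occur in contractible two-term complexes, which the derived
  category does not see. The splitting into cocycles and coboundaries is postponed to the end, so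
  that it doubles \<open>m + 1\<close> but not \<open>n\<close>. The cocycles acquire a projective
  summand at each step; the summand \<Lambda> of the generator absorbs it and also supplies the
  projective terms. Kernels, cocycles and coboundaries must stay finitely generated, whereas an
  artin algebra is given by a descending chain condition on its base ring; hence the detour through
  the noetherian property. Dimension \<open>d\<close> means \<open>d + 1\<close> steps, and
  \<open>n + 2 (m + 1) = (2 m + n + 1) + 1\<close>.\<close>

definition rsub :: "('a, 'q) ring_scheme \<Rightarrow> ('a, 'b) module \<Rightarrow> 'b set \<Rightarrow> bool" where
  "rsub R M U \<longleftrightarrow> U \<subseteq> carrier M \<and> \<zero>\<^bsub>M\<^esub> \<in> U \<and> (\<forall>x\<in>U. \<forall>y\<in>U. x \<oplus>\<^bsub>M\<^esub> y \<in> U) \<and>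
     (\<forall>a\<in>carrier R. \<forall>x\<in>U. a \<odot>\<^bsub>M\<^esub> x \<in> U)"

text \<open>Finite generation by a universal property instead of linear combinations. Scalars occur
  only inside \<open>rsub\<close>, so a generating set passes from the base ring to the algebra by
  comparing submodules.\<close>

definition fg_sub :: "('a, 'q) ring_scheme \<Rightarrow> ('a, 'b) module \<Rightarrow> 'b set \<Rightarrow> bool" where
  "fg_sub R M U \<longleftrightarrow> (\<exists>S. finite S \<and> S \<subseteq> U \<and> (\<forall>T. rsub R M T \<and> S \<subseteq> T \<longrightarrow> U \<subseteq> T))"

definition submod :: "('a, 'b) module \<Rightarrow> 'b set \<Rightarrow> ('a, 'b) module" where
  "submod M U = M\<lparr>carrier := U\<rparr>"

lemma submod_simps [simp]:
  "carrier (submod M U) = U" "\<zero>\<^bsub>submod M U\<^esub> = \<zero>\<^bsub>M\<^esub>"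
  "x \<oplus>\<^bsub>submod M U\<^esub> y = x \<oplus>\<^bsub>M\<^esub> y" "a \<odot>\<^bsub>submod M U\<^esub> x = a \<odot>\<^bsub>M\<^esub> x"
  by (simp_all add: submod_def)

lemma rsubI:
  assumes "U \<subseteq> carrier M" "\<zero>\<^bsub>M\<^esub> \<in> U" "\<And>x y. x \<in> U \<Longrightarrow> y \<in> U \<Longrightarrow> x \<oplus>\<^bsub>M\<^esub> y \<in> U"
    "\<And>a x. a \<in> carrier R \<Longrightarrow> x \<in> U \<Longrightarrow> a \<odot>\<^bsub>M\<^esub> x \<in> U"
  shows "rsub R M U"
  using assms by (auto simp: rsub_def)

lemma rsubD:
  assumes "rsub R M U"
  shows "U \<subseteq> carrier M" "\<And>x. x \<in> U \<Longrightarrow> x \<in> carrier M" "\<zero>\<^bsub>M\<^esub> \<in> U"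
    "\<And>x y. x \<in> U \<Longrightarrow> y \<in> U \<Longrightarrow> x \<oplus>\<^bsub>M\<^esub> y \<in> U"
    "\<And>a x. a \<in> carrier R \<Longrightarrow> x \<in> U \<Longrightarrow> a \<odot>\<^bsub>M\<^esub> x \<in> U"
  using assms by (auto simp: rsub_def)

lemma fg_subI:
  assumes "finite S" "S \<subseteq> U" "\<And>T. rsub R M T \<Longrightarrow> S \<subseteq> T \<Longrightarrow> U \<subseteq> T"
  shows "fg_sub R M U"
  unfolding fg_sub_def by (rule exI[of _ S]) (simp add: assms)

lemma fg_subE:
  assumes "fg_sub R M U"
  obtains S where "finite S" "S \<subseteq> U" "\<And>T. rsub R M T \<Longrightarrow> S \<subseteq> T \<Longrightarrow> U \<subseteq> T"
  using assms unfolding fg_sub_def by (elim exE conjE) simp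

section \<open>Submodules, homomorphisms and finite generation of right modules\<close>

context right_module
begin

lemma smult_zero [simp]: "a \<in> carrier R \<Longrightarrow> a \<odot>\<^bsub>M\<^esub> \<zero>\<^bsub>M\<^esub> = \<zero>\<^bsub>M\<^esub>"
  using smult_r_distr[of a "\<zero>\<^bsub>M\<^esub>" "\<zero>\<^bsub>M\<^esub>"] smult_closed[of a "\<zero>\<^bsub>M\<^esub>"]
  by (metis M.add.l_cancel_one M.l_zero M.zero_closed)

lemma zero_smult [simp]: "x \<in> carrier M \<Longrightarrow> \<zero> \<odot>\<^bsub>M\<^esub> x = \<zero>\<^bsub>M\<^esub>"
  using smult_l_distr[of "\<zero>" "\<zero>" x] smult_closed[of "\<zero>" x]
  by (metis M.add.l_cancel_one R.l_zero R.zero_closed)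

lemma minus_one_smult: "x \<in> carrier M \<Longrightarrow> (\<ominus> \<one>) \<odot>\<^bsub>M\<^esub> x = \<ominus>\<^bsub>M\<^esub> x"
proof -
  assume x: "x \<in> carrier M"
  have "(\<ominus> \<one>) \<odot>\<^bsub>M\<^esub> x \<oplus>\<^bsub>M\<^esub> x = (\<ominus> \<one> \<oplus> \<one>) \<odot>\<^bsub>M\<^esub> x"
    using x by (simp add: smult_l_distr smult_one)
  also have "\<dots> = \<zero>\<^bsub>M\<^esub>" using x by (simp add: R.l_neg)
  finally show ?thesis using x
    by (metis M.minus_equality R.add.inv_closed R.one_closed smult_closed)
qed

lemma smult_minus: "a \<in> carrier R \<Longrightarrow> x \<in> carrier M \<Longrightarrow> a \<odot>\<^bsub>M\<^esub> (\<ominus>\<^bsub>M\<^esub> x) = \<ominus>\<^bsub>M\<^esub> (a \<odot>\<^bsub>M\<^esub> x)"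
  by (metis M.add.inv_closed M.l_neg M.minus_equality smult_closed smult_r_distr smult_zero)

end

text \<open>Negation is the action of \<ominus> \<one>, so closure under it follows from closure
  under scalars.\<close>

lemma rsub_minus:
  assumes "right_module R M" "rsub R M U" "x \<in> U"
  shows "\<ominus>\<^bsub>M\<^esub> x \<in> U"
proof -
  interpret M: right_module R M by fact
  show ?thesis
    using M.minus_one_smult[of x] rsubD(2,5)[OF assms(2)] assms(3) M.R.add.inv_closed[OF M.R.one_closed]
    by metis
qed

lemma rsub_diff:
  assumes "right_module R M" "rsub R M U" "x \<in> U" "y \<in> U"
  shows "x \<ominus>\<^bsub>M\<^esub> y \<in> U"
  unfolding a_minus_def using rsub_minus[OF assms(1,2,4)] rsubD(4)[OF assms(2)] assms(3) by blast

lemma rsub_carrier: "right_module R M \<Longrightarrow> rsub R M (carrier M)"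
proof -
  assume "right_module R M"
  then interpret M: right_module R M .
  show ?thesis by (auto intro!: rsubI M.smult_closed)
qed

lemma rsub_finsum:
  assumes "right_module R M" "rsub R M U" "finite S" "\<And>s. s \<in> S \<Longrightarrow> f s \<in> U"
  shows "(\<Oplus>\<^bsub>M\<^esub>s\<in>S. f s) \<in> U"
proof -
  interpret M: right_module R M by fact
  show ?thesis using assms(3,4)
  proof (induction S rule: finite_induct)
    case empty
    then show ?case using rsubD(3)[OF assms(2)] by simp
  next
    case (insert s S)
    have "f \<in> S \<rightarrow> carrier M" "f s \<in> carrier M"
      using insert rsubD(1)[OF assms(2)] by auto
    then show ?case using insert rsubD(4)[OF assms(2)] by (simp add: M.finsum_insert)
  qed
qed

lemma right_module_submod:
  assumes "right_module R M" "rsub R M U"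
  shows "right_module R (submod M U)"
proof -
  interpret M: right_module R M by fact
  note U = rsubD[OF assms(2)]
  have ab: "abelian_group (submod M U)"
  proof (rule abelian_groupI)
    fix x assume x: "x \<in> carrier (submod M U)"
    then show "\<exists>y\<in>carrier (submod M U). y \<oplus>\<^bsub>submod M U\<^esub> x = \<zero>\<^bsub>submod M U\<^esub>"
      using rsub_minus[OF assms] U(2) by (intro bexI[of _ "\<ominus>\<^bsub>M\<^esub> x"]) (auto simp: M.l_neg)
  qed (use U(2-5) in \<open>auto simp: M.a_ac\<close>)
  interpret N: abelian_group "submod M U" by (rule ab)
  show ?thesis
    by unfold_locales
      (use U in \<open>auto simp: M.smult_l_distr M.smult_r_distr M.smult_assoc M.smult_one\<close>)
qed

text \<open>Linear combinations of \<open>S\<close> lie in every submodule containing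
  \<open>S\<close>. Conversely the set \<open>T\<close> of all these combinations is such a
  submodule, hence exhausts the carrier.\<close>

lemma fin_gen_iff:
  assumes "right_module R M"
  shows "fin_gen R M \<longleftrightarrow> fg_sub R M (carrier M)"
proof -
  interpret M: right_module R M by fact
  show ?thesis
  proof
    assume "fin_gen R M"
    then obtain S where S: "finite S" "S \<subseteq> carrier M"
      "\<And>x. x \<in> carrier M \<Longrightarrow> \<exists>c\<in>S \<rightarrow> carrier R. x = (\<Oplus>\<^bsub>M\<^esub>s\<in>S. c s \<odot>\<^bsub>M\<^esub> s)"
      unfolding fin_gen_def by blast
    have "carrier M \<subseteq> T" if T: "rsub R M T" "S \<subseteq> T" for T
    proof
      fix x assume "x \<in> carrier M"
      then obtain c where c: "c \<in> S \<rightarrow> carrier R" "x = (\<Oplus>\<^bsub>M\<^esub>s\<in>S. c s \<odot>\<^bsub>M\<^esub> s)"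
        using S(3) by blast
      show "x \<in> T" unfolding c(2)
        by (rule rsub_finsum[OF assms T(1) S(1)]) (use c(1) T rsubD(5)[OF T(1)] in blast)
    qed
    then show "fg_sub R M (carrier M)" by (rule fg_subI[OF S(1,2)])
  next
    assume "fg_sub R M (carrier M)"
    then obtain S where S: "finite S" "S \<subseteq> carrier M" "\<And>T. rsub R M T \<Longrightarrow> S \<subseteq> T \<Longrightarrow> carrier M \<subseteq> T"
      by (rule fg_subE) blast
    define T where "T = {\<Oplus>\<^bsub>M\<^esub>s\<in>S. c s \<odot>\<^bsub>M\<^esub> s | c. c \<in> S \<rightarrow> carrier R}"
    have mem: "(\<lambda>s. c s \<odot>\<^bsub>M\<^esub> s) \<in> S \<rightarrow> carrier M" if "c \<in> S \<rightarrow> carrier R" for c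
      using that S(2) M.smult_closed by (auto simp: Pi_iff subset_iff)
    have "rsub R M T"
    proof (rule rsubI)
      show "T \<subseteq> carrier M" unfolding T_def using M.finsum_closed[OF mem] by blast
      have "(\<Oplus>\<^bsub>M\<^esub>s\<in>S. \<zero>\<^bsub>R\<^esub> \<odot>\<^bsub>M\<^esub> s) = (\<Oplus>\<^bsub>M\<^esub>s\<in>S. \<zero>\<^bsub>M\<^esub>)"
        using S(2) by (intro M.finsum_cong') auto
      also have "\<dots> = \<zero>\<^bsub>M\<^esub>" by (rule M.finsum_zero)
      finally show "\<zero>\<^bsub>M\<^esub> \<in> T" unfolding T_def using M.R.zero_closed
        by (intro CollectI exI[of _ "\<lambda>_. \<zero>\<^bsub>R\<^esub>"]) auto
    next
      fix x y assume "x \<in> T" "y \<in> T"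
      then obtain c d where c: "c \<in> S \<rightarrow> carrier R" "x = (\<Oplus>\<^bsub>M\<^esub>s\<in>S. c s \<odot>\<^bsub>M\<^esub> s)"
        and d: "d \<in> S \<rightarrow> carrier R" "y = (\<Oplus>\<^bsub>M\<^esub>s\<in>S. d s \<odot>\<^bsub>M\<^esub> s)" unfolding T_def by blast
      have "x \<oplus>\<^bsub>M\<^esub> y = (\<Oplus>\<^bsub>M\<^esub>s\<in>S. c s \<odot>\<^bsub>M\<^esub> s \<oplus>\<^bsub>M\<^esub> d s \<odot>\<^bsub>M\<^esub> s)"
        unfolding c(2) d(2) by (rule M.finsum_addf[OF mem[OF c(1)] mem[OF d(1)], symmetric])
      also have "\<dots> = (\<Oplus>\<^bsub>M\<^esub>s\<in>S. (c s \<oplus>\<^bsub>R\<^esub> d s) \<odot>\<^bsub>M\<^esub> s)"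
        using c(1) d(1) S(2) by (intro M.finsum_cong')
          (auto simp: M.smult_l_distr Pi_iff subset_iff intro!: M.smult_closed)
      finally show "x \<oplus>\<^bsub>M\<^esub> y \<in> T" unfolding T_def using c(1) d(1)
        by (intro CollectI exI[of _ "\<lambda>s. c s \<oplus>\<^bsub>R\<^esub> d s"]) auto
    next
      fix a x assume a: "a \<in> carrier R" and "x \<in> T"
      then obtain c where c: "c \<in> S \<rightarrow> carrier R" "x = (\<Oplus>\<^bsub>M\<^esub>s\<in>S. c s \<odot>\<^bsub>M\<^esub> s)"
        unfolding T_def by blast
      \<comment> \<open>Acting by \<open>a\<close> multiplies the coefficients by \<open>a\<close>
        from the right, as befits a right action.\<close>
      have "a \<odot>\<^bsub>M\<^esub> (\<Oplus>\<^bsub>M\<^esub>s\<in>S'. c s \<odot>\<^bsub>M\<^esub> s) = (\<Oplus>\<^bsub>M\<^esub>s\<in>S'. (c s \<otimes>\<^bsub>R\<^esub> a) \<odot>\<^bsub>M\<^esub> s)" if "S' \<subseteq> S" for S'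
        using finite_subset[OF that S(1)] that
      proof (induction S' rule: finite_induct)
        case empty
        then show ?case using a by simp
      next
        case (insert s S')
        have m1: "(\<lambda>s. c s \<odot>\<^bsub>M\<^esub> s) \<in> S' \<rightarrow> carrier M" using mem[OF c(1)] insert by auto
        have m2: "(\<lambda>s. (c s \<otimes>\<^bsub>R\<^esub> a) \<odot>\<^bsub>M\<^esub> s) \<in> S' \<rightarrow> carrier M"
          using c(1) a S(2) insert by (auto simp: Pi_iff subset_iff intro!: M.smult_closed)
        have s: "c s \<in> carrier R" "s \<in> carrier M" using c(1) S(2) insert by auto
        show ?case using insert a s m1 m2
          by (simp add: M.finsum_insert M.smult_closed M.smult_r_distr M.smult_assoc M.finsum_closed)
      qed
      from this[of S] have "a \<odot>\<^bsub>M\<^esub> x = (\<Oplus>\<^bsub>M\<^esub>s\<in>S. (c s \<otimes>\<^bsub>R\<^esub> a) \<odot>\<^bsub>M\<^esub> s)" using c(2) by simp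
      then show "a \<odot>\<^bsub>M\<^esub> x \<in> T" unfolding T_def using c(1) a
        by (intro CollectI exI[of _ "\<lambda>s. c s \<otimes>\<^bsub>R\<^esub> a"]) auto
    qed
    moreover have "S \<subseteq> T"
    proof
      fix s assume s: "s \<in> S"
      have "(\<Oplus>\<^bsub>M\<^esub>t\<in>S. (if s = t then \<one>\<^bsub>R\<^esub> else \<zero>\<^bsub>R\<^esub>) \<odot>\<^bsub>M\<^esub> t) = (\<Oplus>\<^bsub>M\<^esub>t\<in>S. if s = t then t else \<zero>\<^bsub>M\<^esub>)"
        using S(2) by (intro M.finsum_cong') (auto simp: M.smult_one)
      also have "\<dots> = s" using M.finsum_singleton[OF s S(1), of "\<lambda>x. x"] S(2) by auto
      finally show "s \<in> T" unfolding T_def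
        by (intro CollectI exI[of _ "\<lambda>t. if s = t then \<one>\<^bsub>R\<^esub> else \<zero>\<^bsub>R\<^esub>"]) auto
    qed
    ultimately have "carrier M \<subseteq> T" by (rule S(3))
    then show "fin_gen R M" unfolding fin_gen_def T_def using S(1,2) by blast
  qed
qed

lemma rsub_submod:
  assumes "rsub R M U"
  shows "rsub R (submod M U) T \<longleftrightarrow> rsub R M T \<and> T \<subseteq> U"
  using assms by (auto simp: rsub_def)

lemma rsub_Int: "rsub R M U \<Longrightarrow> rsub R M T \<Longrightarrow> rsub R M (U \<inter> T)"
  by (auto simp: rsub_def)

lemma fin_gen_submod:
  assumes M: "right_module R M" and U: "rsub R M U" and fg: "fg_sub R M U"
  shows "fin_gen R (submod M U)"
proof -
  obtain S where S: "finite S" "S \<subseteq> U" "\<And>T. rsub R M T \<Longrightarrow> S \<subseteq> T \<Longrightarrow> U \<subseteq> T"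
    using fg by (rule fg_subE) blast
  have "fg_sub R (submod M U) U"
    by (rule fg_subI[OF S(1,2)]) (simp add: rsub_submod[OF U] S(3))
  then show ?thesis by (simp add: fin_gen_iff[OF right_module_submod[OF M U]])
qed

lemma mod_homI:
  assumes "\<And>x. x \<in> carrier M \<Longrightarrow> f x \<in> carrier N"
    "\<And>x y. x \<in> carrier M \<Longrightarrow> y \<in> carrier M \<Longrightarrow> f (x \<oplus>\<^bsub>M\<^esub> y) = f x \<oplus>\<^bsub>N\<^esub> f y"
    "\<And>a x. a \<in> carrier L \<Longrightarrow> x \<in> carrier M \<Longrightarrow> f (a \<odot>\<^bsub>M\<^esub> x) = a \<odot>\<^bsub>N\<^esub> f x"
  shows "f \<in> mod_hom L M N"
  using assms by (auto simp: mod_hom_def)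

lemma mod_homD:
  assumes "f \<in> mod_hom L M N"
  shows "\<And>x. x \<in> carrier M \<Longrightarrow> f x \<in> carrier N"
    "\<And>x y. x \<in> carrier M \<Longrightarrow> y \<in> carrier M \<Longrightarrow> f (x \<oplus>\<^bsub>M\<^esub> y) = f x \<oplus>\<^bsub>N\<^esub> f y"
    "\<And>a x. a \<in> carrier L \<Longrightarrow> x \<in> carrier M \<Longrightarrow> f (a \<odot>\<^bsub>M\<^esub> x) = a \<odot>\<^bsub>N\<^esub> f x"
  using assms by (auto simp: mod_hom_def)

lemma mod_hom_zero:
  assumes "f \<in> mod_hom L M N" "abelian_group M" "abelian_group N"
  shows "f \<zero>\<^bsub>M\<^esub> = \<zero>\<^bsub>N\<^esub>"
proof -
  interpret M: abelian_group M by fact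
  interpret N: abelian_group N by fact
  have "f \<zero>\<^bsub>M\<^esub> \<oplus>\<^bsub>N\<^esub> f \<zero>\<^bsub>M\<^esub> = f \<zero>\<^bsub>M\<^esub>"
    using mod_homD(2)[OF assms(1) M.zero_closed M.zero_closed] by simp
  then show ?thesis using mod_homD(1)[OF assms(1) M.zero_closed] by simp
qed

lemma mod_hom_minus:
  assumes "f \<in> mod_hom L M N" "abelian_group M" "abelian_group N" "x \<in> carrier M"
  shows "f (\<ominus>\<^bsub>M\<^esub> x) = \<ominus>\<^bsub>N\<^esub> f x"
proof -
  interpret M: abelian_group M by fact
  interpret N: abelian_group N by fact
  have "f (\<ominus>\<^bsub>M\<^esub> x) \<oplus>\<^bsub>N\<^esub> f x = f (\<ominus>\<^bsub>M\<^esub> x \<oplus>\<^bsub>M\<^esub> x)"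
    using mod_homD(2)[OF assms(1), of "\<ominus>\<^bsub>M\<^esub> x" x] assms(4) by simp
  also have "\<dots> = \<zero>\<^bsub>N\<^esub>" using assms(4) mod_hom_zero[OF assms(1-3)] by (simp add: M.l_neg)
  finally show ?thesis using N.minus_equality mod_homD(1)[OF assms(1)] assms(4) by simp
qed

lemma rsub_trivial: "right_module L M \<Longrightarrow> rsub L M {\<zero>\<^bsub>M\<^esub>}"
proof -
  assume "right_module L M"
  then interpret M: right_module L M .
  show ?thesis by (rule rsubI) auto
qed

lemma rsub_ker:
  assumes "right_module L M" "right_module L N" "f \<in> mod_hom L M N"
  shows "rsub L M {x \<in> carrier M. f x = \<zero>\<^bsub>N\<^esub>}"
proof -
  interpret M: right_module L M by fact
  interpret N: right_module L N by fact
  have "f \<zero>\<^bsub>M\<^esub> = \<zero>\<^bsub>N\<^esub>" by (rule mod_hom_zero[OF assms(3)]) unfold_locales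
  then show ?thesis
    using mod_homD[OF assms(3)] by (intro rsubI) (auto simp: M.smult_closed)
qed

lemma rsub_image:
  assumes "right_module L M" "right_module L N" "f \<in> mod_hom L M N" "rsub L M U"
  shows "rsub L N (f ` U)"
proof -
  interpret M: right_module L M by fact
  interpret N: right_module L N by fact
  have f0: "f \<zero>\<^bsub>M\<^esub> = \<zero>\<^bsub>N\<^esub>" by (rule mod_hom_zero[OF assms(3)]) unfold_locales
  note D = mod_homD[OF assms(3)] and UD = rsubD[OF assms(4)]
  show ?thesis
  proof (rule rsubI)
    show "\<zero>\<^bsub>N\<^esub> \<in> f ` U" using f0 UD(3) by (metis imageI)
    fix u v assume "u \<in> f ` U" "v \<in> f ` U"
    then obtain x y where "x \<in> U" "y \<in> U" "u = f x" "v = f y" by blast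
    then show "u \<oplus>\<^bsub>N\<^esub> v \<in> f ` U" using UD by (intro image_eqI[of _ _ "x \<oplus>\<^bsub>M\<^esub> y"]) (auto simp: D)
  next
    fix a u assume a: "a \<in> carrier L" and "u \<in> f ` U"
    then obtain x where "x \<in> U" "u = f x" by blast
    then show "a \<odot>\<^bsub>N\<^esub> u \<in> f ` U" using UD a by (intro image_eqI[of _ _ "a \<odot>\<^bsub>M\<^esub> x"]) (auto simp: D)
  qed (use D UD in auto)
qed

section \<open>Finite generation from the descending chain condition over a commutative ring\<close>

lemma rsub_cyclic_sum:
  assumes "right_module R M" "cring R" "rsub R M T" "x \<in> carrier M"
  shows "rsub R M {t \<oplus>\<^bsub>M\<^esub> c \<odot>\<^bsub>M\<^esub> x | t c. t \<in> T \<and> c \<in> carrier R}" (is "rsub R M ?U")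
    and "T \<subseteq> {t \<oplus>\<^bsub>M\<^esub> c \<odot>\<^bsub>M\<^esub> x | t c. t \<in> T \<and> c \<in> carrier R}"
    and "x \<in> {t \<oplus>\<^bsub>M\<^esub> c \<odot>\<^bsub>M\<^esub> x | t c. t \<in> T \<and> c \<in> carrier R}"
proof -
  interpret M: right_module R M by fact
  interpret R: cring R by fact
  note T = rsubD[OF assms(3)]
  note x = assms(4)
  show TU: "T \<subseteq> ?U"
  proof
    fix t assume "t \<in> T"
    then show "t \<in> ?U" using T(2) x by (intro CollectI exI[of _ t] exI[of _ "\<zero>\<^bsub>R\<^esub>"]) auto
  qed
  show "x \<in> ?U" using T(3) x by (intro CollectI exI[of _ "\<zero>\<^bsub>M\<^esub>"] exI[of _ "\<one>\<^bsub>R\<^esub>"])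
    (auto simp: M.smult_one)
  show "rsub R M ?U"
  proof (rule rsubI)
    show "?U \<subseteq> carrier M" using T(2) x by (auto intro!: M.smult_closed)
    show "\<zero>\<^bsub>M\<^esub> \<in> ?U" using TU T(3) by blast
  next
    fix u v assume "u \<in> ?U" "v \<in> ?U"
    then obtain t c s d where *: "t \<in> T" "c \<in> carrier R" "u = t \<oplus>\<^bsub>M\<^esub> c \<odot>\<^bsub>M\<^esub> x"
      "s \<in> T" "d \<in> carrier R" "v = s \<oplus>\<^bsub>M\<^esub> d \<odot>\<^bsub>M\<^esub> x" by blast
    then have "u \<oplus>\<^bsub>M\<^esub> v = (t \<oplus>\<^bsub>M\<^esub> s) \<oplus>\<^bsub>M\<^esub> (c \<oplus>\<^bsub>R\<^esub> d) \<odot>\<^bsub>M\<^esub> x"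
      using T(2) x by (simp add: M.smult_l_distr M.smult_closed M.a_ac)
    then show "u \<oplus>\<^bsub>M\<^esub> v \<in> ?U" using * T(4) by blast
  next
    fix a u assume a: "a \<in> carrier R" and "u \<in> ?U"
    then obtain t c where *: "t \<in> T" "c \<in> carrier R" "u = t \<oplus>\<^bsub>M\<^esub> c \<odot>\<^bsub>M\<^esub> x" by blast
    then have "a \<odot>\<^bsub>M\<^esub> u = a \<odot>\<^bsub>M\<^esub> t \<oplus>\<^bsub>M\<^esub> (c \<otimes>\<^bsub>R\<^esub> a) \<odot>\<^bsub>M\<^esub> x"
      using T(2) x a by (simp add: M.smult_r_distr M.smult_closed M.smult_assoc)
    then show "a \<odot>\<^bsub>M\<^esub> u \<in> ?U" using * a T(5) by blast
  qed
qed

lemma fg_sub_insert: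
  assumes "fg_sub R M T" "T \<subseteq> U" "x \<in> U"
    and "\<And>W. rsub R M W \<Longrightarrow> T \<subseteq> W \<Longrightarrow> x \<in> W \<Longrightarrow> U \<subseteq> W"
  shows "fg_sub R M U"
proof -
  obtain S where S: "finite S" "S \<subseteq> T" "\<And>W. rsub R M W \<Longrightarrow> S \<subseteq> W \<Longrightarrow> T \<subseteq> W"
    using assms(1) by (rule fg_subE) blast
  show ?thesis
  proof (rule fg_subI)
    show "finite (insert x S)" "insert x S \<subseteq> U" using assms(2,3) S(1,2) by auto
    show "U \<subseteq> W" if "rsub R M W" "insert x S \<subseteq> W" for W
      using that assms(4) S(3) by auto
  qed
qed

text \<open>A minimal submodule \<open>I\<close> that is not finitely generated is acted upon by each scalar either
  as zero or surjectively, hence is a vector space, and a hyperplane of \<open>I\<close> contradicts minimality.\<close>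

lemma dcc_imp_fg:
  fixes M :: "('a, 'b) module"
  assumes M: "right_module R M" and R: "cring R"
    and dcc: "\<And>I :: nat \<Rightarrow> 'b set. \<forall>n. rsub R M (I n) \<Longrightarrow> \<forall>n. I (Suc n) \<subseteq> I n \<Longrightarrow> \<exists>N. \<forall>n\<ge>N. I n = I N"
    and pow: "\<And>a. a \<in> carrier R \<Longrightarrow> \<exists>n. \<exists>b\<in>carrier R. a [^]\<^bsub>R\<^esub> (n::nat) = a [^]\<^bsub>R\<^esub> n \<otimes>\<^bsub>R\<^esub> (a \<otimes>\<^bsub>R\<^esub> b)"
    and U: "rsub R M U"
  shows "fg_sub R M U"
proof (rule ccontr)
  assume nfg: "\<not> fg_sub R M U"
  interpret M: right_module R M by fact
  interpret R: cring R by fact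
  \<comment> \<open>The chain condition says that strict inclusion of submodules is well-founded;
    this yields \<open>I\<close>, minimal among the submodules that are not finitely
    generated.\<close>
  define r where "r = {(S, T). rsub R M S \<and> rsub R M T \<and> S \<subset> T}"
  have "wf r" unfolding wf_iff_no_infinite_down_chain
  proof
    assume "\<exists>f. \<forall>i. (f (Suc i), f i) \<in> r"
    then obtain f where f: "\<And>i. (f (Suc i), f i) \<in> r" by blast
    then have "\<forall>i. rsub R M (f i)" "\<forall>i. f (Suc i) \<subseteq> f i" by (auto simp: r_def)
    from dcc[OF this] obtain N where "f (Suc N) = f N" by (metis le_SucI order_refl)
    with f[of N] show False by (auto simp: r_def)
  qed
  then obtain I where I0: "I \<in> {T. rsub R M T \<and> \<not> fg_sub R M T}"
    and Im: "\<And>T. (T, I) \<in> r \<Longrightarrow> T \<notin> {T. rsub R M T \<and> \<not> fg_sub R M T}"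
    using wfE_min[of r U "{T. rsub R M T \<and> \<not> fg_sub R M T}"] U nfg by blast
  have I: "rsub R M I" and nfgI: "\<not> fg_sub R M I" using I0 by auto
  have min: "fg_sub R M T" if "rsub R M T" "T \<subset> I" for T
    using Im[of T] that I by (auto simp: r_def)
  note ID = rsubD[OF I]
  \<comment> \<open>Otherwise the image of \<open>I\<close> under \<open>a\<close> and the part of
    \<open>I\<close> killed by \<open>a\<close> are both proper submodules, hence finitely generated
    by minimality. Preimages of generators of the first together with generators of the second would
    generate \<open>I\<close>.\<close>
  have act: "(\<forall>x\<in>I. a \<odot>\<^bsub>M\<^esub> x = \<zero>\<^bsub>M\<^esub>) \<or> (\<forall>x\<in>I. \<exists>y\<in>I. x = a \<odot>\<^bsub>M\<^esub> y)" if a: "a \<in> carrier R" for a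
  proof (rule ccontr)
    assume neg: "\<not> ?thesis"
    let ?A = "(\<lambda>x. a \<odot>\<^bsub>M\<^esub> x) ` I"
    let ?B = "I \<inter> {x \<in> carrier M. a \<odot>\<^bsub>M\<^esub> x = \<zero>\<^bsub>M\<^esub>}"
    have comm: "b \<odot>\<^bsub>M\<^esub> (a \<odot>\<^bsub>M\<^esub> x) = a \<odot>\<^bsub>M\<^esub> (b \<odot>\<^bsub>M\<^esub> x)" if "b \<in> carrier R" "x \<in> carrier M" for b x
      using that a by (metis M.smult_assoc R.m_comm)
    have hom: "(\<lambda>x. a \<odot>\<^bsub>M\<^esub> x) \<in> mod_hom R M M"
      by (rule mod_homI) (use a comm in \<open>auto simp: M.smult_closed M.smult_r_distr\<close>)
    have "rsub R M ?A" by (rule rsub_image[OF M M hom I])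
    moreover have "?A \<subseteq> I" using ID(5)[OF a] by blast
    moreover have "?A \<noteq> I" using neg by blast
    ultimately have "fg_sub R M ?A" using min by blast
    then obtain S where S: "finite S" "S \<subseteq> ?A" "\<And>W. rsub R M W \<Longrightarrow> S \<subseteq> W \<Longrightarrow> ?A \<subseteq> W"
      by (rule fg_subE) blast
    have "rsub R M ?B" by (rule rsub_Int[OF I rsub_ker[OF M M hom]])
    moreover have "?B \<noteq> I" using neg by blast
    ultimately have "fg_sub R M ?B" using min by blast
    then obtain S' where S': "finite S'" "S' \<subseteq> ?B" "\<And>W. rsub R M W \<Longrightarrow> S' \<subseteq> W \<Longrightarrow> ?B \<subseteq> W"
      by (rule fg_subE) blast
    obtain S1 where S1: "finite S1" "S1 \<subseteq> I" "S = (\<lambda>x. a \<odot>\<^bsub>M\<^esub> x) ` S1"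
      using finite_subset_image[OF S(1,2)] by blast
    have "I \<subseteq> W" if W: "rsub R M W" "S1 \<union> S' \<subseteq> W" for W
    proof
      fix x assume x: "x \<in> I"
      note WD = rsubD[OF W(1)]
      let ?C = "(\<lambda>x. a \<odot>\<^bsub>M\<^esub> x) ` (W \<inter> I)"
      have "rsub R M ?C" by (rule rsub_image[OF M M hom rsub_Int[OF W(1) I]])
      moreover have "S \<subseteq> ?C" using S1 W(2) by blast
      ultimately have "a \<odot>\<^bsub>M\<^esub> x \<in> ?C" using S(3) x by blast
      then obtain w where w: "w \<in> W" "w \<in> I" "a \<odot>\<^bsub>M\<^esub> x = a \<odot>\<^bsub>M\<^esub> w" by blast
      have "a \<odot>\<^bsub>M\<^esub> (x \<ominus>\<^bsub>M\<^esub> w) = \<zero>\<^bsub>M\<^esub>" unfolding a_minus_def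
        using x w ID(2) a M.smult_closed[OF a] by (simp add: M.smult_r_distr M.smult_minus M.r_neg)
      then have "x \<ominus>\<^bsub>M\<^esub> w \<in> ?B" using rsub_diff[OF M I x w(2)] ID(2) by blast
      then have "x \<ominus>\<^bsub>M\<^esub> w \<in> W" using S'(3)[OF W(1)] W(2) by blast
      then have "(x \<ominus>\<^bsub>M\<^esub> w) \<oplus>\<^bsub>M\<^esub> w \<in> W" using WD(4) w by blast
      moreover have "(x \<ominus>\<^bsub>M\<^esub> w) \<oplus>\<^bsub>M\<^esub> w = x" using x w ID(2)
        by (simp add: a_minus_def M.a_assoc M.l_neg)
      ultimately show "x \<in> W" by simp
    qed
    moreover have "finite (S1 \<union> S')" "S1 \<union> S' \<subseteq> I" using S1 S' by auto
    ultimately have "fg_sub R M I" by (intro fg_subI[of "S1 \<union> S'"]) auto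
    then show False using nfgI by simp
  qed
  have inv: "\<exists>b\<in>carrier R. \<forall>x\<in>I. b \<odot>\<^bsub>M\<^esub> (a \<odot>\<^bsub>M\<^esub> x) = x"
    if a: "a \<in> carrier R" and sur: "\<forall>x\<in>I. \<exists>y\<in>I. x = a \<odot>\<^bsub>M\<^esub> y" for a
  proof -
    \<comment> \<open>The powers of \<open>a\<close> stabilise up to the factor \<open>b\<close>. As
      \<open>a\<close> acts surjectively, every \<open>x\<close> in \<open>I\<close> is the result
      of acting by the \<open>n\<close>-th power on some \<open>y\<close>, and the identity applied
      to \<open>y\<close> shows that \<open>b\<close> undoes \<open>a\<close> on
      \<open>x\<close>.\<close>
    obtain n b where b: "b \<in> carrier R" "a [^]\<^bsub>R\<^esub> (n::nat) = a [^]\<^bsub>R\<^esub> n \<otimes>\<^bsub>R\<^esub> (a \<otimes>\<^bsub>R\<^esub> b)"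
      using pow[OF a] by blast
    have powsur: "\<exists>y\<in>I. x = (a [^]\<^bsub>R\<^esub> (k::nat)) \<odot>\<^bsub>M\<^esub> y" if "x \<in> I" for k x
      using that
    proof (induction k arbitrary: x)
      case 0
      then show ?case using ID(2) by (auto simp: M.smult_one)
    next
      case (Suc k)
      then obtain y where y: "y \<in> I" "x = a \<odot>\<^bsub>M\<^esub> y" using sur by blast
      then obtain z where "z \<in> I" "y = (a [^]\<^bsub>R\<^esub> k) \<odot>\<^bsub>M\<^esub> z" using Suc by blast
      then show ?case using y a ID(2) by (intro bexI[of _ z]) (auto simp: M.smult_assoc)
    qed
    have "b \<odot>\<^bsub>M\<^esub> (a \<odot>\<^bsub>M\<^esub> x) = x" if x: "x \<in> I" for x
    proof -
      obtain y where y: "y \<in> I" "x = (a [^]\<^bsub>R\<^esub> n) \<odot>\<^bsub>M\<^esub> y" using powsur[OF x] by blast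
      have "b \<odot>\<^bsub>M\<^esub> (a \<odot>\<^bsub>M\<^esub> x) = (a [^]\<^bsub>R\<^esub> n \<otimes>\<^bsub>R\<^esub> (a \<otimes>\<^bsub>R\<^esub> b)) \<odot>\<^bsub>M\<^esub> y"
        unfolding y(2) using y(1) ID(2) a b(1) by (simp add: M.smult_assoc M.smult_closed)
      also have "\<dots> = x" using b(2) y(2) by simp
      finally show ?thesis .
    qed
    then show ?thesis using b(1) by blast
  qed
  have "I \<noteq> {\<zero>\<^bsub>M\<^esub>}"
  proof
    assume "I = {\<zero>\<^bsub>M\<^esub>}"
    then have "fg_sub R M I" by (intro fg_subI[of "{}"]) (auto simp: rsub_def)
    then show False using nfgI by simp
  qed
  then obtain x where x: "x \<in> I" "x \<noteq> \<zero>\<^bsub>M\<^esub>" using ID(3) by blast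
  \<comment> \<open>A submodule \<open>T\<close> of \<open>I\<close> maximal among those avoiding
    the nonzero element \<open>x\<close> plays the part of the hyperplane. It is proper, hence
    finitely generated, and together with \<open>x\<close> it will generate
    \<open>I\<close>.\<close>
  let ?F = "{T. rsub R M T \<and> T \<subseteq> I \<and> x \<notin> T}"
  have "\<exists>T\<in>?F. \<forall>T'\<in>?F. T \<subseteq> T' \<longrightarrow> T' = T"
  proof (rule subset_Zorn_nonempty)
    show "?F \<noteq> {}" using rsub_trivial[OF M] ID(3) x by (auto intro!: exI[of _ "{\<zero>\<^bsub>M\<^esub>}"])
    fix C assume C: "C \<noteq> {}" "subset.chain ?F C"
    have CF: "C \<subseteq> ?F" and ch: "\<And>S T. S \<in> C \<Longrightarrow> T \<in> C \<Longrightarrow> S \<subseteq> T \<or> T \<subseteq> S"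
      using C(2) by (auto simp: subset_chain_def)
    have "rsub R M (\<Union>C)"
    proof (rule rsubI)
      show "\<Union>C \<subseteq> carrier M" using CF rsubD(1) by blast
      show "\<zero>\<^bsub>M\<^esub> \<in> \<Union>C" using CF C(1) rsubD(3) by blast
    next
      fix u v assume "u \<in> \<Union>C" "v \<in> \<Union>C"
      then obtain S T where "S \<in> C" "T \<in> C" "u \<in> S" "v \<in> T" by blast
      then obtain W where "W \<in> C" "u \<in> W" "v \<in> W" using ch[of S T] by blast
      moreover have "rsub R M W" using CF \<open>W \<in> C\<close> by blast
      ultimately show "u \<oplus>\<^bsub>M\<^esub> v \<in> \<Union>C" using rsubD(4)[of R M W u v] by blast
    next
      fix a u assume a: "a \<in> carrier R" and "u \<in> \<Union>C"
      then obtain W where W: "W \<in> C" "u \<in> W" by blast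
      then have "rsub R M W" using CF by blast
      then show "a \<odot>\<^bsub>M\<^esub> u \<in> \<Union>C" using rsubD(5)[of R M W a u] a W by blast
    qed
    then show "\<Union>C \<in> ?F" using CF by blast
  qed
  then obtain T where T0: "T \<in> ?F" and Tm: "\<forall>T'\<in>?F. T \<subseteq> T' \<longrightarrow> T' = T" ..
  have T: "rsub R M T" "T \<subseteq> I" "x \<notin> T" using T0 by auto
  have Tmax: "T' = T" if "rsub R M T'" "T' \<subseteq> I" "x \<notin> T'" "T \<subseteq> T'" for T'
    using Tm that by auto
  have "fg_sub R M T" using min T x by blast
  then have "fg_sub R M I"
  proof (rule fg_sub_insert[OF _ T(2) x(1)])
    fix W assume W: "rsub R M W" "T \<subseteq> W" "x \<in> W"
    show "I \<subseteq> W"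
    proof
      fix y assume y: "y \<in> I"
      show "y \<in> W"
      proof (cases "y \<in> T")
        case True
        then show ?thesis using W by blast
      next
        case False
        let ?T = "{t \<oplus>\<^bsub>M\<^esub> c \<odot>\<^bsub>M\<^esub> y | t c. t \<in> T \<and> c \<in> carrier R}"
        note c = rsub_cyclic_sum[OF M R T(1) ID(2)[OF y]]
        have "?T \<subseteq> I" using T(2) y ID(4,5) by blast
        moreover have "?T \<noteq> T" using c(3) False by blast
        ultimately have "x \<in> ?T" using Tmax[OF c(1) _ _ c(2)] by blast
        \<comment> \<open>Maximality of \<open>T\<close> forces \<open>x\<close> into the submodule
          generated by \<open>T\<close> and \<open>y\<close>. As \<open>x\<close> is not in
          \<open>T\<close>, the scalar \<open>a\<close> does not kill \<open>y\<close>, hence acts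
          invertibly on \<open>I\<close>, and \<open>y\<close> is recovered from
          \<open>x - t\<close>.\<close>
        then obtain t a where t: "t \<in> T" "a \<in> carrier R" "x = t \<oplus>\<^bsub>M\<^esub> a \<odot>\<^bsub>M\<^esub> y" by blast
        have tM: "t \<in> carrier M" "y \<in> carrier M" "a \<odot>\<^bsub>M\<^esub> y \<in> carrier M"
          using t y T ID(2) M.smult_closed by auto
        have "a \<odot>\<^bsub>M\<^esub> y \<noteq> \<zero>\<^bsub>M\<^esub>"
        proof
          assume "a \<odot>\<^bsub>M\<^esub> y = \<zero>\<^bsub>M\<^esub>"
          then show False using t T(3) tM by simp
        qed
        then have "\<not> (\<forall>x\<in>I. a \<odot>\<^bsub>M\<^esub> x = \<zero>\<^bsub>M\<^esub>)" using y by blast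
        then obtain b where b: "b \<in> carrier R" "b \<odot>\<^bsub>M\<^esub> (a \<odot>\<^bsub>M\<^esub> y) = y"
          using act[OF t(2)] inv[OF t(2)] y by blast
        have "a \<odot>\<^bsub>M\<^esub> y = x \<ominus>\<^bsub>M\<^esub> t" unfolding t(3) a_minus_def using tM
          by (simp add: M.a_comm[of t] M.a_assoc M.r_neg)
        moreover have "x \<ominus>\<^bsub>M\<^esub> t \<in> W" using rsub_diff[OF M W(1) W(3), of t] W(2) t(1) by blast
        ultimately have "a \<odot>\<^bsub>M\<^esub> y \<in> W" by metis
        then show ?thesis using rsubD(5)[OF W(1) b(1)] b(2) by metis
      qed
    qed
  qed
  then show False using nfgI by simp
qed


section \<open>From ideals of the base ring to modules over an artin algebra\<close>

definition rmod :: "('a, 'q) ring_scheme \<Rightarrow> ('a, 'a) module" where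
  "rmod R = \<lparr>carrier = carrier R, mult = mult R, one = one R, zero = zero R, add = add R,
     smult = (\<lambda>a x. x \<otimes>\<^bsub>R\<^esub> a)\<rparr>"

lemma rmod_simps [simp]:
  "carrier (rmod R) = carrier R" "\<zero>\<^bsub>rmod R\<^esub> = \<zero>\<^bsub>R\<^esub>"
  "x \<oplus>\<^bsub>rmod R\<^esub> y = x \<oplus>\<^bsub>R\<^esub> y" "a \<odot>\<^bsub>rmod R\<^esub> x = x \<otimes>\<^bsub>R\<^esub> a"
  by (simp_all add: rmod_def)

lemma right_module_rmod:
  assumes "ring R"
  shows "right_module R (rmod R)"
proof -
  interpret R: ring R by fact
  have "abelian_group (rmod R)"
    by (rule abelian_groupI) (auto simp: R.a_ac intro: R.l_neg bexI[of _ "\<ominus>\<^bsub>R\<^esub> x" for x])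
  then interpret M: abelian_group "rmod R" .
  show ?thesis
    by unfold_locales (auto simp: R.l_distr R.r_distr R.m_assoc)
qed

lemma rsub_rmod_iff:
  assumes "cring R"
  shows "rsub R (rmod R) I \<longleftrightarrow> ideal I R"
proof -
  interpret R: cring R by fact
  show ?thesis
  proof
    assume I: "rsub R (rmod R) I"
    note ID = rsubD[OF I, simplified]
    show "ideal I R"
    proof (rule idealI)
      show "ring R" by unfold_locales
      show "subgroup I (add_monoid R)"
      proof (rule subgroup.intro)
        fix x assume "x \<in> I"
        then have "x \<otimes>\<^bsub>R\<^esub> (\<ominus>\<^bsub>R\<^esub> \<one>\<^bsub>R\<^esub>) \<in> I" "x \<in> carrier R" using ID by auto
        then show "inv\<^bsub>add_monoid R\<^esub> x \<in> I" unfolding a_inv_def[symmetric] by (simp add: R.r_minus)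
      qed (use ID in auto)
      fix a x assume "a \<in> I" "x \<in> carrier R"
      then have "a \<otimes>\<^bsub>R\<^esub> x \<in> I" "x \<otimes>\<^bsub>R\<^esub> a = a \<otimes>\<^bsub>R\<^esub> x" using ID(5)[of x a] ID(2)[of a] R.m_comm[of x a] by simp_all
      then show "a \<otimes>\<^bsub>R\<^esub> x \<in> I" "x \<otimes>\<^bsub>R\<^esub> a \<in> I" by auto
    qed
  next
    assume "ideal I R"
    then interpret ideal I R .
    show "rsub R (rmod R) I" by (rule rsubI) (use a_subset in \<open>auto intro: I_r_closed\<close>)
  qed
qed

lemma artinian_ideal_fg:
  assumes "artinian_cring R" "rsub R (rmod R) I"
  shows "fg_sub R (rmod R) I"
proof -
  have R: "cring R"
    and dcc: "\<And>I :: nat \<Rightarrow> _ set. \<forall>n. ideal (I n) R \<Longrightarrow> \<forall>n. I (Suc n) \<subseteq> I n \<Longrightarrow> \<exists>N. \<forall>n\<ge>N. I n = I N"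
    using assms(1) by (auto simp: artinian_cring_def)
  interpret R: cring R by fact
  show ?thesis
  proof (rule dcc_imp_fg[OF right_module_rmod R _ _ assms(2)])
    show "ring R" by unfold_locales
    show "\<exists>N. \<forall>n\<ge>N. I n = I N" if "\<forall>n. rsub R (rmod R) (I n)" "\<forall>n. I (Suc n) \<subseteq> I n" for I :: "nat \<Rightarrow> _ set"
      using that dcc[of I] by (simp add: rsub_rmod_iff[OF R])
    fix a assume a: "a \<in> carrier R"
    have an: "a [^]\<^bsub>R\<^esub> (n::nat) \<in> carrier R" for n using a by simp
    \<comment> \<open>The principal ideals generated by the powers of \<open>a\<close> form a
      descending chain; where it becomes constant, a power of \<open>a\<close> is a multiple of the
      next one.\<close>
    have "\<forall>n. PIdl\<^bsub>R\<^esub> (a [^]\<^bsub>R\<^esub> Suc n) \<subseteq> PIdl\<^bsub>R\<^esub> (a [^]\<^bsub>R\<^esub> n)"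
    proof
      fix n
      show "PIdl\<^bsub>R\<^esub> (a [^]\<^bsub>R\<^esub> Suc n) \<subseteq> PIdl\<^bsub>R\<^esub> (a [^]\<^bsub>R\<^esub> n)"
      proof
        fix x assume "x \<in> PIdl\<^bsub>R\<^esub> (a [^]\<^bsub>R\<^esub> Suc n)"
        then obtain r where "r \<in> carrier R" "x = r \<otimes>\<^bsub>R\<^esub> (a [^]\<^bsub>R\<^esub> Suc n)"
          by (auto simp: cgenideal_def)
        then have "x = (r \<otimes>\<^bsub>R\<^esub> a) \<otimes>\<^bsub>R\<^esub> a [^]\<^bsub>R\<^esub> n" "r \<otimes>\<^bsub>R\<^esub> a \<in> carrier R" using a by (auto simp: R.m_ac)
        then show "x \<in> PIdl\<^bsub>R\<^esub> (a [^]\<^bsub>R\<^esub> n)" by (auto simp: cgenideal_def)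
      qed
    qed
    then obtain N where "PIdl\<^bsub>R\<^esub> (a [^]\<^bsub>R\<^esub> Suc N) = PIdl\<^bsub>R\<^esub> (a [^]\<^bsub>R\<^esub> N)"
      using dcc[of "\<lambda>n. PIdl\<^bsub>R\<^esub> (a [^]\<^bsub>R\<^esub> n)"] R.cgenideal_ideal[OF an] by (metis le_SucI order_refl)
    then have "a [^]\<^bsub>R\<^esub> N \<in> PIdl\<^bsub>R\<^esub> (a [^]\<^bsub>R\<^esub> Suc N)" using R.cgenideal_self[OF an] by metis
    then obtain b where "b \<in> carrier R" "a [^]\<^bsub>R\<^esub> N = b \<otimes>\<^bsub>R\<^esub> (a [^]\<^bsub>R\<^esub> Suc N)"
      by (auto simp: cgenideal_def)
    then have "b \<in> carrier R" "a [^]\<^bsub>R\<^esub> N = a [^]\<^bsub>R\<^esub> N \<otimes>\<^bsub>R\<^esub> (a \<otimes>\<^bsub>R\<^esub> b)" using a by (auto simp: R.m_ac)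
    then show "\<exists>n. \<exists>b\<in>carrier R. a [^]\<^bsub>R\<^esub> (n::nat) = a [^]\<^bsub>R\<^esub> n \<otimes>\<^bsub>R\<^esub> (a \<otimes>\<^bsub>R\<^esub> b)" by blast
  qed
qed

definition rspan :: "('a, 'q) ring_scheme \<Rightarrow> ('a, 'b) module \<Rightarrow> 'b set \<Rightarrow> 'b set" where
  "rspan R M S = \<Inter>{W. rsub R M W \<and> S \<subseteq> W}"

lemma rsub_rspan:
  assumes "right_module R M" "S \<subseteq> carrier M"
  shows "rsub R M (rspan R M S)"
proof (rule rsubI)
  show "rspan R M S \<subseteq> carrier M"
    using rsub_carrier[OF assms(1)] assms(2) unfolding rspan_def by blast
qed (auto simp: rspan_def intro: rsubD)

lemma rspan_least: "rsub R M W \<Longrightarrow> S \<subseteq> W \<Longrightarrow> rspan R M S \<subseteq> W"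
  by (auto simp: rspan_def)

lemma rspan_superset: "S \<subseteq> rspan R M S"
  by (auto simp: rspan_def)

text \<open>Induction on the generators. With \<open>T\<close> the span of all generators but
  \<open>x\<close>, the submodule \<open>U\<close> is governed by \<open>U \<inter> T\<close> and by
  the ideal of those coefficients of \<open>x\<close> that occur in elements of \<open>U\<close>
  modulo \<open>T\<close>. The first is finitely generated by induction, the second by
  \<open>noeth\<close>.\<close>

lemma noetherian_rspan:
  fixes R :: "('a, 'q) ring_scheme" and M :: "('a, 'b) module"
  assumes M: "right_module R M" and R: "cring R"
    and noeth: "\<And>I. rsub R (rmod R) I \<Longrightarrow> fg_sub R (rmod R) I"
    and S: "finite S" "S \<subseteq> carrier M" and U: "rsub R M U" "U \<subseteq> rspan R M S"
  shows "fg_sub R M U"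
  using S U
proof (induction S arbitrary: U rule: finite_induct)
  case empty
  have "U \<subseteq> {\<zero>\<^bsub>M\<^esub>}" using rsub_trivial[OF M] rspan_least[of R M "{\<zero>\<^bsub>M\<^esub>}" "{}"] empty by auto
  then show ?case by (intro fg_subI[of "{}"]) (auto dest: rsubD(3))
next
  case (insert x S)
  interpret M: right_module R M by fact
  interpret R: cring R by fact
  define T where "T = rspan R M S"
  have T: "rsub R M T" unfolding T_def using insert rsub_rspan[OF M] by auto
  note TD = rsubD[OF T] and UD = rsubD[OF insert.prems(2)]
  have x: "x \<in> carrier M" using insert by auto
  have Ud: "\<exists>t c. t \<in> T \<and> c \<in> carrier R \<and> u = t \<oplus>\<^bsub>M\<^esub> c \<odot>\<^bsub>M\<^esub> x" if "u \<in> U" for u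
  proof -
    have "S \<subseteq> T" unfolding T_def by (rule rspan_superset)
    then have "rspan R M (insert x S) \<subseteq> {t \<oplus>\<^bsub>M\<^esub> c \<odot>\<^bsub>M\<^esub> x | t c. t \<in> T \<and> c \<in> carrier R}"
      using rsub_cyclic_sum[OF M R T x] by (intro rspan_least) auto
    then show ?thesis using that insert.prems by blast
  qed
  \<comment> \<open>The coefficient ideal is set up for arbitrary \<open>W\<close> because it serves
    twice: for \<open>U\<close> itself, and for \<open>W \<inter> U\<close> when a submodule
    \<open>W\<close> containing the proposed generators is tested.\<close>
  have coeff: "rsub R (rmod R) {c \<in> carrier R. \<exists>t\<in>T. t \<oplus>\<^bsub>M\<^esub> c \<odot>\<^bsub>M\<^esub> x \<in> W}" (is "rsub R (rmod R) (?A W)")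
    if W: "rsub R M W" for W
  proof (rule rsubI)
    note WD = rsubD[OF W]
    show "\<zero>\<^bsub>rmod R\<^esub> \<in> ?A W" using WD(3) TD(3) x by (auto intro!: bexI[of _ "\<zero>\<^bsub>M\<^esub>"])
    show "c \<oplus>\<^bsub>rmod R\<^esub> d \<in> ?A W" if "c \<in> ?A W" "d \<in> ?A W" for c d
    proof -
      from that obtain t s where *: "c \<in> carrier R" "d \<in> carrier R" "t \<in> T" "s \<in> T"
        "t \<oplus>\<^bsub>M\<^esub> c \<odot>\<^bsub>M\<^esub> x \<in> W" "s \<oplus>\<^bsub>M\<^esub> d \<odot>\<^bsub>M\<^esub> x \<in> W" by auto
      have "(t \<oplus>\<^bsub>M\<^esub> s) \<oplus>\<^bsub>M\<^esub> (c \<oplus>\<^bsub>R\<^esub> d) \<odot>\<^bsub>M\<^esub> x = (t \<oplus>\<^bsub>M\<^esub> c \<odot>\<^bsub>M\<^esub> x) \<oplus>\<^bsub>M\<^esub> (s \<oplus>\<^bsub>M\<^esub> d \<odot>\<^bsub>M\<^esub> x)"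
        using * TD(2) x by (simp add: M.smult_l_distr M.smult_closed M.a_ac)
      then have "(t \<oplus>\<^bsub>M\<^esub> s) \<oplus>\<^bsub>M\<^esub> (c \<oplus>\<^bsub>R\<^esub> d) \<odot>\<^bsub>M\<^esub> x \<in> W" using WD(4)[OF *(5,6)] by simp
      then show ?thesis using * TD(4)[OF *(3,4)] by auto
    qed
    show "a \<odot>\<^bsub>rmod R\<^esub> c \<in> ?A W" if a: "a \<in> carrier R" and "c \<in> ?A W" for a c
    proof -
      from that obtain t where *: "c \<in> carrier R" "t \<in> T" "t \<oplus>\<^bsub>M\<^esub> c \<odot>\<^bsub>M\<^esub> x \<in> W" by auto
      have "a \<odot>\<^bsub>M\<^esub> (t \<oplus>\<^bsub>M\<^esub> c \<odot>\<^bsub>M\<^esub> x) = a \<odot>\<^bsub>M\<^esub> t \<oplus>\<^bsub>M\<^esub> (c \<otimes>\<^bsub>R\<^esub> a) \<odot>\<^bsub>M\<^esub> x"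
        using * a TD(2) x by (simp add: M.smult_r_distr M.smult_closed M.smult_assoc)
      then show ?thesis using * WD(5)[OF a *(3)] TD(5)[OF a *(2)] a by auto
    qed
  qed auto
  have UT: "fg_sub R M (U \<inter> T)"
    using insert.IH[of "U \<inter> T"] insert.prems rsub_Int[OF insert.prems(2) T] by (auto simp: T_def)
  obtain S1 where S1: "finite S1" "S1 \<subseteq> U \<inter> T" "\<And>W. rsub R M W \<Longrightarrow> S1 \<subseteq> W \<Longrightarrow> U \<inter> T \<subseteq> W"
    using UT by (rule fg_subE) blast
  obtain S2 where S2: "finite S2" "S2 \<subseteq> ?A U" "\<And>I. rsub R (rmod R) I \<Longrightarrow> S2 \<subseteq> I \<Longrightarrow> ?A U \<subseteq> I"
    using noeth[OF coeff[OF insert.prems(2)]] by (rule fg_subE) blast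
  have "\<forall>c\<in>S2. \<exists>t. t \<in> T \<and> t \<oplus>\<^bsub>M\<^esub> c \<odot>\<^bsub>M\<^esub> x \<in> U" using S2(2) by blast
  then obtain \<tau> where \<tau>: "\<And>c. c \<in> S2 \<Longrightarrow> \<tau> c \<in> T" "\<And>c. c \<in> S2 \<Longrightarrow> \<tau> c \<oplus>\<^bsub>M\<^esub> c \<odot>\<^bsub>M\<^esub> x \<in> U"
    by metis
  let ?S = "S1 \<union> (\<lambda>c. \<tau> c \<oplus>\<^bsub>M\<^esub> c \<odot>\<^bsub>M\<^esub> x) ` S2"
  show ?case
  proof (rule fg_subI[of ?S])
    show "finite ?S" using S1(1) S2(1) by simp
    show "?S \<subseteq> U" using S1(2) \<tau>(2) by auto
    fix W assume W: "rsub R M W" "?S \<subseteq> W"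
    have WU: "rsub R M (W \<inter> U)" by (rule rsub_Int[OF W(1) insert.prems(2)])
    have "S2 \<subseteq> ?A (W \<inter> U)" using S2(2) \<tau> W(2) by blast
    then have sub: "?A U \<subseteq> ?A (W \<inter> U)" by (rule S2(3)[OF coeff[OF WU]])
    show "U \<subseteq> W"
    proof
      fix u assume u: "u \<in> U"
      then obtain t c where t: "t \<in> T" "c \<in> carrier R" "u = t \<oplus>\<^bsub>M\<^esub> c \<odot>\<^bsub>M\<^esub> x" using Ud by blast
      then have "c \<in> ?A U" using u by blast
      \<comment> \<open>The coefficient \<open>c\<close> of \<open>u\<close> also occurs in an
        element of \<open>W \<inter> U\<close>. The difference of the two elements has no
        \<open>x\<close>-part, so it lies in \<open>U \<inter> T\<close>, whose generators are in
        \<open>W\<close>.\<close>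
      then obtain s where s: "s \<in> T" "s \<oplus>\<^bsub>M\<^esub> c \<odot>\<^bsub>M\<^esub> x \<in> W" "s \<oplus>\<^bsub>M\<^esub> c \<odot>\<^bsub>M\<^esub> x \<in> U" using sub by blast
      have mem: "t \<in> carrier M" "s \<in> carrier M" "c \<odot>\<^bsub>M\<^esub> x \<in> carrier M"
        using t s TD(2) x M.smult_closed by auto
      have eq: "u \<ominus>\<^bsub>M\<^esub> (s \<oplus>\<^bsub>M\<^esub> c \<odot>\<^bsub>M\<^esub> x) = t \<ominus>\<^bsub>M\<^esub> s"
      proof -
        have "u \<ominus>\<^bsub>M\<^esub> (s \<oplus>\<^bsub>M\<^esub> c \<odot>\<^bsub>M\<^esub> x) = t \<oplus>\<^bsub>M\<^esub> (\<ominus>\<^bsub>M\<^esub> s \<oplus>\<^bsub>M\<^esub> (c \<odot>\<^bsub>M\<^esub> x \<oplus>\<^bsub>M\<^esub> \<ominus>\<^bsub>M\<^esub> (c \<odot>\<^bsub>M\<^esub> x)))"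
          unfolding t(3) a_minus_def using mem by (simp add: M.minus_add M.a_ac del: M.r_neg)
        then show ?thesis using mem by (simp add: M.r_neg a_minus_def)
      qed
      have "t \<ominus>\<^bsub>M\<^esub> s \<in> U \<inter> T"
        using rsub_diff[OF M insert.prems(2) u s(3)] rsub_diff[OF M T t(1) s(1)] eq by simp
      then have "t \<ominus>\<^bsub>M\<^esub> s \<in> W" using S1(3)[OF W(1)] W(2) by blast
      then have "(t \<ominus>\<^bsub>M\<^esub> s) \<oplus>\<^bsub>M\<^esub> (s \<oplus>\<^bsub>M\<^esub> c \<odot>\<^bsub>M\<^esub> x) \<in> W" by (rule rsubD(4)[OF W(1) _ s(2)])
      also have "(t \<ominus>\<^bsub>M\<^esub> s) \<oplus>\<^bsub>M\<^esub> (s \<oplus>\<^bsub>M\<^esub> c \<odot>\<^bsub>M\<^esub> x) = u"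
        unfolding t(3) a_minus_def using mem by (simp add: M.a_assoc M.r_neg2 M.r_neg1)
      finally show "u \<in> W" .
    qed
  qed
qed

text \<open>Restricting scalars along \<phi> makes \<open>M\<close> a finitely generated module over
  the commutative ring \<open>K\<close>: products of generators of \<open>L\<close> over
  \<open>K\<close> with generators of \<open>M\<close> over \<open>L\<close> suffice. Every
  \<open>L\<close>-submodule is a \<open>K\<close>-submodule, so finitely many
  \<open>K\<close>-generators of \<open>U\<close> generate it over \<open>L\<close> as well.\<close>

lemma artin_algebra_noetherian:
  fixes K :: "('k, 'p) ring_scheme" and L :: "('a, 'q) ring_scheme" and M :: "('a, 'b) module"
  assumes art: "artin_algebra K L \<phi>" and M: "right_module L M" and fg: "fin_gen L M" and U: "rsub L M U"
  shows "fin_gen L (submod M U)"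
proof -
  have KA: "artinian_cring K" and "ring L" and hom: "\<phi> \<in> ring_hom K L"
    and central: "\<And>c x. c \<in> carrier K \<Longrightarrow> x \<in> carrier L \<Longrightarrow> \<phi> c \<otimes>\<^bsub>L\<^esub> x = x \<otimes>\<^bsub>L\<^esub> \<phi> c"
    using art by (auto simp: artin_algebra_def)
  obtain B where B: "finite B" "B \<subseteq> carrier L"
    "\<And>x. x \<in> carrier L \<Longrightarrow> \<exists>c\<in>B \<rightarrow> carrier K. x = (\<Oplus>\<^bsub>L\<^esub>s\<in>B. \<phi> (c s) \<otimes>\<^bsub>L\<^esub> s)"
    using art unfolding artin_algebra_def by blast
  have K: "cring K" using KA by (simp add: artinian_cring_def)
  interpret K: cring K by fact
  interpret M: right_module L M by fact
  have \<phi>: "\<And>c. c \<in> carrier K \<Longrightarrow> \<phi> c \<in> carrier L" using hom by (auto simp: ring_hom_def)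
  define MK :: "('k, 'b) module" where
    "MK = \<lparr>carrier = carrier M, mult = mult M, one = one M, zero = zero M, add = add M,
       smult = (\<lambda>c x. \<phi> c \<odot>\<^bsub>M\<^esub> x)\<rparr>"
  have MK [simp]: "carrier MK = carrier M" "\<zero>\<^bsub>MK\<^esub> = \<zero>\<^bsub>M\<^esub>" "x \<oplus>\<^bsub>MK\<^esub> y = x \<oplus>\<^bsub>M\<^esub> y"
    "c \<odot>\<^bsub>MK\<^esub> x = \<phi> c \<odot>\<^bsub>M\<^esub> x" for x y c by (simp_all add: MK_def)
  have "abelian_group MK"
    by (rule abelian_groupI) (auto simp: M.a_ac intro: M.l_neg bexI[of _ "\<ominus>\<^bsub>M\<^esub> x" for x])
  then interpret MK: abelian_group MK .
  have MKr: "right_module K MK"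
    by unfold_locales (use \<phi> hom in \<open>auto simp: M.smult_l_distr M.smult_r_distr M.smult_assoc M.smult_one
        M.smult_closed ring_hom_def\<close>)
  have sub: "rsub K MK T" if "rsub L M T" for T
    using that \<phi> by (auto simp: rsub_def)
  obtain G where G: "finite G" "G \<subseteq> carrier M" "\<And>T. rsub L M T \<Longrightarrow> G \<subseteq> T \<Longrightarrow> carrier M \<subseteq> T"
    using fg unfolding fin_gen_iff[OF M] by (rule fg_subE) blast
  let ?S = "(\<lambda>(b, g). b \<odot>\<^bsub>M\<^esub> g) ` (B \<times> G)"
  have Sfin: "finite ?S" using B G by simp
  have SM: "?S \<subseteq> carrier M" using B(2) G(2) by (auto intro!: M.smult_closed)
  have "carrier M \<subseteq> T" if T: "rsub K MK T" "?S \<subseteq> T" for T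
  proof -
    note TD = rsubD[OF T(1), simplified]
    have agen: "a \<odot>\<^bsub>M\<^esub> g \<in> T" if a: "a \<in> carrier L" and g: "g \<in> G" for a g
    proof -
      have gM: "g \<in> carrier M" using g G by auto
      obtain c where c: "c \<in> B \<rightarrow> carrier K" "a = (\<Oplus>\<^bsub>L\<^esub>s\<in>B. \<phi> (c s) \<otimes>\<^bsub>L\<^esub> s)" using B(3)[OF a] by blast
      have "(\<Oplus>\<^bsub>L\<^esub>s\<in>B'. \<phi> (c s) \<otimes>\<^bsub>L\<^esub> s) \<odot>\<^bsub>M\<^esub> g \<in> T" if "B' \<subseteq> B" for B'
        using finite_subset[OF that B(1)] that
      proof (induction B' rule: finite_induct)
        case empty
        then show ?case using TD(3) gM by simp
      next
        case (insert s B')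
        have s: "s \<in> carrier L" "c s \<in> carrier K" "s \<in> B" using insert B(2) c(1) by auto
        have m: "(\<lambda>s. \<phi> (c s) \<otimes>\<^bsub>L\<^esub> s) \<in> B' \<rightarrow> carrier L"
          using insert B(2) c(1) \<phi> by (auto simp: Pi_iff subset_iff)
        \<comment> \<open>In a right action the left factor acts first. Centrality of \<phi>
          exchanges the two, so that the scalar from \<open>K\<close> acts last, where closure of
          \<open>T\<close> under \<open>K\<close> applies.\<close>
        have "(\<phi> (c s) \<otimes>\<^bsub>L\<^esub> s) \<odot>\<^bsub>M\<^esub> g = \<phi> (c s) \<odot>\<^bsub>M\<^esub> (s \<odot>\<^bsub>M\<^esub> g)"
          using s \<phi> gM by (simp add: central M.smult_assoc)
        moreover have "\<phi> (c s) \<odot>\<^bsub>M\<^esub> (s \<odot>\<^bsub>M\<^esub> g) \<in> T" using s g T(2) TD(5) by auto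
        ultimately show ?case using insert m s gM \<phi> TD(4)
          by (simp add: M.R.finsum_insert M.smult_l_distr M.R.finsum_closed)
      qed
      then show ?thesis using c(2) by blast
    qed
    show ?thesis
    proof
      fix x assume "x \<in> carrier M"
      \<comment> \<open>\<open>T\<close> is closed only under \<open>K\<close>. The elements all of
        whose \<open>L\<close>-multiples lie in \<open>T\<close> form an \<open>L\<close>-submodule,
        to which generation of \<open>M\<close> by \<open>G\<close> applies.\<close>
      have T2: "rsub L M {x \<in> carrier M. \<forall>a\<in>carrier L. a \<odot>\<^bsub>M\<^esub> x \<in> T}" (is "rsub L M ?V")
        by (rule rsubI) (use TD in \<open>auto simp: M.smult_r_distr M.smult_closed M.smult_assoc[symmetric]\<close>)
      have "G \<subseteq> ?V" using agen G(2) by auto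
      then have "x \<in> ?V" using G(3)[OF T2] \<open>x \<in> carrier M\<close> by blast
      then have "\<one>\<^bsub>L\<^esub> \<odot>\<^bsub>M\<^esub> x \<in> T" by blast
      then show "x \<in> T" using \<open>x \<in> carrier M\<close> by (simp add: M.smult_one)
    qed
  qed
  then have "U \<subseteq> rspan K MK ?S" using rsubD(1)[OF U] by (auto simp: rspan_def)
  then have "fg_sub K MK U"
    using SM by (intro noetherian_rspan[OF MKr K artinian_ideal_fg[OF KA] Sfin _ sub[OF U]]) auto
  then have "fg_sub L M U"
  proof (rule fg_subE)
    fix S assume "finite S" "S \<subseteq> U" "\<And>T. rsub K MK T \<Longrightarrow> S \<subseteq> T \<Longrightarrow> U \<subseteq> T"
    then show "fg_sub L M U" by (intro fg_subI[of S]) (simp_all add: sub)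
  qed
  then show ?thesis by (rule fin_gen_submod[OF M U])
qed

section \<open>Modules\<close>

lemma mod_catD: "M \<in> mod_cat L \<Longrightarrow> right_module L M"
  by (simp add: mod_cat_def)

lemma mod_cat_abelian: "M \<in> mod_cat L \<Longrightarrow> abelian_group M"
  using mod_catD right_module.axioms(2) by blast

lemma mod_hom_diff:
  assumes "f \<in> mod_hom L M N" "abelian_group M" "abelian_group N" "x \<in> carrier M" "y \<in> carrier M"
  shows "f (x \<ominus>\<^bsub>M\<^esub> y) = f x \<ominus>\<^bsub>N\<^esub> f y"
proof -
  interpret M: abelian_group M by fact
  show ?thesis using assms by (simp add: a_minus_def mod_homD(2)[OF assms(1)] mod_hom_minus)
qed

lemma mod_hom_id: "(\<lambda>x. x) \<in> mod_hom L M M"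
  by (auto simp: mod_hom_def)

lemma mod_hom_comp:
  "g \<in> mod_hom L N P \<Longrightarrow> f \<in> mod_hom L M N \<Longrightarrow> (\<lambda>x. g (f x)) \<in> mod_hom L M P"
  by (auto simp: mod_hom_def Pi_iff)

lemma mod_hom_const_zero:
  assumes "N \<in> mod_cat L"
  shows "(\<lambda>x. \<zero>\<^bsub>N\<^esub>) \<in> mod_hom L M N"
proof -
  interpret N: right_module L N by (rule mod_catD[OF assms])
  show ?thesis by (auto simp: mod_hom_def)
qed

lemma mod_hom_add:
  assumes "N \<in> mod_cat L" "f \<in> mod_hom L M N" "g \<in> mod_hom L M N"
  shows "(\<lambda>x. f x \<oplus>\<^bsub>N\<^esub> g x) \<in> mod_hom L M N"
proof -
  interpret N: right_module L N by (rule mod_catD[OF assms(1)])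
  show ?thesis
    using mod_homD[OF assms(2)] mod_homD[OF assms(3)]
    by (intro mod_homI) (auto simp: N.a_ac N.smult_r_distr)
qed

lemma mod_hom_neg:
  assumes "N \<in> mod_cat L" "f \<in> mod_hom L M N"
  shows "(\<lambda>x. \<ominus>\<^bsub>N\<^esub> f x) \<in> mod_hom L M N"
proof -
  interpret N: right_module L N by (rule mod_catD[OF assms(1)])
  show ?thesis
    using mod_homD[OF assms(2)]
    by (intro mod_homI) (auto simp: N.minus_add N.smult_minus)
qed

lemma mod_hom_sub:
  assumes "N \<in> mod_cat L" "f \<in> mod_hom L M N" "g \<in> mod_hom L M N"
  shows "(\<lambda>x. f x \<ominus>\<^bsub>N\<^esub> g x) \<in> mod_hom L M N"
  unfolding a_minus_def by (intro mod_hom_add mod_hom_neg assms)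

lemma mod_hom_into_submod:
  "f \<in> mod_hom L M N \<Longrightarrow> (\<And>x. x \<in> carrier M \<Longrightarrow> f x \<in> U) \<Longrightarrow> f \<in> mod_hom L M (submod N U)"
  by (auto simp: mod_hom_def)

lemma mod_hom_from_submod:
  "f \<in> mod_hom L M N \<Longrightarrow> U \<subseteq> carrier M \<Longrightarrow> f \<in> mod_hom L (submod M U) N"
  by (auto simp: mod_hom_def Pi_iff subset_iff)

lemma mod_hom_out_submod:
  "f \<in> mod_hom L M (submod N U) \<Longrightarrow> U \<subseteq> carrier N \<Longrightarrow> f \<in> mod_hom L M N"
  by (auto simp: mod_hom_def Pi_iff subset_iff)

lemma mod_hom_inv_into:
  fixes M :: "('a, 'b) module" and N :: "('a, 'c) module"
  assumes M: "right_module L M" and f: "f \<in> mod_hom L M N" and bij: "bij_betw f (carrier M) (carrier N)"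
  shows "inv_into (carrier M) f \<in> mod_hom L N M"
    and "\<And>x. x \<in> carrier M \<Longrightarrow> inv_into (carrier M) f (f x) = x"
    and "\<And>y. y \<in> carrier N \<Longrightarrow> f (inv_into (carrier M) f y) = y"
proof -
  interpret M: right_module L M by fact
  let ?g = "inv_into (carrier M) f"
  have inj: "inj_on f (carrier M)" using bij by (simp add: bij_betw_def)
  show gf: "?g (f x) = x" if "x \<in> carrier M" for x using that inj by simp
  show fg: "f (?g y) = y" if "y \<in> carrier N" for y
    using that bij by (simp add: bij_betw_def f_inv_into_f)
  have g: "?g y \<in> carrier M" if "y \<in> carrier N" for y
    using that bij by (metis bij_betw_def inv_into_into)
  show "?g \<in> mod_hom L N M"
  proof (rule mod_homI)
    fix x y assume *: "x \<in> carrier N" "y \<in> carrier N"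
    then have "x \<oplus>\<^bsub>N\<^esub> y = f (?g x \<oplus>\<^bsub>M\<^esub> ?g y)" using mod_homD(2)[OF f g[OF *(1)] g[OF *(2)]] fg by simp
    then show "?g (x \<oplus>\<^bsub>N\<^esub> y) = ?g x \<oplus>\<^bsub>M\<^esub> ?g y" using gf g * by simp
  next
    fix a x assume *: "a \<in> carrier L" "x \<in> carrier N"
    then have "a \<odot>\<^bsub>N\<^esub> x = f (a \<odot>\<^bsub>M\<^esub> ?g x)" using mod_homD(3)[OF f *(1) g[OF *(2)]] fg by simp
    then show "?g (a \<odot>\<^bsub>N\<^esub> x) = a \<odot>\<^bsub>M\<^esub> ?g x" using gf g * M.smult_closed by simp
  qed (rule g)
qed

section \<open>Direct sums and zero modules\<close>

lemma mod_sum_simps [simp]: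
  "carrier (mod_sum M N) = {Join x y | x y. x \<in> carrier M \<and> y \<in> carrier N}"
  "\<zero>\<^bsub>mod_sum M N\<^esub> = Join \<zero>\<^bsub>M\<^esub> \<zero>\<^bsub>N\<^esub>"
  "p \<oplus>\<^bsub>mod_sum M N\<^esub> q = Join (lft p \<oplus>\<^bsub>M\<^esub> lft q) (rgt p \<oplus>\<^bsub>N\<^esub> rgt q)"
  "a \<odot>\<^bsub>mod_sum M N\<^esub> p = Join (a \<odot>\<^bsub>M\<^esub> lft p) (a \<odot>\<^bsub>N\<^esub> rgt p)"
  by (simp_all add: mod_sum_def)

lemma zero_mod_simps [simp]:
  "carrier (zero_mod L) = {Atom \<zero>\<^bsub>L\<^esub>}" "\<zero>\<^bsub>zero_mod L\<^esub> = Atom \<zero>\<^bsub>L\<^esub>"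
  "p \<oplus>\<^bsub>zero_mod L\<^esub> q = Atom \<zero>\<^bsub>L\<^esub>" "a \<odot>\<^bsub>zero_mod L\<^esub> p = Atom \<zero>\<^bsub>L\<^esub>"
  by (simp_all add: zero_mod_def)

lemma right_module_mod_sum:
  assumes "right_module L M" "right_module L N"
  shows "right_module L (mod_sum M N)"
proof -
  interpret M: right_module L M by fact
  interpret N: right_module L N by fact
  have "abelian_group (mod_sum M N)"
  proof (rule abelian_groupI)
    fix p assume "p \<in> carrier (mod_sum M N)"
    then obtain x y where "x \<in> carrier M" "y \<in> carrier N" "p = Join x y" by auto
    then show "\<exists>q\<in>carrier (mod_sum M N). q \<oplus>\<^bsub>mod_sum M N\<^esub> p = \<zero>\<^bsub>mod_sum M N\<^esub>"
      by (intro bexI[of _ "Join (\<ominus>\<^bsub>M\<^esub> x) (\<ominus>\<^bsub>N\<^esub> y)"]) (auto simp: M.l_neg N.l_neg)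
  qed (auto simp: M.a_ac N.a_ac)
  then interpret S: abelian_group "mod_sum M N" .
  show ?thesis
    by unfold_locales (auto simp: M.smult_closed M.smult_l_distr M.smult_r_distr M.smult_assoc M.smult_one
        N.smult_closed N.smult_l_distr N.smult_r_distr N.smult_assoc N.smult_one)
qed

text \<open>A submodule containing the generators of both summands meets each axis in a submodule
  that contains the generators of that axis, so it contains both axes and their sum.\<close>

lemma mod_sum_in_mod_cat:
  assumes "M \<in> mod_cat L" "N \<in> mod_cat L"
  shows "mod_sum M N \<in> mod_cat L"
proof -
  interpret M: right_module L M by (rule mod_catD[OF assms(1)])
  interpret N: right_module L N by (rule mod_catD[OF assms(2)])
  have S: "right_module L (mod_sum M N)" by (rule right_module_mod_sum) unfold_locales
  have "fg_sub L M (carrier M)" "fg_sub L N (carrier N)"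
    using assms by (auto simp: mod_cat_def fin_gen_iff)
  obtain A where A: "finite A" "A \<subseteq> carrier M" "\<And>T. rsub L M T \<Longrightarrow> A \<subseteq> T \<Longrightarrow> carrier M \<subseteq> T"
    using \<open>fg_sub L M (carrier M)\<close> by (rule fg_subE) blast
  obtain B where B: "finite B" "B \<subseteq> carrier N" "\<And>T. rsub L N T \<Longrightarrow> B \<subseteq> T \<Longrightarrow> carrier N \<subseteq> T"
    using \<open>fg_sub L N (carrier N)\<close> by (rule fg_subE) blast
  let ?S = "(\<lambda>x. Join x \<zero>\<^bsub>N\<^esub>) ` A \<union> (\<lambda>y. Join \<zero>\<^bsub>M\<^esub> y) ` B"
  have "fg_sub L (mod_sum M N) (carrier (mod_sum M N))"
  proof (rule fg_subI[of ?S])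
    show "finite ?S" using A B by simp
    show "?S \<subseteq> carrier (mod_sum M N)" using A B by auto
    fix T assume T: "rsub L (mod_sum M N) T" "?S \<subseteq> T"
    note TD = rsubD[OF T(1), simplified]
    have "rsub L M {x \<in> carrier M. Join x \<zero>\<^bsub>N\<^esub> \<in> T}"
      using TD(3) TD(4)[of "Join _ _" "Join _ _"] TD(5)[of _ "Join _ _"]
      by (intro rsubI) (force simp: M.smult_closed)+
    from A(3)[OF this] have 1: "Join x \<zero>\<^bsub>N\<^esub> \<in> T" if "x \<in> carrier M" for x using that A(2) T(2) by blast
    have "rsub L N {y \<in> carrier N. Join \<zero>\<^bsub>M\<^esub> y \<in> T}"
      using TD(3) TD(4)[of "Join _ _" "Join _ _"] TD(5)[of _ "Join _ _"]
      by (intro rsubI) (force simp: N.smult_closed)+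
    from B(3)[OF this] have 2: "Join \<zero>\<^bsub>M\<^esub> y \<in> T" if "y \<in> carrier N" for y using that B(2) T(2) by blast
    show "carrier (mod_sum M N) \<subseteq> T"
    proof
      fix p assume "p \<in> carrier (mod_sum M N)"
      then obtain x y where p: "p = Join x y" "x \<in> carrier M" "y \<in> carrier N" by auto
      show "p \<in> T" using TD(4)[OF 1[OF p(2)] 2[OF p(3)]] p by simp
    qed
  qed
  then show ?thesis using S by (simp add: mod_cat_def fin_gen_iff)
qed

lemma trivial_in_mod_cat:
  assumes "right_module L M" "carrier M = {\<zero>\<^bsub>M\<^esub>}"
  shows "M \<in> mod_cat L"
proof -
  have "fg_sub L M (carrier M)"
    by (rule fg_subI[of "{}"]) (use assms(2) in \<open>auto dest: rsubD(3)\<close>)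
  then show ?thesis using assms by (simp add: mod_cat_def fin_gen_iff)
qed

lemma zero_mod_in_mod_cat:
  assumes "ring L"
  shows "zero_mod L \<in> mod_cat L"
proof (rule trivial_in_mod_cat)
  interpret ring L by fact
  have "abelian_group (zero_mod L)" by (rule abelian_groupI) auto
  then interpret Z: abelian_group "zero_mod L" .
  show "right_module L (zero_mod L)" by unfold_locales auto
qed simp

lemma mod_hom_lft: "f \<in> mod_hom L X (mod_sum M N) \<Longrightarrow> (\<lambda>x. lft (f x)) \<in> mod_hom L X M"
  by (rule mod_homI) (fastforce simp: mod_hom_def Pi_iff)+

lemma mod_hom_rgt: "f \<in> mod_hom L X (mod_sum M N) \<Longrightarrow> (\<lambda>x. rgt (f x)) \<in> mod_hom L X N"
  by (rule mod_homI) (fastforce simp: mod_hom_def Pi_iff)+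

lemma mod_hom_Join:
  "f \<in> mod_hom L X M \<Longrightarrow> g \<in> mod_hom L X N \<Longrightarrow> (\<lambda>x. Join (f x) (g x)) \<in> mod_hom L X (mod_sum M N)"
  by (rule mod_homI) (auto simp: mod_hom_def)

lemma lft_hom: "lft \<in> mod_hom L (mod_sum M N) M"
  using mod_hom_lft[OF mod_hom_id] .

lemma rgt_hom: "rgt \<in> mod_hom L (mod_sum M N) N"
  using mod_hom_rgt[OF mod_hom_id] .

section \<open>Complexes\<close>

text \<open>The equation \<open>j = i + 1\<close> is a premise of the rules on differentials so that
  they apply alike to degrees written \<open>i - 1\<close> and \<open>i\<close>, or
  \<open>i + 1\<close> and \<open>i + 2\<close>.\<close>

lemma bcpxD:
  assumes "X \<in> bcpx L"
  shows "\<And>i. cobj X i \<in> mod_cat L" "\<And>i. right_module L (cobj X i)" "\<And>i. abelian_group (cobj X i)"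
    "\<And>i j. j = i + 1 \<Longrightarrow> cdiff X i \<in> mod_hom L (cobj X i) (cobj X j)"
    "\<And>i j x. j = i + 1 \<Longrightarrow> x \<in> carrier (cobj X i) \<Longrightarrow> cdiff X i x \<in> carrier (cobj X j)"
    "\<And>i j x. j = i + 1 \<Longrightarrow> x \<in> carrier (cobj X i) \<Longrightarrow> cdiff X j (cdiff X i x) = \<zero>\<^bsub>cobj X (i + 2)\<^esub>"
    "\<And>i. cdiff X i \<zero>\<^bsub>cobj X i\<^esub> = \<zero>\<^bsub>cobj X (i + 1)\<^esub>"
proof -
  have *: "(\<forall>i. cobj X i \<in> mod_cat L) \<and>
     (\<forall>i. cdiff X i \<in> mod_hom L (cobj X i) (cobj X (i + 1))) \<and>
     (\<forall>i. \<forall>x\<in>carrier (cobj X i). cdiff X (i + 1) (cdiff X i x) = \<zero>\<^bsub>cobj X (i + 1 + 1)\<^esub>)"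
    using assms unfolding bcpx_def by blast
  then show 1: "\<And>i. cobj X i \<in> mod_cat L" by blast
  show 3: "\<And>i. abelian_group (cobj X i)" by (rule mod_cat_abelian[OF 1])
  show "\<And>i. right_module L (cobj X i)" by (rule mod_catD[OF 1])
  show 2: "\<And>i j. j = i + 1 \<Longrightarrow> cdiff X i \<in> mod_hom L (cobj X i) (cobj X j)" using * by blast
  show "\<And>i j x. j = i + 1 \<Longrightarrow> x \<in> carrier (cobj X i) \<Longrightarrow> cdiff X i x \<in> carrier (cobj X j)"
    using mod_homD(1)[OF 2] by blast
  show "\<And>i j x. j = i + 1 \<Longrightarrow> x \<in> carrier (cobj X i) \<Longrightarrow> cdiff X j (cdiff X i x) = \<zero>\<^bsub>cobj X (i + 2)\<^esub>"
  proof -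
    fix i j x assume "j = i + 1" "x \<in> carrier (cobj X i)"
    then have "cdiff X j (cdiff X i x) = \<zero>\<^bsub>cobj X (i + 1 + 1)\<^esub>" using * by blast
    then show "cdiff X j (cdiff X i x) = \<zero>\<^bsub>cobj X (i + 2)\<^esub>" by (simp add: add.assoc)
  qed
  show "\<And>i. cdiff X i \<zero>\<^bsub>cobj X i\<^esub> = \<zero>\<^bsub>cobj X (i + 1)\<^esub>"
    by (rule mod_hom_zero[OF 2 3 3]) simp
qed

lemma bcpx_bound:
  assumes "X \<in> bcpx L"
  obtains b where "\<And>i. \<bar>i\<bar> > b \<Longrightarrow> carrier (cobj X i) = {\<zero>\<^bsub>cobj X i\<^esub>}"
  using assms unfolding bcpx_def by blast

lemma bcpxI:
  assumes "\<And>i. cobj X i \<in> mod_cat L"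
    "\<And>i. cdiff X i \<in> mod_hom L (cobj X i) (cobj X (i + 1))"
    "\<And>i x. x \<in> carrier (cobj X i) \<Longrightarrow> cdiff X (i + 1) (cdiff X i x) = \<zero>\<^bsub>cobj X (i + 2)\<^esub>"
    "\<And>i. \<bar>i\<bar> > b \<Longrightarrow> carrier (cobj X i) \<subseteq> {\<zero>\<^bsub>cobj X i\<^esub>}"
  shows "X \<in> bcpx L"
proof -
  have "\<zero>\<^bsub>cobj X i\<^esub> \<in> carrier (cobj X i)" for i
  proof -
    interpret abelian_group "cobj X i" by (rule mod_cat_abelian[OF assms(1)])
    show ?thesis by simp
  qed
  then have "\<forall>i. \<bar>i\<bar> > b \<longrightarrow> carrier (cobj X i) = {\<zero>\<^bsub>cobj X i\<^esub>}" using assms(4) by fastforce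
  moreover have "\<forall>i. \<forall>x\<in>carrier (cobj X i). cdiff X (i + 1) (cdiff X i x) = \<zero>\<^bsub>cobj X (i + 1 + 1)\<^esub>"
    using assms(3) by (simp add: add.assoc)
  ultimately show ?thesis using assms(1,2) unfolding bcpx_def by blast
qed

lemma chain_mapD:
  assumes "chain_map L X Y f"
  shows "\<And>i. f i \<in> mod_hom L (cobj X i) (cobj Y i)"
    "\<And>i x. x \<in> carrier (cobj X i) \<Longrightarrow> f i x \<in> carrier (cobj Y i)"
    "\<And>i j x. j = i + 1 \<Longrightarrow> x \<in> carrier (cobj X i) \<Longrightarrow> f j (cdiff X i x) = cdiff Y i (f i x)"
proof -
  show 1: "f i \<in> mod_hom L (cobj X i) (cobj Y i)" for i
    using assms unfolding chain_map_def by blast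
  show "f i x \<in> carrier (cobj Y i)" if "x \<in> carrier (cobj X i)" for i x
    by (rule mod_homD(1)[OF 1 that])
  show "f j (cdiff X i x) = cdiff Y i (f i x)" if "j = i + 1" "x \<in> carrier (cobj X i)" for i j x
    using assms that unfolding chain_map_def by blast
qed

lemma chain_map_zero:
  assumes "chain_map L X Y f" "X \<in> bcpx L" "Y \<in> bcpx L"
  shows "f i \<zero>\<^bsub>cobj X i\<^esub> = \<zero>\<^bsub>cobj Y i\<^esub>"
  by (rule mod_hom_zero[OF chain_mapD(1)[OF assms(1)] bcpxD(3)[OF assms(2)] bcpxD(3)[OF assms(3)]])

lemma chain_mapI:
  assumes "\<And>i. f i \<in> mod_hom L (cobj X i) (cobj Y i)"
    "\<And>i x. x \<in> carrier (cobj X i) \<Longrightarrow> f (i + 1) (cdiff X i x) = cdiff Y i (f i x)"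
  shows "chain_map L X Y f"
  using assms unfolding chain_map_def by blast

lemma chain_map_gid: "chain_map L X X gid"
  by (simp add: chain_map_def gid_def mod_hom_id)

lemma chain_map_gcomp:
  "chain_map L X Y f \<Longrightarrow> chain_map L Y Z g \<Longrightarrow> chain_map L X Z (gcomp g f)"
  by (rule chain_mapI) (auto simp: gcomp_def chain_mapD(2,3) intro: mod_hom_comp chain_mapD(1))

text \<open>An elementwise form of \<open>quasi_iso\<close>, which composes without recourse to cosets.\<close>

definition qis :: "('a, 'q) ring_scheme \<Rightarrow> 'a cpx \<Rightarrow> 'a cpx \<Rightarrow> 'a gmap \<Rightarrow> bool" where
  "qis L X Y f \<longleftrightarrow> chain_map L X Y f \<and>
     (\<forall>i. \<forall>x\<in>carrier (cobj X i). \<forall>y\<in>carrier (cobj Y (i - 1)).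
        cdiff X i x = \<zero>\<^bsub>cobj X (i + 1)\<^esub> \<longrightarrow> f i x = cdiff Y (i - 1) y \<longrightarrow>
        (\<exists>w\<in>carrier (cobj X (i - 1)). x = cdiff X (i - 1) w)) \<and>
     (\<forall>i. \<forall>y\<in>carrier (cobj Y i). cdiff Y i y = \<zero>\<^bsub>cobj Y (i + 1)\<^esub> \<longrightarrow>
        (\<exists>x\<in>carrier (cobj X i). cdiff X i x = \<zero>\<^bsub>cobj X (i + 1)\<^esub> \<and>
          (\<exists>w\<in>carrier (cobj Y (i - 1)). y = f i x \<oplus>\<^bsub>cobj Y i\<^esub> cdiff Y (i - 1) w)))"

lemma qisI:
  assumes "chain_map L X Y f"
    "\<And>i x y. x \<in> carrier (cobj X i) \<Longrightarrow> y \<in> carrier (cobj Y (i - 1)) \<Longrightarrow>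
        cdiff X i x = \<zero>\<^bsub>cobj X (i + 1)\<^esub> \<Longrightarrow> f i x = cdiff Y (i - 1) y \<Longrightarrow>
        \<exists>w\<in>carrier (cobj X (i - 1)). x = cdiff X (i - 1) w"
    "\<And>i y. y \<in> carrier (cobj Y i) \<Longrightarrow> cdiff Y i y = \<zero>\<^bsub>cobj Y (i + 1)\<^esub> \<Longrightarrow>
        \<exists>x\<in>carrier (cobj X i). cdiff X i x = \<zero>\<^bsub>cobj X (i + 1)\<^esub> \<and>
          (\<exists>w\<in>carrier (cobj Y (i - 1)). y = f i x \<oplus>\<^bsub>cobj Y i\<^esub> cdiff Y (i - 1) w)"
  shows "qis L X Y f"
  using assms unfolding qis_def by blast

lemma qis_chain_map: "qis L X Y f \<Longrightarrow> chain_map L X Y f"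
  by (simp add: qis_def)

lemma qis_inj:
  assumes "qis L X Y f" "x \<in> carrier (cobj X i)" "y \<in> carrier (cobj Y (i - 1))"
    "cdiff X i x = \<zero>\<^bsub>cobj X (i + 1)\<^esub>" "f i x = cdiff Y (i - 1) y"
  obtains w where "w \<in> carrier (cobj X (i - 1))" "x = cdiff X (i - 1) w"
  using assms unfolding qis_def by blast

lemma qis_surj:
  assumes "qis L X Y f" "y \<in> carrier (cobj Y i)" "cdiff Y i y = \<zero>\<^bsub>cobj Y (i + 1)\<^esub>"
  obtains x w where "x \<in> carrier (cobj X i)" "cdiff X i x = \<zero>\<^bsub>cobj X (i + 1)\<^esub>"
    "w \<in> carrier (cobj Y (i - 1))" "y = f i x \<oplus>\<^bsub>cobj Y i\<^esub> cdiff Y (i - 1) w"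
  using assms unfolding qis_def by blast

lemma qis_bij:
  assumes X: "X \<in> bcpx L" and Y: "Y \<in> bcpx L" and f: "chain_map L X Y f"
    and bij: "\<And>i. inj_on (f i) (carrier (cobj X i))" "\<And>i. f i ` carrier (cobj X i) = carrier (cobj Y i)"
  shows "qis L X Y f"
proof (rule qisI[OF f])
  fix i x y assume x: "x \<in> carrier (cobj X i)" and y: "y \<in> carrier (cobj Y (i - 1))"
    and *: "f i x = cdiff Y (i - 1) y"
  obtain w where w: "w \<in> carrier (cobj X (i - 1))" "y = f (i - 1) w" using bij(2) y by blast
  have "f i x = f i (cdiff X (i - 1) w)" using * w chain_mapD(3)[OF f, of i "i - 1" w] by simp
  then have "x = cdiff X (i - 1) w" using bcpxD(5)[OF X, of i "i - 1" w] w x bij(1)[of i]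
    by (auto dest: inj_onD)
  then show "\<exists>w\<in>carrier (cobj X (i - 1)). x = cdiff X (i - 1) w" using w by blast
next
  fix i y assume y: "y \<in> carrier (cobj Y i)" "cdiff Y i y = \<zero>\<^bsub>cobj Y (i + 1)\<^esub>"
  interpret Yi: abelian_group "cobj Y i" by (rule bcpxD(3)[OF Y])
  interpret Y1: abelian_group "cobj Y (i - 1)" by (rule bcpxD(3)[OF Y])
  interpret Xi: abelian_group "cobj X (i + 1)" by (rule bcpxD(3)[OF X])
  obtain x where x: "x \<in> carrier (cobj X i)" "y = f i x" using bij(2) y by blast
  have "f (i + 1) (cdiff X i x) = f (i + 1) \<zero>\<^bsub>cobj X (i + 1)\<^esub>"
    using chain_mapD(3)[OF f, of "i + 1" i x] x y chain_map_zero[OF f X Y] by simp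
  then have "cdiff X i x = \<zero>\<^bsub>cobj X (i + 1)\<^esub>"
    using bij(1)[of "i + 1"] bcpxD(5)[OF X, of "i + 1" i x] x by (auto dest: inj_onD)
  then show "\<exists>x\<in>carrier (cobj X i). cdiff X i x = \<zero>\<^bsub>cobj X (i + 1)\<^esub> \<and>
          (\<exists>w\<in>carrier (cobj Y (i - 1)). y = f i x \<oplus>\<^bsub>cobj Y i\<^esub> cdiff Y (i - 1) w)"
    using x y bcpxD(7)[OF Y, of "i - 1"]
    by (intro bexI[of _ x] conjI bexI[of _ "\<zero>\<^bsub>cobj Y (i - 1)\<^esub>"]) auto
qed

text \<open>Quasi-isomorphisms have no inverse chain map in general and are composed forwards only.
  Isomorphisms of complexes are the case in which the direction can be reversed, as is necessary for
  an extension by a zero subcomplex.\<close>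

lemma qis_inverse:
  assumes X: "X \<in> bcpx L" and Y: "Y \<in> bcpx L" and f: "chain_map L X Y f"
    and bij: "\<And>i. bij_betw (f i) (carrier (cobj X i)) (carrier (cobj Y i))"
  shows "\<exists>g. qis L Y X g"
proof -
  define g where "g i = inv_into (carrier (cobj X i)) (f i)" for i
  note g = mod_hom_inv_into[OF bcpxD(2)[OF X] chain_mapD(1)[OF f] bij, folded g_def]
  have "chain_map L Y X g"
  proof (rule chain_mapI[OF g(1)])
    fix i y assume y: "y \<in> carrier (cobj Y i)"
    note gy = mod_homD(1)[OF g(1) y]
    have "cdiff Y i y = f (i + 1) (cdiff X i (g i y))"
      using chain_mapD(3)[OF f _ gy, of "i + 1"] g(3)[OF y] by simp
    moreover have "cdiff X i (g i y) \<in> carrier (cobj X (i + 1))" using bcpxD(5)[OF X _ gy] by simp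
    ultimately show "g (i + 1) (cdiff Y i y) = cdiff X i (g i y)" using g(2) by simp
  qed
  moreover have "inj_on (g i) (carrier (cobj Y i))" for i using g(3) by (metis inj_onI)
  moreover have "g i ` carrier (cobj Y i) = carrier (cobj X i)" for i
    using bij[of i] inv_into_image_cancel[of "f i" "carrier (cobj X i)" "carrier (cobj X i)"]
    by (simp add: g_def bij_betw_def)
  ultimately show ?thesis using qis_bij[OF Y X] by blast
qed

lemma qis_gid: "X \<in> bcpx L \<Longrightarrow> qis L X X gid"
  by (rule qis_bij[OF _ _ chain_map_gid]) (auto simp: gid_def)

text \<open>The boundary terms add up: from \<open>z = g y + d w\<close> and
  \<open>y = f x + d v\<close> follows \<open>z = g (f x) + d (g v + w)\<close>.\<close>

lemma qis_gcomp:
  assumes X: "X \<in> bcpx L" and Y: "Y \<in> bcpx L" and Z: "Z \<in> bcpx L"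
    and f: "qis L X Y f" and g: "qis L Y Z g"
  shows "qis L X Z (gcomp g f)"
proof (rule qisI)
  note cf = qis_chain_map[OF f] and cg = qis_chain_map[OF g]
  show "chain_map L X Z (gcomp g f)" by (rule chain_map_gcomp[OF cf cg])
  show "\<exists>w\<in>carrier (cobj X (i - 1)). x = cdiff X (i - 1) w"
    if x: "x \<in> carrier (cobj X i)" "z \<in> carrier (cobj Z (i - 1))" "cdiff X i x = \<zero>\<^bsub>cobj X (i + 1)\<^esub>"
      "gcomp g f i x = cdiff Z (i - 1) z" for i x z
  proof -
    have "cdiff Y i (f i x) = \<zero>\<^bsub>cobj Y (i + 1)\<^esub>"
      using chain_mapD(3)[OF cf, of "i + 1" i x] x chain_map_zero[OF cf X Y] by simp
    then obtain y where "y \<in> carrier (cobj Y (i - 1))" "f i x = cdiff Y (i - 1) y"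
      using qis_inj[OF g chain_mapD(2)[OF cf x(1)] x(2)] x(4) by (auto simp: gcomp_def)
    then show ?thesis using qis_inj[OF f x(1) _ x(3)] by metis
  qed
  show "\<exists>x\<in>carrier (cobj X i). cdiff X i x = \<zero>\<^bsub>cobj X (i + 1)\<^esub> \<and>
          (\<exists>w\<in>carrier (cobj Z (i - 1)). z = gcomp g f i x \<oplus>\<^bsub>cobj Z i\<^esub> cdiff Z (i - 1) w)"
    if z: "z \<in> carrier (cobj Z i)" "cdiff Z i z = \<zero>\<^bsub>cobj Z (i + 1)\<^esub>" for i z
  proof -
    interpret Zi: abelian_group "cobj Z i" by (rule bcpxD(3)[OF Z])
    interpret Z1: abelian_group "cobj Z (i - 1)" by (rule bcpxD(3)[OF Z])
    obtain y w where y: "y \<in> carrier (cobj Y i)" "cdiff Y i y = \<zero>\<^bsub>cobj Y (i + 1)\<^esub>"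
      "w \<in> carrier (cobj Z (i - 1))" "z = g i y \<oplus>\<^bsub>cobj Z i\<^esub> cdiff Z (i - 1) w"
      using qis_surj[OF g z] by blast
    obtain x v where x: "x \<in> carrier (cobj X i)" "cdiff X i x = \<zero>\<^bsub>cobj X (i + 1)\<^esub>"
      "v \<in> carrier (cobj Y (i - 1))" "y = f i x \<oplus>\<^bsub>cobj Y i\<^esub> cdiff Y (i - 1) v"
      using qis_surj[OF f y(1,2)] by blast
    have fx: "f i x \<in> carrier (cobj Y i)" and dv: "cdiff Y (i - 1) v \<in> carrier (cobj Y i)"
      and gv: "g (i - 1) v \<in> carrier (cobj Z (i - 1))"
      using x chain_mapD(2)[OF cf] chain_mapD(2)[OF cg] bcpxD(5)[OF Y, of i "i - 1"] by auto
    have "g i y = g i (f i x) \<oplus>\<^bsub>cobj Z i\<^esub> cdiff Z (i - 1) (g (i - 1) v)"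
      using x(4) mod_homD(2)[OF chain_mapD(1)[OF cg] fx dv] chain_mapD(3)[OF cg, of i "i - 1" v] x(3) by simp
    moreover have "cdiff Z (i - 1) (g (i - 1) v \<oplus>\<^bsub>cobj Z (i - 1)\<^esub> w) =
        cdiff Z (i - 1) (g (i - 1) v) \<oplus>\<^bsub>cobj Z i\<^esub> cdiff Z (i - 1) w"
      by (rule mod_homD(2)[OF bcpxD(4)[OF Z] gv y(3)]) simp
    moreover have "cdiff Z (i - 1) (g (i - 1) v) \<in> carrier (cobj Z i)" "cdiff Z (i - 1) w \<in> carrier (cobj Z i)"
      "g i (f i x) \<in> carrier (cobj Z i)"
      using gv y bcpxD(5)[OF Z, of i "i - 1"] chain_mapD(2)[OF cg fx] by auto
    ultimately have "z = gcomp g f i x \<oplus>\<^bsub>cobj Z i\<^esub> cdiff Z (i - 1) (g (i - 1) v \<oplus>\<^bsub>cobj Z (i - 1)\<^esub> w)"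
      using y(4) by (simp add: gcomp_def Zi.a_assoc)
    then show ?thesis using x gv y by blast
  qed
qed

lemma rsub_coset_eq_iff:
  assumes M: "right_module L M" and H: "rsub L M H" and x: "x \<in> carrier M" "y \<in> carrier M"
  shows "H +>\<^bsub>M\<^esub> x = H +>\<^bsub>M\<^esub> y \<longleftrightarrow> (\<exists>h\<in>H. x = h \<oplus>\<^bsub>M\<^esub> y)"
proof -
  interpret M: right_module L M by fact
  note HD = rsubD[OF H]
  have coset: "H +>\<^bsub>M\<^esub> x = {h \<oplus>\<^bsub>M\<^esub> x | h. h \<in> H}" for x
    by (auto simp: a_r_coset_def')
  have sub: "H +>\<^bsub>M\<^esub> x \<subseteq> H +>\<^bsub>M\<^esub> y" if "x = h \<oplus>\<^bsub>M\<^esub> y" "h \<in> H" "y \<in> carrier M" for x y h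
  proof -
    have "k \<oplus>\<^bsub>M\<^esub> x = (k \<oplus>\<^bsub>M\<^esub> h) \<oplus>\<^bsub>M\<^esub> y" if "k \<in> H" for k
      using \<open>h \<in> H\<close> \<open>x = _\<close> \<open>y \<in> carrier M\<close> that HD(2) by (simp add: M.a_assoc)
    then show ?thesis unfolding coset using HD(4) \<open>h \<in> H\<close> by blast
  qed
  show ?thesis
  proof
    assume "H +>\<^bsub>M\<^esub> x = H +>\<^bsub>M\<^esub> y"
    moreover have "x \<in> H +>\<^bsub>M\<^esub> x" unfolding coset using HD(3) x by force
    ultimately show "\<exists>h\<in>H. x = h \<oplus>\<^bsub>M\<^esub> y" unfolding coset by blast
  next
    assume "\<exists>h\<in>H. x = h \<oplus>\<^bsub>M\<^esub> y"
    then obtain h where h: "h \<in> H" "x = h \<oplus>\<^bsub>M\<^esub> y" by blast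
    then have "y = (\<ominus>\<^bsub>M\<^esub> h) \<oplus>\<^bsub>M\<^esub> x" using HD(2) x by (simp add: M.r_neg1)
    then show "H +>\<^bsub>M\<^esub> x = H +>\<^bsub>M\<^esub> y"
      using sub[OF h(2,1) x(2)] sub[OF _ rsub_minus[OF M H h(1)] x(1)] by blast
  qed
qed

lemma rsub_coboundaries:
  assumes "X \<in> bcpx L"
  shows "rsub L (cobj X i) (coboundaries X i)"
  unfolding coboundaries_def
  by (rule rsub_image[OF bcpxD(2)[OF assms] bcpxD(2)[OF assms] bcpxD(4)[OF assms]
        rsub_carrier[OF bcpxD(2)[OF assms]]]) simp

lemma rsub_cocycles:
  assumes "X \<in> bcpx L"
  shows "rsub L (cobj X i) (cocycles X i)"
  unfolding cocycles_def mod_ker_def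
  by (rule rsub_ker[OF bcpxD(2)[OF assms] bcpxD(2)[OF assms] bcpxD(4)[OF assms]]) simp

text \<open>The bridge to the definition by cosets. All quasi-isomorphisms below are constructed
  elementwise and converted here.\<close>

lemma qis_imp_quasi_iso:
  assumes X: "X \<in> bcpx L" and Y: "Y \<in> bcpx L" and f: "qis L X Y f"
  shows "quasi_iso L X Y f"
  unfolding quasi_iso_def
proof (intro conjI allI)
  note cf = qis_chain_map[OF f]
  show "chain_map L X Y f" by (rule cf)
  fix i
  let ?BX = "coboundaries X i" and ?BY = "coboundaries Y i"
  interpret Xi: right_module L "cobj X i" by (rule bcpxD(2)[OF X])
  interpret Yi: right_module L "cobj Y i" by (rule bcpxD(2)[OF Y])
  note BX = rsub_coboundaries[OF X, of i] and BY = rsub_coboundaries[OF Y, of i]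
  note ZX = rsub_cocycles[OF X, of i] and ZY = rsub_cocycles[OF Y, of i]
  note fh = mod_homD[OF chain_mapD(1)[OF cf]]
  have fB: "f i h \<in> ?BY" if "h \<in> ?BX" for h
    using that chain_mapD(2)[OF cf] chain_mapD(3)[OF cf, of i "i - 1"] by (auto simp: coboundaries_def)
  have fZ: "f i x \<in> cocycles Y i" if "x \<in> cocycles X i" for x
    using that chain_mapD(2)[OF cf] chain_mapD(3)[OF cf, of "i + 1" i x] chain_map_zero[OF cf X Y]
    by (auto simp: cocycles_def mod_ker_def)
  \<comment> \<open>A chain map sends coboundaries to coboundaries, so all cosets in the union
    defining \<open>cohomology_map\<close> are the same one.\<close>
  have map: "cohomology_map Y f i (?BX +>\<^bsub>cobj X i\<^esub> x) = ?BY +>\<^bsub>cobj Y i\<^esub> f i x"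
    if x: "x \<in> carrier (cobj X i)" for x
  proof -
    have "?BY +>\<^bsub>cobj Y i\<^esub> f i z = ?BY +>\<^bsub>cobj Y i\<^esub> f i x" if z: "z \<in> ?BX +>\<^bsub>cobj X i\<^esub> x" for z
    proof -
      obtain h where h: "h \<in> ?BX" "z = h \<oplus>\<^bsub>cobj X i\<^esub> x" using z by (auto simp: a_r_coset_def')
      have hX: "h \<in> carrier (cobj X i)" using rsubD(2)[OF BX h(1)] .
      then have "f i z = f i h \<oplus>\<^bsub>cobj Y i\<^esub> f i x" using fh(2)[OF hX x] h by simp
      then show ?thesis
        using fB[OF h(1)] fh(1) hX x h
        by (subst rsub_coset_eq_iff[OF bcpxD(2)[OF Y] BY]) auto
    qed
    moreover have "x \<in> ?BX +>\<^bsub>cobj X i\<^esub> x"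
      using rsubD(3)[OF BX] x unfolding a_r_coset_def' by force
    ultimately show ?thesis unfolding cohomology_map_def by blast
  qed
  show "bij_betw (cohomology_map Y f i) (cohomology X i) (cohomology Y i)"
    unfolding bij_betw_def
  proof
    show "inj_on (cohomology_map Y f i) (cohomology X i)"
    proof (rule inj_onI)
      fix C D assume "C \<in> cohomology X i" "D \<in> cohomology X i"
        and eq: "cohomology_map Y f i C = cohomology_map Y f i D"
      then obtain x y where x: "x \<in> cocycles X i" "C = ?BX +>\<^bsub>cobj X i\<^esub> x"
        and y: "y \<in> cocycles X i" "D = ?BX +>\<^bsub>cobj X i\<^esub> y" unfolding cohomology_def by blast
      have xX: "x \<in> carrier (cobj X i)" and yX: "y \<in> carrier (cobj X i)"
        using rsubD(2)[OF ZX] x(1) y(1) by auto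
      have "?BY +>\<^bsub>cobj Y i\<^esub> f i x = ?BY +>\<^bsub>cobj Y i\<^esub> f i y" using eq x y map xX yX by simp
      then obtain h where h: "h \<in> ?BY" "f i x = h \<oplus>\<^bsub>cobj Y i\<^esub> f i y"
        using rsub_coset_eq_iff[OF bcpxD(2)[OF Y] BY fh(1)[OF xX] fh(1)[OF yX]] by blast
      obtain v where v: "v \<in> carrier (cobj Y (i - 1))" "h = cdiff Y (i - 1) v"
        using h(1) by (auto simp: coboundaries_def)
      have "f i (x \<ominus>\<^bsub>cobj X i\<^esub> y) = f i x \<ominus>\<^bsub>cobj Y i\<^esub> f i y"
        by (rule mod_hom_diff[OF chain_mapD(1)[OF cf] bcpxD(3)[OF X] bcpxD(3)[OF Y] xX yX])
      also have "\<dots> = h" unfolding h(2) a_minus_def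
        using rsubD(2)[OF BY h(1)] fh(1)[OF yX] by (simp add: Yi.a_assoc Yi.r_neg)
      finally have fd: "f i (x \<ominus>\<^bsub>cobj X i\<^esub> y) = cdiff Y (i - 1) v" using v by simp
      have d: "x \<ominus>\<^bsub>cobj X i\<^esub> y \<in> cocycles X i" by (rule rsub_diff[OF bcpxD(2)[OF X] ZX x(1) y(1)])
      then obtain w where w: "w \<in> carrier (cobj X (i - 1))" "x \<ominus>\<^bsub>cobj X i\<^esub> y = cdiff X (i - 1) w"
        using qis_inj[OF f _ v(1) _ fd] by (auto simp: cocycles_def mod_ker_def)
      have "x = cdiff X (i - 1) w \<oplus>\<^bsub>cobj X i\<^esub> y" unfolding w(2)[symmetric] a_minus_def
        using xX yX by (simp add: Xi.a_assoc Xi.l_neg)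
      then show "C = D" unfolding x(2) y(2)
        using w by (subst rsub_coset_eq_iff[OF bcpxD(2)[OF X] BX xX yX]) (auto simp: coboundaries_def)
    qed
    show "cohomology_map Y f i ` cohomology X i = cohomology Y i"
    proof
      show "cohomology_map Y f i ` cohomology X i \<subseteq> cohomology Y i"
        using map fZ rsubD(2)[OF ZX] unfolding cohomology_def by auto
      show "cohomology Y i \<subseteq> cohomology_map Y f i ` cohomology X i"
      proof
        fix C assume "C \<in> cohomology Y i"
        then obtain y where y: "y \<in> cocycles Y i" "C = ?BY +>\<^bsub>cobj Y i\<^esub> y" unfolding cohomology_def by blast
        then obtain x w where x: "x \<in> carrier (cobj X i)" "cdiff X i x = \<zero>\<^bsub>cobj X (i + 1)\<^esub>"
          "w \<in> carrier (cobj Y (i - 1))" "y = f i x \<oplus>\<^bsub>cobj Y i\<^esub> cdiff Y (i - 1) w"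
          using qis_surj[OF f, of y i] by (auto simp: cocycles_def mod_ker_def)
        have "cdiff Y (i - 1) w \<in> ?BY" using x by (auto simp: coboundaries_def)
        moreover have "y = cdiff Y (i - 1) w \<oplus>\<^bsub>cobj Y i\<^esub> f i x"
          using x fh(1) bcpxD(5)[OF Y, of i "i - 1"] by (simp add: Yi.a_comm)
        ultimately have "C = ?BY +>\<^bsub>cobj Y i\<^esub> f i x" unfolding y(2)
          using rsub_coset_eq_iff[OF bcpxD(2)[OF Y] BY] rsubD(2)[OF ZY y(1)] fh(1)[OF x(1)] by blast
        then have "C = cohomology_map Y f i (?BX +>\<^bsub>cobj X i\<^esub> x)" using map x by simp
        moreover have "x \<in> cocycles X i" using x by (simp add: cocycles_def mod_ker_def)
        ultimately show "C \<in> cohomology_map Y f i ` cohomology X i" unfolding cohomology_def by blast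
      qed
    qed
  qed
qed

section \<open>Cones and exact sequences\<close>

text \<open>Normal forms for degrees; the nested successors stem from the definitions of
  \<open>bcpx\<close> and \<open>cone\<close>.\<close>

lemma int_index [simp]:
  fixes i :: int
  shows "i + 1 + 1 = i + 2" "i + 1 + 2 = i + 3" "i + 2 + 1 = i + 3" "i - 1 + 2 = i + 1"
  by simp_all

lemma abelian_group_minus_zero: "abelian_group G \<Longrightarrow> \<ominus>\<^bsub>G\<^esub> \<zero>\<^bsub>G\<^esub> = \<zero>\<^bsub>G\<^esub>"
  by (metis abelian_group.minus_equality abelian_group.axioms(1) abelian_monoid.l_zero abelian_monoid.zero_closed)

section \<open>Sums, shifts and cones of bounded complexes\<close>

lemma cpx_sum_simps [simp]:
  "cobj (cpx_sum X Y) i = mod_sum (cobj X i) (cobj Y i)"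
  "cdiff (cpx_sum X Y) i p = Join (cdiff X i (lft p)) (cdiff Y i (rgt p))"
  by (simp_all add: cpx_sum_def)

lemma cpx_zero_simps [simp]: "cobj (cpx_zero L) i = zero_mod L" "cdiff (cpx_zero L) i x = x"
  by (simp_all add: cpx_zero_def)

lemma cone_simps [simp]:
  "cobj (cone X Y f) i = mod_sum (cobj X (i + 1)) (cobj Y i)"
  "cdiff (cone X Y f) i p = Join (\<ominus>\<^bsub>cobj X (i + 2)\<^esub> cdiff X (i + 1) (lft p))
                         (f (i + 1) (lft p) \<oplus>\<^bsub>cobj Y (i + 1)\<^esub> cdiff Y i (rgt p))"
  by (simp_all add: cone_def add.assoc)

lemma cpx_shift_simps [simp]:
  "cobj (cpx_shift n X) i = cobj X (i + n)"
  "cdiff (cpx_shift n X) i x = (if even n then cdiff X (i + n) x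
                    else \<ominus>\<^bsub>cobj X (i + n + 1)\<^esub> cdiff X (i + n) x)"
  by (simp_all add: cpx_shift_def)

lemma cpx_sum_in_bcpx:
  assumes X: "X \<in> bcpx L" and Y: "Y \<in> bcpx L"
  shows "cpx_sum X Y \<in> bcpx L"
proof -
  obtain b where b: "\<And>i. \<bar>i\<bar> > b \<Longrightarrow> carrier (cobj X i) = {\<zero>\<^bsub>cobj X i\<^esub>}" using bcpx_bound[OF X] by blast
  obtain c where c: "\<And>i. \<bar>i\<bar> > c \<Longrightarrow> carrier (cobj Y i) = {\<zero>\<^bsub>cobj Y i\<^esub>}" using bcpx_bound[OF Y] by blast
  show ?thesis
  proof (rule bcpxI[of _ _ "max b c"])
    show "cobj (cpx_sum X Y) i \<in> mod_cat L" for i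
      using mod_sum_in_mod_cat[OF bcpxD(1)[OF X] bcpxD(1)[OF Y]] by simp
    show "cdiff (cpx_sum X Y) i \<in> mod_hom L (cobj (cpx_sum X Y) i) (cobj (cpx_sum X Y) (i + 1))" for i
      unfolding cpx_sum_simps(1) cpx_sum_def
      by (simp, rule mod_hom_Join[OF mod_hom_comp[OF bcpxD(4)[OF X] lft_hom] mod_hom_comp[OF bcpxD(4)[OF Y] rgt_hom]])
        simp_all
    show "cdiff (cpx_sum X Y) (i + 1) (cdiff (cpx_sum X Y) i p) = \<zero>\<^bsub>cobj (cpx_sum X Y) (i + 2)\<^esub>"
      if "p \<in> carrier (cobj (cpx_sum X Y) i)" for i p
      using that bcpxD(6)[OF X] bcpxD(6)[OF Y] by auto
    show "carrier (cobj (cpx_sum X Y) i) \<subseteq> {\<zero>\<^bsub>cobj (cpx_sum X Y) i\<^esub>}" if "max b c < \<bar>i\<bar>" for i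
      using b[of i] c[of i] that by auto
  qed
qed

lemma cpx_zero_in_bcpx:
  assumes "ring L"
  shows "cpx_zero L \<in> bcpx L"
  by (rule bcpxI[of _ _ 0])
    (auto simp: zero_mod_in_mod_cat[OF assms] cpx_zero_def mod_hom_id)

lemma cpx_shift_in_bcpx:
  assumes X: "X \<in> bcpx L"
  shows "cpx_shift n X \<in> bcpx L"
proof -
  obtain b where b: "\<And>i. \<bar>i\<bar> > b \<Longrightarrow> carrier (cobj X i) = {\<zero>\<^bsub>cobj X i\<^esub>}" using bcpx_bound[OF X] by blast
  have d: "cdiff X (i + n) \<in> mod_hom L (cobj X (i + n)) (cobj X (i + 1 + n))" for i
    by (rule bcpxD(4)[OF X]) simp
  have hom: "cdiff (cpx_shift n X) i \<in> mod_hom L (cobj (cpx_shift n X) i) (cobj (cpx_shift n X) (i + 1))" for i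
    using d[of i] mod_hom_neg[OF bcpxD(1)[OF X] d, of i]
    by (cases "even n") (simp_all add: cpx_shift_def algebra_simps)
  show ?thesis
  proof (rule bcpxI[of _ _ "b + \<bar>n\<bar>"])
    show "cobj (cpx_shift n X) i \<in> mod_cat L" for i using bcpxD(1)[OF X] by simp
    show "cdiff (cpx_shift n X) i \<in> mod_hom L (cobj (cpx_shift n X) i) (cobj (cpx_shift n X) (i + 1))" for i
      by (rule hom)
    show "cdiff (cpx_shift n X) (i + 1) (cdiff (cpx_shift n X) i x) = \<zero>\<^bsub>cobj (cpx_shift n X) (i + 2)\<^esub>"
      if "x \<in> carrier (cobj (cpx_shift n X) i)" for i x
    proof -
      interpret A: abelian_group "cobj X (i + 2 + n)" by (rule bcpxD(3)[OF X])
      have dd: "cdiff X (i + 1 + n) (cdiff X (i + n) x) = \<zero>\<^bsub>cobj X (i + 2 + n)\<^esub>"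
        using bcpxD(6)[OF X, of "i + 1 + n" "i + n" x] that by (simp add: algebra_simps)
      have m: "cdiff X (i + 1 + n) (\<ominus>\<^bsub>cobj X (i + 1 + n)\<^esub> cdiff X (i + n) x) =
          \<ominus>\<^bsub>cobj X (i + 2 + n)\<^esub> cdiff X (i + 1 + n) (cdiff X (i + n) x)"
        by (rule mod_hom_minus[OF bcpxD(4)[OF X] bcpxD(3)[OF X] bcpxD(3)[OF X] bcpxD(5)[OF X]])
          (use that in auto)
      show ?thesis
      proof (cases "even n")
        case True
        then show ?thesis using dd by simp
      next
        case False
        have e: "i + 1 + n + 1 = i + 2 + n" "i + n + 1 = i + 1 + n" by simp_all
        show ?thesis using False m dd unfolding cpx_shift_simps e by simp
      qed
    qed
    show "carrier (cobj (cpx_shift n X) i) \<subseteq> {\<zero>\<^bsub>cobj (cpx_shift n X) i\<^esub>}" if "b + \<bar>n\<bar> < \<bar>i\<bar>" for i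
      using b[of "i + n"] that by simp
  qed
qed

lemma cone_in_bcpx:
  assumes X: "X \<in> bcpx L" and Y: "Y \<in> bcpx L" and f: "chain_map L X Y f"
  shows "cone X Y f \<in> bcpx L"
proof -
  obtain b where b: "\<And>i. \<bar>i\<bar> > b \<Longrightarrow> carrier (cobj X i) = {\<zero>\<^bsub>cobj X i\<^esub>}" using bcpx_bound[OF X] by blast
  obtain c where c: "\<And>i. \<bar>i\<bar> > c \<Longrightarrow> carrier (cobj Y i) = {\<zero>\<^bsub>cobj Y i\<^esub>}" using bcpx_bound[OF Y] by blast
  show ?thesis
  \<comment> \<open>The extra 1 is due to degree \<open>i\<close> of the cone containing degree
    \<open>i + 1\<close> of \<open>X\<close>.\<close>
  proof (rule bcpxI[of _ _ "max b c + 1"])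
    show "cobj (cone X Y f) i \<in> mod_cat L" for i
      using mod_sum_in_mod_cat[OF bcpxD(1)[OF X] bcpxD(1)[OF Y]] by simp
    show "cdiff (cone X Y f) i \<in> mod_hom L (cobj (cone X Y f) i) (cobj (cone X Y f) (i + 1))" for i
    proof -
      have "cdiff (cone X Y f) i = (\<lambda>p. Join (\<ominus>\<^bsub>cobj X (i + 1 + 1)\<^esub> cdiff X (i + 1) (lft p))
                         (f (i + 1) (lft p) \<oplus>\<^bsub>cobj Y (i + 1)\<^esub> cdiff Y i (rgt p)))"
        by (simp add: cone_def)
      moreover have "\<dots> \<in> mod_hom L (cobj (cone X Y f) i) (cobj (cone X Y f) (i + 1))"
        unfolding cone_simps(1)
        by (rule mod_hom_Join mod_hom_neg mod_hom_add bcpxD(1)[OF X] bcpxD(1)[OF Y]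
          mod_hom_comp[OF bcpxD(4)[OF X] lft_hom] mod_hom_comp[OF bcpxD(4)[OF Y] rgt_hom]
          mod_hom_comp[OF chain_mapD(1)[OF f] lft_hom] refl)+
      ultimately show ?thesis by simp
    qed
    show "cdiff (cone X Y f) (i + 1) (cdiff (cone X Y f) i p) = \<zero>\<^bsub>cobj (cone X Y f) (i + 2)\<^esub>"
      if pc: "p \<in> carrier (cobj (cone X Y f) i)" for i p
    proof -
      obtain x y where p: "p = Join x y" "x \<in> carrier (cobj X (i + 1))" "y \<in> carrier (cobj Y i)"
        using pc by auto
      interpret X3: abelian_group "cobj X (i + 3)" by (rule bcpxD(3)[OF X])
      interpret X2: abelian_group "cobj X (i + 2)" by (rule bcpxD(3)[OF X])
      interpret Y2: abelian_group "cobj Y (i + 2)" by (rule bcpxD(3)[OF Y])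
      have dx: "cdiff X (i + 1) x \<in> carrier (cobj X (i + 2))" using bcpxD(5)[OF X _ p(2)] by simp
      have dy: "cdiff Y i y \<in> carrier (cobj Y (i + 1))" using bcpxD(5)[OF Y _ p(3)] by simp
      have fx: "f (i + 1) x \<in> carrier (cobj Y (i + 1))" by (rule chain_mapD(2)[OF f p(2)])
      have 1: "cdiff X (i + 2) (\<ominus>\<^bsub>cobj X (i + 2)\<^esub> cdiff X (i + 1) x) = \<zero>\<^bsub>cobj X (i + 3)\<^esub>"
        using mod_hom_minus[OF bcpxD(4)[OF X, of "i + 3" "i + 2"] bcpxD(3)[OF X] bcpxD(3)[OF X] dx]
          bcpxD(6)[OF X, of "i + 2" "i + 1" x] p(2) by simp
      have 2: "f (i + 2) (\<ominus>\<^bsub>cobj X (i + 2)\<^esub> cdiff X (i + 1) x) = \<ominus>\<^bsub>cobj Y (i + 2)\<^esub> cdiff Y (i + 1) (f (i + 1) x)"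
        using mod_hom_minus[OF chain_mapD(1)[OF f] bcpxD(3)[OF X] bcpxD(3)[OF Y] dx]
          chain_mapD(3)[OF f, of "i + 2" "i + 1" x] p(2) by simp
      have 3: "cdiff Y (i + 1) (f (i + 1) x \<oplus>\<^bsub>cobj Y (i + 1)\<^esub> cdiff Y i y) = cdiff Y (i + 1) (f (i + 1) x)"
        using mod_homD(2)[OF bcpxD(4)[OF Y, of "i + 2" "i + 1"] fx dy] bcpxD(6)[OF Y, of "i + 1" i y] p(3)
          bcpxD(5)[OF Y, of "i + 2" "i + 1", OF _ fx] by simp
      have "cdiff Y (i + 1) (f (i + 1) x) \<in> carrier (cobj Y (i + 2))"
        using bcpxD(5)[OF Y, of "i + 2" "i + 1", OF _ fx] by simp
      then show ?thesis using 1 2 3 p(1) abelian_group_minus_zero[OF bcpxD(3)[OF X]] by (simp add: Y2.l_neg)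
    qed
    show "carrier (cobj (cone X Y f) i) \<subseteq> {\<zero>\<^bsub>cobj (cone X Y f) i\<^esub>}" if "max b c + 1 < \<bar>i\<bar>" for i
      using b[of "i + 1"] c[of i] that by auto
  qed
qed

section \<open>Short exact sequences of complexes and their cones\<close>

definition subcpx :: "'a cpx \<Rightarrow> (int \<Rightarrow> 'a melt set) \<Rightarrow> 'a cpx" where
  "subcpx X U = \<lparr>cobj = (\<lambda>i. submod (cobj X i) (U i)), cdiff = cdiff X\<rparr>"

lemma subcpx_simps [simp]: "cobj (subcpx X U) i = submod (cobj X i) (U i)" "cdiff (subcpx X U) i = cdiff X i"
  by (simp_all add: subcpx_def)

text \<open>Degreewise exact sequences take the place of triangles in all the counting. They allow
  pullbacks and kernels to be formed on elements.\<close>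

definition ses :: "('a, 'q) ring_scheme \<Rightarrow> 'a cpx \<Rightarrow> 'a cpx \<Rightarrow> 'a cpx \<Rightarrow> 'a gmap \<Rightarrow> 'a gmap \<Rightarrow> bool" where
  "ses L A X C f p \<longleftrightarrow> A \<in> bcpx L \<and> X \<in> bcpx L \<and> C \<in> bcpx L \<and> chain_map L A X f \<and> chain_map L X C p \<and>
     (\<forall>i. inj_on (f i) (carrier (cobj A i))) \<and> (\<forall>i. p i ` carrier (cobj X i) = carrier (cobj C i)) \<and>
     (\<forall>i. f i ` carrier (cobj A i) = {x \<in> carrier (cobj X i). p i x = \<zero>\<^bsub>cobj C i\<^esub>})"

lemma sesI:
  assumes "A \<in> bcpx L" "X \<in> bcpx L" "C \<in> bcpx L" "chain_map L A X f" "chain_map L X C p"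
    "\<And>i. inj_on (f i) (carrier (cobj A i))" "\<And>i. p i ` carrier (cobj X i) = carrier (cobj C i)"
    "\<And>i. f i ` carrier (cobj A i) = {x \<in> carrier (cobj X i). p i x = \<zero>\<^bsub>cobj C i\<^esub>}"
  shows "ses L A X C f p"
  using assms unfolding ses_def by blast

lemma sesD:
  assumes "ses L A X C f p"
  shows "A \<in> bcpx L" "X \<in> bcpx L" "C \<in> bcpx L" "chain_map L A X f" "chain_map L X C p"
    "\<And>i x y. x \<in> carrier (cobj A i) \<Longrightarrow> y \<in> carrier (cobj A i) \<Longrightarrow> f i x = f i y \<Longrightarrow> x = y"
    "\<And>i c. c \<in> carrier (cobj C i) \<Longrightarrow> \<exists>x\<in>carrier (cobj X i). c = p i x"
    "\<And>i a. a \<in> carrier (cobj A i) \<Longrightarrow> p i (f i a) = \<zero>\<^bsub>cobj C i\<^esub>"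
    "\<And>i x. x \<in> carrier (cobj X i) \<Longrightarrow> p i x = \<zero>\<^bsub>cobj C i\<^esub> \<Longrightarrow> \<exists>a\<in>carrier (cobj A i). x = f i a"
proof -
  have *: "A \<in> bcpx L \<and> X \<in> bcpx L \<and> C \<in> bcpx L \<and> chain_map L A X f \<and> chain_map L X C p"
    and inj: "\<forall>i. inj_on (f i) (carrier (cobj A i))"
    and sur: "\<forall>i. p i ` carrier (cobj X i) = carrier (cobj C i)"
    and ex: "\<forall>i. f i ` carrier (cobj A i) = {x \<in> carrier (cobj X i). p i x = \<zero>\<^bsub>cobj C i\<^esub>}"
    using assms by (auto simp: ses_def)
  show "A \<in> bcpx L" "X \<in> bcpx L" "C \<in> bcpx L" "chain_map L A X f" "chain_map L X C p" using * by blast+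
  show "x = y" if "x \<in> carrier (cobj A i)" "y \<in> carrier (cobj A i)" "f i x = f i y" for i x y
    using inj that by (auto dest: inj_onD)
  show "\<exists>x\<in>carrier (cobj X i). c = p i x" if "c \<in> carrier (cobj C i)" for i c using sur that by blast
  show "p i (f i a) = \<zero>\<^bsub>cobj C i\<^esub>" if "a \<in> carrier (cobj A i)" for i a using ex that by blast
  show "\<exists>a\<in>carrier (cobj A i). x = f i a" if "x \<in> carrier (cobj X i)" "p i x = \<zero>\<^bsub>cobj C i\<^esub>" for i x
    using ex that by blast
qed

definition cone_proj :: "'a gmap \<Rightarrow> 'a gmap" where
  "cone_proj p = (\<lambda>i z. p i (rgt z))"

text \<open>A diagram chase. A cocycle \<open>c = p x\<close> lifts to \<open>(- a, x)\<close> with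
  \<open>f a = d x\<close>; the sign makes the two contributions in \<open>X\<close> cancel. If
  \<open>(a, x)\<close> is a cocycle and \<open>p x\<close> is the boundary of \<open>p x'\<close>,
  then \<open>x - d x'\<close> is some \<open>f a'\<close>, and injectivity of \<open>f\<close>
  identifies \<open>(a, x)\<close> as the boundary of \<open>(a', x')\<close>.\<close>

lemma qis_cone_proj:
  assumes S: "ses L A X C f p"
  shows "qis L (cone A X f) C (cone_proj p)"
proof (rule qisI)
  note A = sesD(1)[OF S] and X = sesD(2)[OF S] and C = sesD(3)[OF S]
  note f = sesD(4)[OF S] and p = sesD(5)[OF S]
  show "chain_map L (cone A X f) C (cone_proj p)"
  proof (rule chain_mapI)
    show "cone_proj p i \<in> mod_hom L (cobj (cone A X f) i) (cobj C i)" for i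
      unfolding cone_proj_def cone_simps by (rule mod_hom_comp[OF chain_mapD(1)[OF p] rgt_hom])
    fix i z assume "z \<in> carrier (cobj (cone A X f) i)"
    then obtain a x where z: "z = Join a x" "a \<in> carrier (cobj A (i + 1))" "x \<in> carrier (cobj X i)" by auto
    interpret Ci: abelian_group "cobj C (i + 1)" by (rule bcpxD(3)[OF C])
    have dx: "cdiff X i x \<in> carrier (cobj X (i + 1))" using bcpxD(5)[OF X _ z(3)] by simp
    have "p (i + 1) (f (i + 1) a \<oplus>\<^bsub>cobj X (i + 1)\<^esub> cdiff X i x) = p (i + 1) (f (i + 1) a) \<oplus>\<^bsub>cobj C (i + 1)\<^esub> p (i + 1) (cdiff X i x)"
      by (rule mod_homD(2)[OF chain_mapD(1)[OF p] chain_mapD(2)[OF f z(2)] dx])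
    also have "\<dots> = p (i + 1) (cdiff X i x)"
      using sesD(8)[OF S z(2)] chain_mapD(2)[OF p dx] by simp
    finally show "cone_proj p (i + 1) (cdiff (cone A X f) i z) = cdiff C i (cone_proj p i z)"
      using z chain_mapD(3)[OF p, of "i + 1" i x] by (simp add: cone_proj_def)
  qed
next
  note A = sesD(1)[OF S] and X = sesD(2)[OF S] and C = sesD(3)[OF S]
  note f = sesD(4)[OF S] and p = sesD(5)[OF S]
  fix i z c assume zc: "z \<in> carrier (cobj (cone A X f) i)" and c: "c \<in> carrier (cobj C (i - 1))"
    and dz: "cdiff (cone A X f) i z = \<zero>\<^bsub>cobj (cone A X f) (i + 1)\<^esub>" and pz: "cone_proj p i z = cdiff C (i - 1) c"
  obtain a x where z: "z = Join a x" "a \<in> carrier (cobj A (i + 1))" "x \<in> carrier (cobj X i)" using zc by auto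
  interpret Ai: abelian_group "cobj A (i + 1)" by (rule bcpxD(3)[OF A])
  interpret Xi: abelian_group "cobj X i" by (rule bcpxD(3)[OF X])
  interpret X1: abelian_group "cobj X j" for j by (rule bcpxD(3)[OF X])
  interpret Ci: abelian_group "cobj C i" by (rule bcpxD(3)[OF C])
  have px: "p i x = cdiff C (i - 1) c" using pz z by (simp add: cone_proj_def)
  have fadx: "f (i + 1) a \<oplus>\<^bsub>cobj X (i + 1)\<^esub> cdiff X i x = \<zero>\<^bsub>cobj X (i + 1)\<^esub>"
    using dz z by simp
  obtain x' where x': "x' \<in> carrier (cobj X (i - 1))" "c = p (i - 1) x'" using sesD(7)[OF S c] by blast
  have dx': "cdiff X (i - 1) x' \<in> carrier (cobj X i)" using bcpxD(5)[OF X _ x'(1)] by simp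
  have "p i (x \<ominus>\<^bsub>cobj X i\<^esub> cdiff X (i - 1) x') = p i x \<ominus>\<^bsub>cobj C i\<^esub> p i (cdiff X (i - 1) x')"
    by (rule mod_hom_diff[OF chain_mapD(1)[OF p] bcpxD(3)[OF X] bcpxD(3)[OF C] z(3) dx'])
  also have "p i (cdiff X (i - 1) x') = p i x" using px x' chain_mapD(3)[OF p, of i "i - 1" x'] by simp
  finally have "p i (x \<ominus>\<^bsub>cobj X i\<^esub> cdiff X (i - 1) x') = \<zero>\<^bsub>cobj C i\<^esub>"
    using chain_mapD(2)[OF p z(3)] by (simp add: a_minus_def Ci.r_neg)
  then obtain a' where a': "a' \<in> carrier (cobj A i)" "x \<ominus>\<^bsub>cobj X i\<^esub> cdiff X (i - 1) x' = f i a'"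
    using sesD(9)[OF S, of "x \<ominus>\<^bsub>cobj X i\<^esub> cdiff X (i - 1) x'" i] z(3) dx' by auto
  have fa': "f i a' \<in> carrier (cobj X i)" by (rule chain_mapD(2)[OF f a'(1)])
  have x: "x = f i a' \<oplus>\<^bsub>cobj X i\<^esub> cdiff X (i - 1) x'"
    unfolding a'(2)[symmetric] a_minus_def using z(3) dx' by (simp add: Xi.a_assoc Xi.l_neg)
  have "cdiff X i x = cdiff X i (f i a') \<oplus>\<^bsub>cobj X (i + 1)\<^esub> cdiff X i (cdiff X (i - 1) x')"
    unfolding x by (rule mod_homD(2)[OF bcpxD(4)[OF X] fa' dx']) simp
  also have "\<dots> = f (i + 1) (cdiff A i a')"
    using bcpxD(6)[OF X, of i "i - 1" x'] x'(1) chain_mapD(3)[OF f, of "i + 1" i a'] a'(1)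
      bcpxD(5)[OF X, of "i + 1" i, OF _ fa'] by simp
  finally have dx: "cdiff X i x = f (i + 1) (cdiff A i a')" .
  have da': "cdiff A i a' \<in> carrier (cobj A (i + 1))" using bcpxD(5)[OF A _ a'(1)] by simp
  have "f (i + 1) a = \<ominus>\<^bsub>cobj X (i + 1)\<^esub> f (i + 1) (cdiff A i a')"
    using fadx dx chain_mapD(2)[OF f da'] chain_mapD(2)[OF f z(2)] X1.minus_equality by simp
  also have "\<dots> = f (i + 1) (\<ominus>\<^bsub>cobj A (i + 1)\<^esub> cdiff A i a')"
    by (rule mod_hom_minus[OF chain_mapD(1)[OF f] bcpxD(3)[OF A] bcpxD(3)[OF X] da', symmetric])
  finally have "a = \<ominus>\<^bsub>cobj A (i + 1)\<^esub> cdiff A i a'"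
    using sesD(6)[OF S z(2)] da' by simp
  then show "\<exists>w\<in>carrier (cobj (cone A X f) (i - 1)). z = cdiff (cone A X f) (i - 1) w"
    using z x a' x' by (intro bexI[of _ "Join a' x'"]) auto
next
  note A = sesD(1)[OF S] and X = sesD(2)[OF S] and C = sesD(3)[OF S]
  note f = sesD(4)[OF S] and p = sesD(5)[OF S]
  fix i c assume c: "c \<in> carrier (cobj C i)" "cdiff C i c = \<zero>\<^bsub>cobj C (i + 1)\<^esub>"
  interpret A1: abelian_group "cobj A (i + 1)" by (rule bcpxD(3)[OF A])
  interpret A2: abelian_group "cobj A (i + 2)" by (rule bcpxD(3)[OF A])
  interpret X1: abelian_group "cobj X (i + 1)" by (rule bcpxD(3)[OF X])
  interpret Ci: abelian_group "cobj C i" by (rule bcpxD(3)[OF C])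
  interpret C1: abelian_group "cobj C (i - 1)" by (rule bcpxD(3)[OF C])
  obtain x where x: "x \<in> carrier (cobj X i)" "c = p i x" using sesD(7)[OF S c(1)] by blast
  have dx: "cdiff X i x \<in> carrier (cobj X (i + 1))" using bcpxD(5)[OF X _ x(1)] by simp
  have "p (i + 1) (cdiff X i x) = \<zero>\<^bsub>cobj C (i + 1)\<^esub>"
    using chain_mapD(3)[OF p, of "i + 1" i x] x c by simp
  then obtain a where a: "a \<in> carrier (cobj A (i + 1))" "cdiff X i x = f (i + 1) a"
    using sesD(9)[OF S dx] by blast
  have da: "cdiff A (i + 1) a \<in> carrier (cobj A (i + 2))" using bcpxD(5)[OF A _ a(1)] by simp
  have "f (i + 2) (cdiff A (i + 1) a) = f (i + 2) \<zero>\<^bsub>cobj A (i + 2)\<^esub>"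
    using chain_mapD(3)[OF f, of "i + 2" "i + 1" a] a chain_map_zero[OF f A X]
      bcpxD(6)[OF X, of "i + 1" i x] x(1) by simp
  then have da0: "cdiff A (i + 1) a = \<zero>\<^bsub>cobj A (i + 2)\<^esub>" using sesD(6)[OF S da] by simp
  have 1: "cdiff A (i + 1) (\<ominus>\<^bsub>cobj A (i + 1)\<^esub> a) = \<zero>\<^bsub>cobj A (i + 2)\<^esub>"
    using mod_hom_minus[OF bcpxD(4)[OF A, of "i + 2" "i + 1"] bcpxD(3)[OF A] bcpxD(3)[OF A] a(1)] da0 by simp
  have 2: "f (i + 1) (\<ominus>\<^bsub>cobj A (i + 1)\<^esub> a) = \<ominus>\<^bsub>cobj X (i + 1)\<^esub> cdiff X i x"
    using mod_hom_minus[OF chain_mapD(1)[OF f] bcpxD(3)[OF A] bcpxD(3)[OF X] a(1)] a(2) by simp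
  let ?z = "Join (\<ominus>\<^bsub>cobj A (i + 1)\<^esub> a) x"
  have "?z \<in> carrier (cobj (cone A X f) i)" using a x by simp
  moreover have "cdiff (cone A X f) i ?z = \<zero>\<^bsub>cobj (cone A X f) (i + 1)\<^esub>"
    using 1 2 dx by (simp add: X1.l_neg)
  moreover have "c = cone_proj p i ?z \<oplus>\<^bsub>cobj C i\<^esub> cdiff C (i - 1) \<zero>\<^bsub>cobj C (i - 1)\<^esub>"
    using bcpxD(7)[OF C, of "i - 1"] x(2) c(1) by (simp add: cone_proj_def)
  ultimately show "\<exists>z\<in>carrier (cobj (cone A X f) i). cdiff (cone A X f) i z = \<zero>\<^bsub>cobj (cone A X f) (i + 1)\<^esub> \<and>
          (\<exists>w\<in>carrier (cobj C (i - 1)). c = cone_proj p i z \<oplus>\<^bsub>cobj C i\<^esub> cdiff C (i - 1) w)"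
    by (intro bexI[of _ ?z] conjI bexI[of _ "\<zero>\<^bsub>cobj C (i - 1)\<^esub>"]) auto
qed

text \<open>This rotates a sequence: together with \<open>qis_cone_proj\<close> a subcomplex can be
  moved to the quotient side at the price of a shift.\<close>

lemma ses_cone:
  assumes A: "A \<in> bcpx L" and X: "X \<in> bcpx L" and f: "chain_map L A X f"
  shows "ses L X (cone A X f) (cpx_shift 1 A) (cone_in A) cone_out"
proof (rule sesI)
  show "X \<in> bcpx L" by fact
  show "cone A X f \<in> bcpx L" by (rule cone_in_bcpx[OF A X f])
  show "cpx_shift 1 A \<in> bcpx L" by (rule cpx_shift_in_bcpx[OF A])
  have z: "f i \<zero>\<^bsub>cobj A i\<^esub> = \<zero>\<^bsub>cobj X i\<^esub>" for i by (rule chain_map_zero[OF f A X])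
  show "chain_map L X (cone A X f) (cone_in A)"
  proof (rule chain_mapI)
    show "cone_in A i \<in> mod_hom L (cobj X i) (cobj (cone A X f) i)" for i
      unfolding cone_in_def cone_simps
      by (rule mod_hom_Join[OF mod_hom_const_zero[OF bcpxD(1)[OF A]] mod_hom_id])
    fix i x assume x: "x \<in> carrier (cobj X i)"
    interpret X1: abelian_group "cobj X (i + 1)" by (rule bcpxD(3)[OF X])
    have "cdiff A (i + 1) \<zero>\<^bsub>cobj A (i + 1)\<^esub> = \<zero>\<^bsub>cobj A (i + 2)\<^esub>"
      using bcpxD(7)[OF A, of "i + 1"] by simp
    then show "cone_in A (i + 1) (cdiff X i x) = cdiff (cone A X f) i (cone_in A i x)"
      using bcpxD(5)[OF X _ x, of "i + 1"] z abelian_group_minus_zero[OF bcpxD(3)[OF A]]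
      by (simp add: cone_in_def)
  qed
  show "chain_map L (cone A X f) (cpx_shift 1 A) cone_out"
  proof (rule chain_mapI)
    show "cone_out i \<in> mod_hom L (cobj (cone A X f) i) (cobj (cpx_shift 1 A) i)" for i
      unfolding cone_out_def by (simp del: mod_sum_simps) (rule lft_hom)
  qed (simp add: cone_out_def add.assoc)
  have X0: "\<exists>x. x \<in> carrier (cobj X i)" for i
    using abelian_group.axioms(1)[OF bcpxD(3)[OF X]] abelian_monoid.zero_closed by blast
  show "inj_on (cone_in A i) (carrier (cobj X i))" for i by (auto simp: inj_on_def cone_in_def)
  show "cone_out i ` carrier (cobj (cone A X f) i) = carrier (cobj (cpx_shift 1 A) i)" for i
    using X0[of i] by (force simp: cone_out_def)
  interpret A: abelian_group "cobj A i" for i by (rule bcpxD(3)[OF A])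
  show "cone_in A i ` carrier (cobj X i) = {x \<in> carrier (cobj (cone A X f) i). cone_out i x = \<zero>\<^bsub>cobj (cpx_shift 1 A) i\<^esub>}" for i
    by (auto simp: cone_out_def cone_in_def)
qed

section \<open>Roofs\<close>

text \<open>Witnessed by the zero homotopy. The diagrams of roofs constructed below commute
  strictly, so no other homotopy occurs.\<close>

lemma homotopic_refl:
  assumes "X \<in> bcpx L" "Y \<in> bcpx L" "chain_map L X Y f"
  shows "homotopic L X Y f f"
  unfolding homotopic_def
proof (intro exI[of _ "\<lambda>i x. \<zero>\<^bsub>cobj Y (i - 1)\<^esub>"] conjI allI ballI)
  show "(\<lambda>x. \<zero>\<^bsub>cobj Y (i - 1)\<^esub>) \<in> mod_hom L (cobj X i) (cobj Y (i - 1))" for i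
    by (rule mod_hom_const_zero[OF bcpxD(1)[OF assms(2)]])
  fix i x assume x: "x \<in> carrier (cobj X i)"
  interpret Yi: abelian_group "cobj Y i" by (rule bcpxD(3)[OF assms(2)])
  show "f i x = f i x \<oplus>\<^bsub>cobj Y i\<^esub> (cdiff Y (i - 1) \<zero>\<^bsub>cobj Y (i - 1)\<^esub> \<oplus>\<^bsub>cobj Y i\<^esub> \<zero>\<^bsub>cobj Y (i + 1 - 1)\<^esub>)"
    using bcpxD(7)[OF assms(2), of "i - 1"] chain_mapD(2)[OF assms(3) x] by simp
qed

definition qroof :: "('a, 'q) ring_scheme \<Rightarrow> 'a cpx \<Rightarrow> 'a cpx \<Rightarrow> 'a roof \<Rightarrow> bool" where
  "qroof L X Y r \<longleftrightarrow> X \<in> bcpx L \<and> Y \<in> bcpx L \<and> apex r \<in> bcpx L \<and> qis L (apex r) X (den r) \<and>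
     chain_map L (apex r) Y (num r)"

lemma qroof_db_hom: "qroof L X Y r \<Longrightarrow> r \<in> db_hom L X Y"
  by (auto simp: qroof_def db_hom_def intro: qis_imp_quasi_iso)

lemma qroof_of_map: "X \<in> bcpx L \<Longrightarrow> Y \<in> bcpx L \<Longrightarrow> chain_map L X Y f \<Longrightarrow> qroof L X Y (db_of_map X f)"
  by (simp add: qroof_def db_of_map_def qis_gid)

lemma gcomp_gid [simp]: "gcomp f gid = f" "gcomp gid f = f"
  by (simp_all add: gcomp_def gid_def)

text \<open>\<open>W\<close> with \<open>u\<close> and \<open>v\<close> completes the two roofs to
  their composite, and \<open>W'\<close> with \<open>u'\<close> and \<open>v'\<close> compares it
  with \<open>c\<close>. Strict equalities suffice here: in every use \<open>u\<close> and
  \<open>v'\<close> are identities, and only \<open>v\<close> and \<open>u'\<close> carry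
  information.\<close>

lemma db_compI:
  assumes r: "qroof L X Y r" and t: "qroof L Y Z t" and c: "qroof L X Z c"
    and W: "W \<in> bcpx L" "qis L W (apex r) u" "chain_map L W (apex t) v"
    and uv: "gcomp (num r) u = gcomp (den t) v"
    and W': "W' \<in> bcpx L" "chain_map L W' (apex c) u'" "qis L W' W v'"
    and den: "gcomp (den c) u' = gcomp (gcomp (den r) u) v'"
    and num: "gcomp (num c) u' = gcomp (gcomp (num t) v) v'"
  shows "db_comp L X Y Z r t c"
proof -
  have mem: "X \<in> bcpx L" "Y \<in> bcpx L" "Z \<in> bcpx L" "apex r \<in> bcpx L" "apex t \<in> bcpx L" "apex c \<in> bcpx L"
    and r': "qis L (apex r) X (den r)" "chain_map L (apex r) Y (num r)"
    and t': "qis L (apex t) Y (den t)" "chain_map L (apex t) Z (num t)"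
    using r t c by (auto simp: qroof_def)
  have d: "qis L W X (gcomp (den r) u)" by (rule qis_gcomp[OF W(1) mem(4,1) W(2) r'(1)])
  have n: "chain_map L W Z (gcomp (num t) v)" by (rule chain_map_gcomp[OF W(3) t'(2)])
  let ?c = "\<lparr>apex = W, den = gcomp (den r) u, num = gcomp (num t) v\<rparr>"
  have c': "qroof L X Z ?c" using d n mem W by (simp add: qroof_def)
  have d': "qis L W' X (gcomp (gcomp (den r) u) v')" by (rule qis_gcomp[OF W'(1) W(1) mem(1) W'(3) d])
  have "db_eq L X Z c ?c" unfolding db_eq_def
  proof (intro conjI, rule qroof_db_hom[OF c], rule qroof_db_hom[OF c'],
      rule bexI[of _ W'], rule exI[of _ u'], rule exI[of _ v'], intro conjI)
    show "W' \<in> bcpx L" "chain_map L W' (apex c) u'" by fact+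
    show "chain_map L W' (apex ?c) v'" using qis_chain_map[OF W'(3)] by simp
    show "quasi_iso L W' X (gcomp (den c) u')" unfolding den by (rule qis_imp_quasi_iso[OF W'(1) mem(1) d'])
    show "homotopic L W' X (gcomp (den c) u') (gcomp (den ?c) v')"
      using homotopic_refl[OF W'(1) mem(1) qis_chain_map[OF d']] den by simp
    show "homotopic L W' Z (gcomp (num c) u') (gcomp (num ?c) v')"
      using homotopic_refl[OF W'(1) mem(3) chain_map_gcomp[OF qis_chain_map[OF W'(3)] n]] num by simp
  qed
  then have "quasi_iso L W (apex r) u \<and> chain_map L W (apex t) v \<and>
      homotopic L W Y (gcomp (num r) u) (gcomp (den t) v) \<and> db_eq L X Z c ?c"
    using qis_imp_quasi_iso[OF W(1) mem(4) W(2)] W(3)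
      homotopic_refl[OF W(1) mem(2) chain_map_gcomp[OF qis_chain_map[OF W(2)] r'(2)]] uv by simp
  then show ?thesis unfolding db_comp_def
    using qroof_db_hom[OF r] qroof_db_hom[OF t] qroof_db_hom[OF c] W(1) by blast
qed

text \<open>The inverse is the same roof read backwards. Each composite has apex \<open>W\<close>
  and two equal legs, and that leg maps it to the identity roof.\<close>

lemma db_iso_of_qis:
  assumes W: "W \<in> bcpx L" and X: "X \<in> bcpx L" and Y: "Y \<in> bcpx L"
    and f: "qis L W X f" and g: "qis L W Y g"
  shows "db_iso L X Y \<lparr>apex = W, den = f, num = g\<rparr>" (is "db_iso L X Y ?r")
proof -
  let ?t = "\<lparr>apex = W, den = g, num = f\<rparr>"
  note cf = qis_chain_map[OF f] and cg = qis_chain_map[OF g]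
  have r: "qroof L X Y ?r" "qroof L Y X ?t" using assms cf cg by (simp_all add: qroof_def)
  have "db_comp L X Y X ?r ?t (db_of_map X gid)"
    by (rule db_compI[where u = gid and v = gid and u' = f and v' = gid,
        OF r qroof_of_map[OF X X chain_map_gid] W _ _ _ W _ qis_gid[OF W]])
      (simp_all add: qis_gid[OF W] chain_map_gid cf db_of_map_def)
  moreover have "db_comp L Y X Y ?t ?r (db_of_map Y gid)"
    by (rule db_compI[where u = gid and v = gid and u' = g and v' = gid,
        OF r(2,1) qroof_of_map[OF Y Y chain_map_gid] W _ _ _ W _ qis_gid[OF W]])
      (simp_all add: qis_gid[OF W] chain_map_gid cg db_of_map_def)
  ultimately show ?thesis unfolding db_iso_def by blast
qed

lemma db_comp_of_maps:
  assumes "X \<in> bcpx L" "Y \<in> bcpx L" "Z \<in> bcpx L" "chain_map L X Y f" "chain_map L Y Z g" "h = gcomp g f"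
  shows "db_comp L X Y Z (db_of_map X f) (db_of_map Y g) (db_of_map X h)"
  unfolding assms(6)
  by (rule db_compI[where u = gid and v = f and u' = gid and v' = gid,
        OF qroof_of_map[OF assms(1,2,4)] qroof_of_map[OF assms(2,3,5)]
        qroof_of_map[OF assms(1,3) chain_map_gcomp[OF assms(4,5)]] assms(1) _ _ _ assms(1) _ qis_gid[OF assms(1)]])
    (simp_all add: db_of_map_def qis_gid assms chain_map_gid)

text \<open>The standard triangle of \<open>f\<close>, with its cone replaced by \<open>C\<close>
  along the quasi-isomorphism \<open>cone_proj p\<close>. The connecting morphism need not be a
  chain map: it is the roof \<open>?c\<close>, which inverts \<open>cone_proj p\<close> and then
  projects the cone to the shift of \<open>A\<close>.\<close>

lemma db_triangle_of_ses:
  assumes S: "ses L A X C f p"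
  shows "\<exists>a b c. db_triangle L A X C a b c"
proof -
  note A = sesD(1)[OF S] and X = sesD(2)[OF S] and C = sesD(3)[OF S]
  note f = sesD(4)[OF S] and p = sesD(5)[OF S]
  let ?K = "cone A X f" and ?A1 = "cpx_shift 1 A" and ?q = "cone_proj p"
  have K: "?K \<in> bcpx L" by (rule cone_in_bcpx[OF A X f])
  have A1: "?A1 \<in> bcpx L" by (rule cpx_shift_in_bcpx[OF A])
  have q: "qis L ?K C ?q" by (rule qis_cone_proj[OF S])
  note cq = qis_chain_map[OF q]
  have ci: "chain_map L X ?K (cone_in A)" and co: "chain_map L ?K ?A1 cone_out"
    using sesD(4,5)[OF ses_cone[OF A X f]] by auto
  let ?c = "\<lparr>apex = ?K, den = ?q, num = cone_out\<rparr>"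
  have c: "qroof L C ?A1 ?c" using K C A1 q co by (simp add: qroof_def)
  have iso: "db_iso L B B (db_of_map B gid)" if "B \<in> bcpx L" for B
    using db_iso_of_qis[OF that that that qis_gid[OF that] qis_gid[OF that]] by (simp add: db_of_map_def)
  have shift: "db_shift 1 (db_of_map A gid) = db_of_map ?A1 gid"
    by (simp add: db_shift_def db_of_map_def gshift_def gid_def)
  have "db_triangle L A X C (db_of_map A f) (db_of_map X p) ?c"
    unfolding db_triangle_def
  proof (intro conjI, rule qroof_db_hom[OF qroof_of_map[OF A X f]],
      rule qroof_db_hom[OF qroof_of_map[OF X C p]], rule qroof_db_hom[OF c],
      rule bexI[of _ A], rule bexI[of _ X], rule exI[of _ f], intro conjI, rule f,
      rule exI[of _ "db_of_map A gid"], rule exI[of _ "db_of_map X gid"],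
      rule exI[of _ "db_of_map ?K ?q"], intro conjI)
    show "A \<in> bcpx L" "X \<in> bcpx L" by fact+
    show "db_iso L A A (db_of_map A gid)" "db_iso L X X (db_of_map X gid)" by (rule iso[OF A], rule iso[OF X])
    show "db_iso L ?K C (db_of_map ?K ?q)"
      using db_iso_of_qis[OF K K C qis_gid[OF K] q] by (simp add: db_of_map_def)
    show "db_square L A X A X (db_of_map A f) (db_of_map A f) (db_of_map A gid) (db_of_map X gid)"
      unfolding db_square_def
      by (intro exI[of _ "db_of_map A f"] conjI db_comp_of_maps A X f chain_map_gid) simp_all
    show "db_square L X ?K X C (db_of_map X (cone_in A)) (db_of_map X p) (db_of_map X gid) (db_of_map ?K ?q)"
      unfolding db_square_def
      by (intro exI[of _ "db_of_map X p"] conjI db_comp_of_maps X K C p ci cq chain_map_gid)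
        (simp_all, simp add: gcomp_def cone_proj_def cone_in_def)
    show "db_square L ?K ?A1 C ?A1 (db_of_map ?K cone_out) ?c (db_of_map ?K ?q) (db_shift 1 (db_of_map A gid))"
      unfolding db_square_def shift
    proof (intro exI[of _ "db_of_map ?K cone_out"] conjI)
      show "db_comp L ?K ?A1 ?A1 (db_of_map ?K cone_out) (db_of_map ?A1 gid) (db_of_map ?K cone_out)"
        by (intro db_comp_of_maps K A1 co chain_map_gid) simp
      show "db_comp L ?K C ?A1 (db_of_map ?K ?q) ?c (db_of_map ?K cone_out)"
        by (rule db_compI[where u = gid and v = gid and u' = gid and v' = gid,
            OF qroof_of_map[OF K C cq] c qroof_of_map[OF K A1 co] K _ _ _ K _ qis_gid[OF K]])
          (simp_all add: db_of_map_def qis_gid[OF K] chain_map_gid)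
    qed
  qed
  then show ?thesis by blast
qed

section \<open>Levels of generation\<close>

lemma db_isomorphic_of_qis:
  "W \<in> bcpx L \<Longrightarrow> X \<in> bcpx L \<Longrightarrow> Y \<in> bcpx L \<Longrightarrow> qis L W X f \<Longrightarrow> qis L W Y g \<Longrightarrow> db_isomorphic L X Y"
  unfolding db_isomorphic_def using db_iso_of_qis by blast

definition gsum :: "'a gmap \<Rightarrow> 'a gmap \<Rightarrow> 'a gmap" where
  "gsum f g = (\<lambda>i p. Join (f i (lft p)) (g i (rgt p)))"

lemma chain_map_gsum:
  assumes "chain_map L X X' f" "chain_map L Y Y' g"
  shows "chain_map L (cpx_sum X Y) (cpx_sum X' Y') (gsum f g)"
proof (rule chain_mapI)
  show "gsum f g i \<in> mod_hom L (cobj (cpx_sum X Y) i) (cobj (cpx_sum X' Y') i)" for i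
    unfolding gsum_def cpx_sum_simps
    by (rule mod_hom_Join[OF mod_hom_comp[OF chain_mapD(1)[OF assms(1)] lft_hom] mod_hom_comp[OF chain_mapD(1)[OF assms(2)] rgt_hom]])
  fix i p assume "p \<in> carrier (cobj (cpx_sum X Y) i)"
  then show "gsum f g (i + 1) (cdiff (cpx_sum X Y) i p) = cdiff (cpx_sum X' Y') i (gsum f g i p)"
    using chain_mapD(3)[OF assms(1)] chain_mapD(3)[OF assms(2)] by (auto simp: gsum_def)
qed

lemma qis_gsum:
  assumes "qis L X X' f" "qis L Y Y' g"
  shows "qis L (cpx_sum X Y) (cpx_sum X' Y') (gsum f g)"
proof (rule qisI)
  show "chain_map L (cpx_sum X Y) (cpx_sum X' Y') (gsum f g)"
    by (rule chain_map_gsum[OF qis_chain_map[OF assms(1)] qis_chain_map[OF assms(2)]])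
next
  fix i p q assume p: "p \<in> carrier (cobj (cpx_sum X Y) i)" and q: "q \<in> carrier (cobj (cpx_sum X' Y') (i - 1))"
    and d: "cdiff (cpx_sum X Y) i p = \<zero>\<^bsub>cobj (cpx_sum X Y) (i + 1)\<^esub>"
    and e: "gsum f g i p = cdiff (cpx_sum X' Y') (i - 1) q"
  obtain x y where x: "p = Join x y" "x \<in> carrier (cobj X i)" "y \<in> carrier (cobj Y i)" using p by auto
  obtain u v where u: "q = Join u v" "u \<in> carrier (cobj X' (i - 1))" "v \<in> carrier (cobj Y' (i - 1))" using q by auto
  obtain w where w: "w \<in> carrier (cobj X (i - 1))" "x = cdiff X (i - 1) w"
    using qis_inj[OF assms(1) x(2) u(2)] d e x(1) u(1) by (auto simp: gsum_def)
  obtain z where z: "z \<in> carrier (cobj Y (i - 1))" "y = cdiff Y (i - 1) z"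
    using qis_inj[OF assms(2) x(3) u(3)] d e x(1) u(1) by (auto simp: gsum_def)
  show "\<exists>w\<in>carrier (cobj (cpx_sum X Y) (i - 1)). p = cdiff (cpx_sum X Y) (i - 1) w"
    using w z x(1) by (intro bexI[of _ "Join w z"]) auto
next
  fix i q assume q: "q \<in> carrier (cobj (cpx_sum X' Y') i)"
    and d: "cdiff (cpx_sum X' Y') i q = \<zero>\<^bsub>cobj (cpx_sum X' Y') (i + 1)\<^esub>"
  obtain u v where u: "q = Join u v" "u \<in> carrier (cobj X' i)" "v \<in> carrier (cobj Y' i)" using q by auto
  obtain x w where x: "x \<in> carrier (cobj X i)" "cdiff X i x = \<zero>\<^bsub>cobj X (i + 1)\<^esub>"
    "w \<in> carrier (cobj X' (i - 1))" "u = f i x \<oplus>\<^bsub>cobj X' i\<^esub> cdiff X' (i - 1) w"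
    using qis_surj[OF assms(1) u(2)] d u(1) by auto
  obtain y z where y: "y \<in> carrier (cobj Y i)" "cdiff Y i y = \<zero>\<^bsub>cobj Y (i + 1)\<^esub>"
    "z \<in> carrier (cobj Y' (i - 1))" "v = g i y \<oplus>\<^bsub>cobj Y' i\<^esub> cdiff Y' (i - 1) z"
    using qis_surj[OF assms(2) u(3)] d u(1) by auto
  show "\<exists>p\<in>carrier (cobj (cpx_sum X Y) i). cdiff (cpx_sum X Y) i p = \<zero>\<^bsub>cobj (cpx_sum X Y) (i + 1)\<^esub> \<and>
     (\<exists>w\<in>carrier (cobj (cpx_sum X' Y') (i - 1)). q = gsum f g i p \<oplus>\<^bsub>cobj (cpx_sum X' Y') i\<^esub> cdiff (cpx_sum X' Y') (i - 1) w)"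
    using x y u(1) by (intro bexI[of _ "Join x y"] conjI bexI[of _ "Join w z"]) (auto simp: gsum_def)
qed

lemma cpx_shift_0 [simp]: "cpx_shift 0 X = X"
  by (simp add: cpx_shift_def)

text \<open>The complement is the zero complex and the list is \<open>[X0]\<close> with shift 0.
  Through this rule an extension, up to quasi-isomorphism, enters \<open>db_diamond\<close>.\<close>

lemma db_gen_one_qis:
  assumes L: "ring L" and X0: "X0 \<in> I" "X0 \<in> bcpx L" and X: "X \<in> bcpx L" and f: "qis L X0 X f"
  shows "X \<in> db_gen_one L I"
proof -
  note Z = cpx_zero_in_bcpx[OF L]
  note S0 = cpx_sum_in_bcpx[OF X0(2) Z]
  have "db_isomorphic L (cpx_sum X (cpx_zero L)) (cpx_sum_list L [X0])"
    using db_isomorphic_of_qis[OF S0 cpx_sum_in_bcpx[OF X Z] S0 qis_gsum[OF f qis_gid[OF Z]] qis_gid[OF S0]]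
    by simp
  moreover have "set [X0] \<subseteq> {cpx_shift n Y | n Y. Y \<in> I}" using X0(1)
    by (auto intro!: exI[of _ 0] exI[of _ X0])
  ultimately show ?thesis using X Z unfolding db_gen_one_def by blast
qed

lemma db_gen_subset_bcpx: "db_gen L I k \<subseteq> bcpx L"
  by (induction L I k rule: db_gen.induct) (auto simp: db_gen_one_def db_diamond_def)

section \<open>Subcomplexes and complexes with zero differential\<close>

lemma bcpx_zero_closed: "X \<in> bcpx L \<Longrightarrow> \<zero>\<^bsub>cobj X i\<^esub> \<in> carrier (cobj X i)"
  by (rule rsubD(3)[OF rsub_carrier[OF bcpxD(2)]])

lemma chain_map_into_subcpx:
  assumes "chain_map L Y X f" "\<And>i y. y \<in> carrier (cobj Y i) \<Longrightarrow> f i y \<in> U i"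
  shows "chain_map L Y (subcpx X U) f"
  by (rule chain_mapI) (auto simp: chain_mapD(3)[OF assms(1)] intro!: mod_hom_into_submod chain_mapD(1)[OF assms(1)] assms(2))

lemma chain_map_from_subcpx:
  assumes "chain_map L X Y f" "\<And>i. U i \<subseteq> carrier (cobj X i)"
  shows "chain_map L (subcpx X U) Y f"
  using assms(2)
  by (intro chain_mapI) (auto simp: chain_mapD(3)[OF assms(1)] subset_iff intro!: mod_hom_from_submod chain_mapD(1)[OF assms(1)])

text \<open>In the derived category this is the sum of the modules \<open>N i\<close>, each placed
  in degree \<open>i\<close>. Keeping all degrees in one complex allows them to be resolved
  simultaneously, at the cost of a single one.\<close>

definition zcpx :: "(int \<Rightarrow> ('a, 'a melt) module) \<Rightarrow> 'a cpx" where
  "zcpx N = \<lparr>cobj = N, cdiff = (\<lambda>i x. \<zero>\<^bsub>N (i + 1)\<^esub>)\<rparr>"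

lemma zcpx_simps [simp]: "cobj (zcpx N) i = N i" "cdiff (zcpx N) i x = \<zero>\<^bsub>N (i + 1)\<^esub>"
  by (simp_all add: zcpx_def)

definition bounded_fam :: "(int \<Rightarrow> ('a, 'b) module) \<Rightarrow> bool" where
  "bounded_fam N \<longleftrightarrow> (\<exists>b. \<forall>i. \<bar>i\<bar> > b \<longrightarrow> carrier (N i) \<subseteq> {\<zero>\<^bsub>N i\<^esub>})"

lemma bounded_fam_bcpx: "X \<in> bcpx L \<Longrightarrow> bounded_fam (cobj X)"
  unfolding bounded_fam_def by (rule bcpx_bound) (auto intro!: exI)

lemma zcpx_in_bcpx:
  assumes "\<And>i. N i \<in> mod_cat L" "bounded_fam N"
  shows "zcpx N \<in> bcpx L"
proof -
  obtain b where b: "\<forall>i. \<bar>i\<bar> > b \<longrightarrow> carrier (N i) \<subseteq> {\<zero>\<^bsub>N i\<^esub>}"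
    using assms(2) unfolding bounded_fam_def by blast
  show ?thesis
  proof (rule bcpxI)
    show "cdiff (zcpx N) i \<in> mod_hom L (cobj (zcpx N) i) (cobj (zcpx N) (i + 1))" for i
      using mod_hom_const_zero[OF assms(1)] by (simp add: zcpx_def)
    show "carrier (cobj (zcpx N) i) \<subseteq> {\<zero>\<^bsub>cobj (zcpx N) i\<^esub>}" if "b < \<bar>i\<bar>" for i using b that by simp
  qed (use assms(1) in \<open>simp_all\<close>)
qed

lemma cpx_shift_zcpx:
  assumes "\<And>i. N i \<in> mod_cat L"
  shows "cpx_shift n (zcpx N) = zcpx (\<lambda>i. N (i + n))"
proof -
  have "cdiff (cpx_shift n (zcpx N)) = cdiff (zcpx (\<lambda>i. N (i + n)))"
    using abelian_group_minus_zero[OF mod_cat_abelian[OF assms]]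
    by (intro ext) (simp add: algebra_simps)
  then show ?thesis by (simp add: cpx_shift_def zcpx_def)
qed

lemma chain_map_zcpx:
  assumes "\<And>i. M i \<in> mod_cat L" "\<And>i. N i \<in> mod_cat L" "\<And>i. f i \<in> mod_hom L (M i) (N i)"
  shows "chain_map L (zcpx M) (zcpx N) f"
  using mod_hom_zero[OF assms(3) mod_cat_abelian[OF assms(1)] mod_cat_abelian[OF assms(2)]] assms(3)
  by (intro chain_mapI) auto

text \<open>What the homological part takes from artin algebras: finitely generated modules are
  closed under submodules, so kernels, cocycles and coboundaries do not leave the category.\<close>

locale fg_noetherian =
  fixes L :: "('a, 'q) ring_scheme"
  assumes ring_L: "ring L"
    and noetherian: "\<And>M U. M \<in> mod_cat L \<Longrightarrow> rsub L M U \<Longrightarrow> submod M U \<in> mod_cat L"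
begin

lemma subcpx_in_bcpx:
  assumes X: "X \<in> bcpx L" and U: "\<And>i. rsub L (cobj X i) (U i)"
    and d: "\<And>i x. x \<in> U i \<Longrightarrow> cdiff X i x \<in> U (i + 1)"
  shows "subcpx X U \<in> bcpx L"
proof -
  obtain b where b: "\<And>i. \<bar>i\<bar> > b \<Longrightarrow> carrier (cobj X i) = {\<zero>\<^bsub>cobj X i\<^esub>}" using bcpx_bound[OF X] by blast
  show ?thesis
  proof (rule bcpxI)
    show "cobj (subcpx X U) i \<in> mod_cat L" for i using noetherian[OF bcpxD(1)[OF X] U] by simp
    show "cdiff (subcpx X U) i \<in> mod_hom L (cobj (subcpx X U) i) (cobj (subcpx X U) (i + 1))" for i
      unfolding subcpx_simps
      by (rule mod_hom_into_submod[OF mod_hom_from_submod[OF bcpxD(4)[OF X] rsubD(1)[OF U]]]) (auto simp: d)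
    show "cdiff (subcpx X U) (i + 1) (cdiff (subcpx X U) i x) = \<zero>\<^bsub>cobj (subcpx X U) (i + 2)\<^esub>"
      if "x \<in> carrier (cobj (subcpx X U) i)" for i x
      using bcpxD(6)[OF X, of "i + 1" i x] that rsubD(2)[OF U] by simp
    show "carrier (cobj (subcpx X U) i) \<subseteq> {\<zero>\<^bsub>cobj (subcpx X U) i\<^esub>}" if "b < \<bar>i\<bar>" for i
      using b[OF that] rsubD(1)[OF U, of i] by auto
  qed
qed

lemma ker_subcpx:
  assumes X: "X \<in> bcpx L" and Y: "Y \<in> bcpx L" and f: "chain_map L X Y f"
  shows "subcpx X (\<lambda>i. {x \<in> carrier (cobj X i). f i x = \<zero>\<^bsub>cobj Y i\<^esub>}) \<in> bcpx L"
proof (rule subcpx_in_bcpx[OF X])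
  show "rsub L (cobj X i) {x \<in> carrier (cobj X i). f i x = \<zero>\<^bsub>cobj Y i\<^esub>}" for i
    by (rule rsub_ker[OF bcpxD(2)[OF X] bcpxD(2)[OF Y] chain_mapD(1)[OF f]])
  show "cdiff X i x \<in> {x \<in> carrier (cobj X (i + 1)). f (i + 1) x = \<zero>\<^bsub>cobj Y (i + 1)\<^esub>}"
    if "x \<in> {x \<in> carrier (cobj X i). f i x = \<zero>\<^bsub>cobj Y i\<^esub>}" for i x
    using that bcpxD(5)[OF X] chain_mapD(3)[OF f] bcpxD(7)[OF Y] by auto
qed

lemma ses_ker:
  assumes X: "X \<in> bcpx L" and Y: "Y \<in> bcpx L" and f: "chain_map L X Y f"
    and sur: "\<And>i. f i ` carrier (cobj X i) = carrier (cobj Y i)"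
  shows "ses L (subcpx X (\<lambda>i. {x \<in> carrier (cobj X i). f i x = \<zero>\<^bsub>cobj Y i\<^esub>})) X Y gid f"
  by (rule sesI[OF ker_subcpx[OF X Y f] X Y _ f _ sur])
    (auto intro!: chain_map_from_subcpx[OF chain_map_gid], auto simp: gid_def)

lemma cpx_sum_list_in_bcpx:
  assumes "set Ys \<subseteq> bcpx L"
  shows "cpx_sum_list L Ys \<in> bcpx L"
  using assms by (induction Ys) (auto intro: cpx_sum_in_bcpx cpx_zero_in_bcpx[OF ring_L])

end

section \<open>Strict levels of generation by a single complex\<close>

locale generator = fg_noetherian L for L :: "('a, 'q) ring_scheme" +
  fixes S :: "'a cpx"
  assumes S_in: "S \<in> bcpx L"
begin

text \<open>Membership of \<open>C\<close> in \<open>\<langle>S\<rangle>\<^sub>1\<close>, witnessed by quasi-isomorphisms instead of roofs.\<close>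

definition level_one :: "'a cpx \<Rightarrow> bool" where
  "level_one C \<longleftrightarrow> C \<in> bcpx L \<and> (\<exists>C'\<in>bcpx L. \<exists>Ys. \<exists>W\<in>bcpx L. \<exists>f g.
     set Ys \<subseteq> {cpx_shift n Y | n Y. Y \<in> {S}} \<and> qis L W (cpx_sum C C') f \<and> qis L W (cpx_sum_list L Ys) g)"

lemma shifts_in_bcpx: "set Ys \<subseteq> {cpx_shift n Y | n Y. Y \<in> {S}} \<Longrightarrow> cpx_sum_list L Ys \<in> bcpx L"
  using cpx_shift_in_bcpx[OF S_in] by (intro cpx_sum_list_in_bcpx) auto

lemma level_one_db_gen_one: "level_one C \<Longrightarrow> C \<in> db_gen_one L {S}"
  unfolding level_one_def db_gen_one_def
  using db_isomorphic_of_qis[OF _ cpx_sum_in_bcpx shifts_in_bcpx] by blast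

lemma level_one_qis:
  assumes "level_one C" "qis L C D h" "D \<in> bcpx L"
  shows "level_one D"
proof -
  obtain C' Ys W f g where *: "C \<in> bcpx L" "C' \<in> bcpx L" "W \<in> bcpx L"
    "set Ys \<subseteq> {cpx_shift n Y | n Y. Y \<in> {S}}" "qis L W (cpx_sum C C') f" "qis L W (cpx_sum_list L Ys) g"
    using assms(1) unfolding level_one_def by blast
  have "qis L W (cpx_sum D C') (gcomp (gsum h gid) f)"
    by (rule qis_gcomp[OF *(3) cpx_sum_in_bcpx[OF *(1,2)] cpx_sum_in_bcpx[OF assms(3) *(2)] *(5)
          qis_gsum[OF assms(2) qis_gid[OF *(2)]]])
  then show ?thesis unfolding level_one_def using * assms(3) by blast
qed

text \<open>A strict counterpart of \<open>db_gen\<close>: the sequence is exact in each degree, the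
  quasi-isomorphism points from the extension to \<open>X\<close>, and direct summands are taken
  only inside \<open>level_one\<close>. Level 0 contains complexes with zero terms, not all acyclic
  ones; invariance under quasi-isomorphism therefore starts at level 1.\<close>

fun level :: "nat \<Rightarrow> 'a cpx set" where
  "level 0 = {X \<in> bcpx L. \<forall>i. carrier (cobj X i) = {\<zero>\<^bsub>cobj X i\<^esub>}}"
| "level (Suc a) = {X \<in> bcpx L. \<exists>A X0 C f p g. ses L A X0 C f p \<and> A \<in> level a \<and> level_one C \<and> qis L X0 X g}"

lemma level_SucI:
  "ses L A X0 C f p \<Longrightarrow> A \<in> level a \<Longrightarrow> level_one C \<Longrightarrow> qis L X0 X g \<Longrightarrow> X \<in> bcpx L \<Longrightarrow> X \<in> level (Suc a)"
  unfolding level.simps by blast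

lemma level_qis: "X \<in> level (Suc a) \<Longrightarrow> qis L X Y h \<Longrightarrow> Y \<in> bcpx L \<Longrightarrow> Y \<in> level (Suc a)"
  unfolding level.simps using qis_gcomp sesD(2) by blast

text \<open>Exact sequences become triangles. The induction starts at level 1 because
  \<open>db_gen\<close> begins there with \<open>db_gen_one\<close>, whereas \<open>level\<close>
  begins with an extension of zero.\<close>

lemma level_db_gen: "X \<in> level (Suc a) \<Longrightarrow> X \<in> db_gen L {S} (Suc a)"
proof (induction a arbitrary: X)
  case 0
  then obtain A X0 C f p g where *: "ses L A X0 C f p" "A \<in> level 0" "level_one C" "qis L X0 X g" "X \<in> bcpx L"
    by auto
  note p = sesD(5)[OF *(1)] and X0 = sesD(2)[OF *(1)] and C = sesD(3)[OF *(1)]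
  \<comment> \<open>The subcomplex \<open>A\<close> is zero, so \<open>p\<close> is an isomorphism,
    and \<open>X0\<close> inherits \<open>level_one\<close> from \<open>C\<close> along its
    inverse.\<close>
  have inj: "x = y" if x: "x \<in> carrier (cobj X0 i)" "y \<in> carrier (cobj X0 i)" "p i x = p i y" for x y i
  proof -
    interpret X: abelian_group "cobj X0 i" by (rule bcpxD(3)[OF X0])
    interpret C: abelian_group "cobj C i" by (rule bcpxD(3)[OF C])
    have "p i (x \<ominus>\<^bsub>cobj X0 i\<^esub> y) = \<zero>\<^bsub>cobj C i\<^esub>"
      using mod_hom_diff[OF chain_mapD(1)[OF p] bcpxD(3)[OF X0] bcpxD(3)[OF C] x(1,2)] x(3)
        chain_mapD(2)[OF p x(2)] by (simp add: a_minus_def C.r_neg)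
    then obtain a where "a \<in> carrier (cobj A i)" "x \<ominus>\<^bsub>cobj X0 i\<^esub> y = f i a"
      using sesD(9)[OF *(1), of "x \<ominus>\<^bsub>cobj X0 i\<^esub> y" i] x(1,2) by auto
    moreover have "carrier (cobj A i) = {\<zero>\<^bsub>cobj A i\<^esub>}" using *(2) by simp
    ultimately have "x \<ominus>\<^bsub>cobj X0 i\<^esub> y = \<zero>\<^bsub>cobj X0 i\<^esub>"
      using chain_map_zero[OF sesD(4,1,2)[OF *(1)]] by simp
    then show ?thesis using x(1,2)
      by (metis X.add.inv_closed X.minus_equality X.minus_minus a_minus_def)
  qed
  then have "bij_betw (p i) (carrier (cobj X0 i)) (carrier (cobj C i))" for i
    using *(1) by (auto simp: bij_betw_def ses_def intro: inj_onI)
  then obtain q where "qis L C X0 q" using qis_inverse[OF X0 C p] by blast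
  then have "level_one X0" by (rule level_one_qis[OF *(3) _ X0])
  then show ?case using level_one_db_gen_one[OF level_one_qis[OF _ *(4,5)]] by simp
next
  case (Suc a)
  then obtain A X0 C f p g where *: "ses L A X0 C f p" "A \<in> level (Suc a)" "level_one C" "qis L X0 X g" "X \<in> bcpx L"
    unfolding level.simps(2)[of "Suc a"] by blast
  have X0: "X0 \<in> bcpx L" by (rule sesD(2)[OF *(1)])
  have "X0 \<in> db_star L (db_gen L {S} (Suc a)) (db_gen_one L {S})"
    unfolding db_star_def
    using X0 Suc.IH[OF *(2)] level_one_db_gen_one[OF *(3)] db_triangle_of_ses[OF *(1)] by blast
  then show ?case using db_gen_one_qis[OF ring_L _ X0 *(5,4)] by (simp add: db_diamond_def)
qed

text \<open>\<open>C\<close> has length at most \<open>r\<close> if extending any complex by \<open>C\<close> on the right costs at most \<open>r\<close> steps.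
  Quantifying over all extensions yields associativity without the octahedral axiom.\<close>

definition length_le :: "'a cpx \<Rightarrow> nat \<Rightarrow> bool" where
  "length_le C r \<longleftrightarrow> C \<in> bcpx L \<and> (\<forall>a A X f p. ses L A X C f p \<longrightarrow> A \<in> level a \<longrightarrow> X \<in> level (a + r))"

lemma length_leD: "length_le C r \<Longrightarrow> ses L A X C f p \<Longrightarrow> A \<in> level a \<Longrightarrow> X \<in> level (a + r)"
  unfolding length_le_def by blast

lemma length_le_bcpx: "length_le C r \<Longrightarrow> C \<in> bcpx L"
  by (simp add: length_le_def)

lemma length_leI: "C \<in> bcpx L \<Longrightarrow> (\<And>a A X f p. ses L A X C f p \<Longrightarrow> A \<in> level a \<Longrightarrow> X \<in> level (a + r)) \<Longrightarrow> length_le C r"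
  unfolding length_le_def by blast

lemma length_le_one: "level_one C \<Longrightarrow> length_le C 1"
proof (rule length_leI)
  assume "level_one C"
  then show "C \<in> bcpx L" by (simp add: level_one_def)
  fix a A X f p assume *: "ses L A X C f p" "A \<in> level a"
  show "X \<in> level (a + 1)"
    using level_SucI[OF * \<open>level_one C\<close> qis_gid[OF sesD(2)[OF *(1)]] sesD(2)[OF *(1)]] by simp
qed

text \<open>When \<open>C\<close> vanishes, \<open>f\<close> is an isomorphism. Level 0 is treated
  separately because there the terms themselves have to be zero.\<close>

lemma length_le_trivial:
  assumes C: "C \<in> bcpx L" and triv: "\<And>i. carrier (cobj C i) \<subseteq> {\<zero>\<^bsub>cobj C i\<^esub>}"
  shows "length_le C 0"
proof (rule length_leI[OF C])
  fix a A X f p assume S: "ses L A X C f p" and A: "A \<in> level a"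
  have "p i x = \<zero>\<^bsub>cobj C i\<^esub>" if "x \<in> carrier (cobj X i)" for i x
    using chain_mapD(2)[OF sesD(5)[OF S] that] triv by blast
  then have sur: "f i ` carrier (cobj A i) = carrier (cobj X i)" for i
    using S by (auto simp: ses_def)
  have q: "qis L A X f"
    by (rule qis_bij[OF sesD(1,2,4)[OF S] _ sur]) (use S in \<open>auto simp: ses_def\<close>)
  show "X \<in> level (a + 0)"
  proof (cases a)
    case 0
    have "carrier (cobj X i) = {\<zero>\<^bsub>cobj X i\<^esub>}" for i
      using sur[of i] A 0 chain_map_zero[OF sesD(4,1,2)[OF S], of i] by simp
    then show ?thesis using 0 sesD(2)[OF S] by simp
  next
    case (Suc b)
    then show ?thesis using level_qis[of A b X f] A q sesD(2)[OF S] by simp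
  qed
qed

text \<open>Two complexes may agree on carriers and still differ as records. This occurs for
  cocycles: as a subcomplex they keep the differential of \<open>X\<close>, which vanishes on them
  but is not the constant zero function.\<close>

lemma length_le_cong:
  assumes C: "length_le C r" and D: "D \<in> bcpx L" and eq: "\<And>i. cobj D i = cobj C i"
    "\<And>i x. x \<in> carrier (cobj C i) \<Longrightarrow> cdiff D i x = cdiff C i x"
  shows "length_le D r"
proof (rule length_leI[OF D])
  fix a A X f p assume S: "ses L A X D f p" and A: "A \<in> level a"
  have "chain_map L X C p"
    using chain_mapD(1)[OF sesD(5)[OF S]] chain_mapD(2)[OF sesD(5)[OF S]] chain_mapD(3)[OF sesD(5)[OF S]] eq
    by (intro chain_mapI) auto
  then have "ses L A X C f p" using S length_le_bcpx[OF C] by (simp add: ses_def eq)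
  then show "X \<in> level (a + r)" by (rule length_leD[OF C _ A])
qed

text \<open>If \<open>0 \<rightarrow> A \<rightarrow> X \<rightarrow> C \<rightarrow> 0\<close> and \<open>0 \<rightarrow> K \<rightarrow> P \<rightarrow> C \<rightarrow> 0\<close> are exact, the pullback \<open>Y\<close> of \<open>X\<close> and \<open>P\<close>
  over \<open>C\<close> is an extension of \<open>P\<close> by \<open>A\<close>, and \<open>X\<close> is quasi-isomorphic to the cone of \<open>K \<rightarrow> Y\<close>.\<close>

lemma length_le_resolve:
  assumes K: "ses L K P C k s" and P: "length_le P 1" and K1: "length_le (cpx_shift 1 K) r"
  shows "length_le C (Suc r)"
proof (rule length_leI[OF sesD(3)[OF K]])
  fix a A X f p assume S: "ses L A X C f p" and A: "A \<in> level a"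
  note kA = sesD(1)[OF S] and kX = sesD(2)[OF S] and kC = sesD(3)[OF S] and kK = sesD(1)[OF K] and kP = sesD(2)[OF K]
  note f = sesD(4)[OF S] and p = sesD(5)[OF S] and k = sesD(4)[OF K] and s = sesD(5)[OF K]
  have XP: "cpx_sum X P \<in> bcpx L" by (rule cpx_sum_in_bcpx[OF kX kP])
  define U where "U i = {z \<in> carrier (cobj (cpx_sum X P) i). p i (lft z) = s i (rgt z)}" for i
  define Y where "Y = subcpx (cpx_sum X P) U"
  have Uc: "U i \<subseteq> carrier (cobj (cpx_sum X P) i)" for i by (auto simp: U_def)
  have Y: "Y \<in> bcpx L" unfolding Y_def
  proof (rule subcpx_in_bcpx[OF XP])
    show "rsub L (cobj (cpx_sum X P) i) (U i)" for i
    proof -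
      interpret Xi: right_module L "cobj X i" by (rule bcpxD(2)[OF kX])
      interpret Pi: right_module L "cobj P i" by (rule bcpxD(2)[OF kP])
      show ?thesis
        using mod_homD[OF chain_mapD(1)[OF p]] mod_homD[OF chain_mapD(1)[OF s]]
          chain_map_zero[OF p kX kC] chain_map_zero[OF s kP kC]
        by (intro rsubI) (auto simp: U_def Xi.smult_closed Pi.smult_closed)
    qed
    show "cdiff (cpx_sum X P) i z \<in> U (i + 1)" if "z \<in> U i" for i z
      using that bcpxD(5)[OF kX] bcpxD(5)[OF kP] chain_mapD(3)[OF p] chain_mapD(3)[OF s]
      by (auto simp: U_def)
  qed
  have lX: "chain_map L (cpx_sum X P) X (\<lambda>i. lft)" and rP: "chain_map L (cpx_sum X P) P (\<lambda>i. rgt)"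
    by (rule chain_mapI; auto simp del: mod_sum_simps intro: lft_hom rgt_hom)+
  have "ses L A Y P (\<lambda>i x. Join (f i x) \<zero>\<^bsub>cobj P i\<^esub>) (\<lambda>i. rgt)"
  proof (rule sesI[OF kA Y kP])
    show "chain_map L A Y (\<lambda>i x. Join (f i x) \<zero>\<^bsub>cobj P i\<^esub>)" unfolding Y_def
    proof (rule chain_map_into_subcpx)
      show "chain_map L A (cpx_sum X P) (\<lambda>i x. Join (f i x) \<zero>\<^bsub>cobj P i\<^esub>)"
        by (rule chain_mapI)
          (auto simp: bcpxD(7)[OF kP] chain_mapD(3)[OF f] simp del: mod_sum_simps
            intro!: mod_hom_Join chain_mapD(1)[OF f] mod_hom_const_zero bcpxD(1)[OF kP])
      show "Join (f i y) \<zero>\<^bsub>cobj P i\<^esub> \<in> U i" if "y \<in> carrier (cobj A i)" for i y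
        using that chain_mapD(2)[OF f that] sesD(8)[OF S that] chain_map_zero[OF s kP kC]
          bcpx_zero_closed[OF kP] by (auto simp: U_def)
    qed
    show "chain_map L Y P (\<lambda>i. rgt)" unfolding Y_def by (rule chain_map_from_subcpx[OF rP Uc])
    show "inj_on (\<lambda>x. Join (f i x) \<zero>\<^bsub>cobj P i\<^esub>) (carrier (cobj A i))" for i
      using sesD(6)[OF S] by (auto simp: inj_on_def)
    show "rgt ` carrier (cobj Y i) = carrier (cobj P i)" for i
    proof
      show "carrier (cobj P i) \<subseteq> rgt ` carrier (cobj Y i)"
      proof
        fix q assume q: "q \<in> carrier (cobj P i)"
        obtain x where "x \<in> carrier (cobj X i)" "s i q = p i x"
          using sesD(7)[OF S chain_mapD(2)[OF s q]] by blast
        then show "q \<in> rgt ` carrier (cobj Y i)"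
          using q by (intro image_eqI[of _ _ "Join x q"]) (auto simp: Y_def U_def)
      qed
    qed (auto simp: Y_def U_def)
    show "(\<lambda>x. Join (f i x) \<zero>\<^bsub>cobj P i\<^esub>) ` carrier (cobj A i) = {z \<in> carrier (cobj Y i). rgt z = \<zero>\<^bsub>cobj P i\<^esub>}" for i
      using sesD(8,9)[OF S] chain_mapD(2)[OF f] bcpx_zero_closed[OF kP] chain_map_zero[OF s kP kC]
      by (fastforce simp: Y_def U_def)
  qed
  then have Ya: "Y \<in> level (a + 1)" by (rule length_leD[OF P _ A])
  have KY: "ses L K Y X (\<lambda>i x. Join \<zero>\<^bsub>cobj X i\<^esub> (k i x)) (\<lambda>i. lft)"
  proof (rule sesI[OF kK Y kX])
    show "chain_map L K Y (\<lambda>i x. Join \<zero>\<^bsub>cobj X i\<^esub> (k i x))" unfolding Y_def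
    proof (rule chain_map_into_subcpx)
      show "chain_map L K (cpx_sum X P) (\<lambda>i x. Join \<zero>\<^bsub>cobj X i\<^esub> (k i x))"
        by (rule chain_mapI)
          (auto simp: bcpxD(7)[OF kX] chain_mapD(3)[OF k] simp del: mod_sum_simps
            intro!: mod_hom_Join chain_mapD(1)[OF k] mod_hom_const_zero bcpxD(1)[OF kX])
      show "Join \<zero>\<^bsub>cobj X i\<^esub> (k i y) \<in> U i" if "y \<in> carrier (cobj K i)" for i y
        using that chain_mapD(2)[OF k that] sesD(8)[OF K that] chain_map_zero[OF p kX kC]
          bcpx_zero_closed[OF kX] by (auto simp: U_def)
    qed
    show "chain_map L Y X (\<lambda>i. lft)" unfolding Y_def by (rule chain_map_from_subcpx[OF lX Uc])
    show "inj_on (\<lambda>x. Join \<zero>\<^bsub>cobj X i\<^esub> (k i x)) (carrier (cobj K i))" for i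
      using sesD(6)[OF K] by (auto simp: inj_on_def)
    show "lft ` carrier (cobj Y i) = carrier (cobj X i)" for i
    proof
      show "carrier (cobj X i) \<subseteq> lft ` carrier (cobj Y i)"
      proof
        fix x assume x: "x \<in> carrier (cobj X i)"
        obtain q where "q \<in> carrier (cobj P i)" "p i x = s i q"
          using sesD(7)[OF K chain_mapD(2)[OF p x]] by blast
        then show "x \<in> lft ` carrier (cobj Y i)"
          using x by (intro image_eqI[of _ _ "Join x q"]) (auto simp: Y_def U_def)
      qed
    qed (auto simp: Y_def U_def)
    show "(\<lambda>x. Join \<zero>\<^bsub>cobj X i\<^esub> (k i x)) ` carrier (cobj K i) = {z \<in> carrier (cobj Y i). lft z = \<zero>\<^bsub>cobj X i\<^esub>}" for i
    proof
      show "{z \<in> carrier (cobj Y i). lft z = \<zero>\<^bsub>cobj X i\<^esub>} \<subseteq> (\<lambda>x. Join \<zero>\<^bsub>cobj X i\<^esub> (k i x)) ` carrier (cobj K i)"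
      proof
        fix z assume "z \<in> {z \<in> carrier (cobj Y i). lft z = \<zero>\<^bsub>cobj X i\<^esub>}"
        then obtain q where q: "z = Join \<zero>\<^bsub>cobj X i\<^esub> q" "q \<in> carrier (cobj P i)" "s i q = \<zero>\<^bsub>cobj C i\<^esub>"
          using chain_map_zero[OF p kX kC] by (auto simp: Y_def U_def)
        then show "z \<in> (\<lambda>x. Join \<zero>\<^bsub>cobj X i\<^esub> (k i x)) ` carrier (cobj K i)"
          using sesD(9)[OF K q(2,3)] by blast
      qed
    qed (use sesD(8)[OF K] chain_mapD(2)[OF k] bcpx_zero_closed[OF kX] chain_map_zero[OF p kX kC]
        in \<open>auto simp: Y_def U_def\<close>)
  qed
  \<comment> \<open>The cone is an extension of the shift of \<open>K\<close> by \<open>Y\<close>.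
    One step has been spent on \<open>P\<close> to reach \<open>Y\<close>, and \<open>r\<close> more
    are spent on the shifted kernel.\<close>
  have "cone K Y (\<lambda>i x. Join \<zero>\<^bsub>cobj X i\<^esub> (k i x)) \<in> level (a + 1 + r)"
    by (rule length_leD[OF K1 ses_cone[OF kK Y sesD(4)[OF KY]] Ya])
  then have "cone K Y (\<lambda>i x. Join \<zero>\<^bsub>cobj X i\<^esub> (k i x)) \<in> level (Suc (a + r))" by simp
  then have "X \<in> level (Suc (a + r))" by (rule level_qis[OF _ qis_cone_proj[OF KY] kX])
  then show "X \<in> level (a + Suc r)" by simp
qed

text \<open>Composing the projection to \<open>C\<close> with \<open>u\<close> presents
  \<open>X\<close> as an extension of \<open>D\<close> by the kernel \<open>?X\<close> of the
  composite, and \<open>?X\<close> is in turn an extension of the kernel of \<open>u\<close> by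
  \<open>A\<close>. The two bounds are applied one after the other.\<close>

lemma length_le_extension:
  assumes C: "C \<in> bcpx L" and D: "length_le D r'" and u: "chain_map L C D u"
    and sur: "\<And>i. u i ` carrier (cobj C i) = carrier (cobj D i)"
    and ker: "length_le (subcpx C (\<lambda>i. {c \<in> carrier (cobj C i). u i c = \<zero>\<^bsub>cobj D i\<^esub>})) r"
      (is "length_le (subcpx C ?U) r")
  shows "length_le C (r + r')"
proof (rule length_leI[OF C])
  fix a A X f p assume S: "ses L A X C f p" and A: "A \<in> level a"
  note kA = sesD(1)[OF S] and kX = sesD(2)[OF S] and kC = sesD(3)[OF S] and kD = length_le_bcpx[OF D]
  note f = sesD(4)[OF S] and p = sesD(5)[OF S]
  have up: "chain_map L X D (gcomp u p)" by (rule chain_map_gcomp[OF p u])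
  have psur: "p i ` carrier (cobj X i) = carrier (cobj C i)" for i using S by (auto simp: ses_def)
  have upsur: "gcomp u p i ` carrier (cobj X i) = carrier (cobj D i)" for i
    using psur[of i] sur[of i] by (simp add: gcomp_def flip: image_image)
  let ?X = "subcpx X (\<lambda>i. {x \<in> carrier (cobj X i). gcomp u p i x = \<zero>\<^bsub>cobj D i\<^esub>})"
  have S2: "ses L ?X X D gid (gcomp u p)" by (rule ses_ker[OF kX kD up upsur])
  have "ses L A ?X (subcpx C ?U) f p"
  proof (rule sesI[OF kA sesD(1)[OF S2] length_le_bcpx[OF ker]])
    show "chain_map L A ?X f"
      by (rule chain_map_into_subcpx[OF f])
        (use chain_mapD(2)[OF f] sesD(8)[OF S] chain_map_zero[OF u kC kD] in \<open>auto simp: gcomp_def\<close>)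
    show "chain_map L ?X (subcpx C ?U) p"
      by (rule chain_map_into_subcpx[OF chain_map_from_subcpx[OF p]])
        (use chain_mapD(2)[OF p] in \<open>auto simp: gcomp_def\<close>)
    show "inj_on (f i) (carrier (cobj A i))" for i using S by (auto simp: ses_def)
    show "p i ` carrier (cobj ?X i) = carrier (cobj (subcpx C ?U) i)" for i
      using psur[of i] by (auto simp: gcomp_def image_iff)
    show "f i ` carrier (cobj A i) = {x \<in> carrier (cobj ?X i). p i x = \<zero>\<^bsub>cobj (subcpx C ?U) i\<^esub>}" for i
    proof -
      have "f i ` carrier (cobj A i) = {x \<in> carrier (cobj X i). p i x = \<zero>\<^bsub>cobj C i\<^esub>}"
        using S by (auto simp: ses_def)
      then show ?thesis using chain_map_zero[OF u kC kD] by (auto simp: gcomp_def)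
    qed
  qed
  then have "?X \<in> level (a + r)" by (rule length_leD[OF ker _ A])
  then have "X \<in> level (a + r + r')" by (rule length_leD[OF D S2])
  then show "X \<in> level (a + (r + r'))" by (simp add: add.assoc)
qed

text \<open>The universal bound is evaluated at the trivial extension of \<open>X\<close> by the
  zero complex.\<close>

lemma length_le_level:
  assumes "length_le X r"
  shows "X \<in> level r"
proof -
  have X: "X \<in> bcpx L" by (rule length_le_bcpx[OF assms])
  have Z: "cpx_zero L \<in> bcpx L" by (rule cpx_zero_in_bcpx[OF ring_L])
  have "ses L (cpx_zero L) X X (\<lambda>i x. \<zero>\<^bsub>cobj X i\<^esub>) gid"
    by (rule sesI[OF Z X X _ chain_map_gid])
      (auto simp: gid_def bcpxD(7)[OF X] bcpx_zero_closed[OF X]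
        intro!: chain_mapI mod_hom_const_zero bcpxD(1)[OF X])
  then have "X \<in> level (0 + r)" by (rule length_leD[OF assms]) (simp add: Z)
  then show ?thesis by simp
qed

end

section \<open>Retracts\<close>

text \<open>A direct summand given by a split injection, without naming a complement. The complement
  is the kernel of \<open>b\<close> and is constructed only once, for whole complexes.\<close>

definition retract :: "('a, 'q) ring_scheme \<Rightarrow> ('a, 'b) module \<Rightarrow> ('a, 'c) module \<Rightarrow> bool" where
  "retract L W M \<longleftrightarrow> (\<exists>a\<in>mod_hom L W M. \<exists>b\<in>mod_hom L M W. \<forall>x\<in>carrier W. b (a x) = x)"

lemma retractI:
  "a \<in> mod_hom L W M \<Longrightarrow> b \<in> mod_hom L M W \<Longrightarrow> (\<And>x. x \<in> carrier W \<Longrightarrow> b (a x) = x) \<Longrightarrow> retract L W M"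
  by (auto simp: retract_def)

lemma retract_refl: "retract L M M"
  by (rule retractI[OF mod_hom_id mod_hom_id]) (rule refl)

lemma retract_trans:
  assumes "retract L W M" "retract L M N"
  shows "retract L W N"
proof -
  obtain a b where ab: "a \<in> mod_hom L W M" "b \<in> mod_hom L M W" "\<forall>x\<in>carrier W. b (a x) = x"
    using assms(1) unfolding retract_def by blast
  obtain c d where cd: "c \<in> mod_hom L M N" "d \<in> mod_hom L N M" "\<forall>x\<in>carrier M. d (c x) = x"
    using assms(2) unfolding retract_def by blast
  show ?thesis
    by (rule retractI[OF mod_hom_comp[OF cd(1) ab(1)] mod_hom_comp[OF ab(2) cd(2)]])
      (use ab cd mod_homD(1)[OF ab(1)] in auto)
qed

lemma retract_mod_sum:
  assumes "retract L W M" "retract L W' M'"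
  shows "retract L (mod_sum W W') (mod_sum M M')"
proof -
  obtain a b where ab: "a \<in> mod_hom L W M" "b \<in> mod_hom L M W" "\<forall>x\<in>carrier W. b (a x) = x"
    using assms(1) unfolding retract_def by blast
  obtain c d where cd: "c \<in> mod_hom L W' M'" "d \<in> mod_hom L M' W'" "\<forall>x\<in>carrier W'. d (c x) = x"
    using assms(2) unfolding retract_def by blast
  show ?thesis
    by (rule retractI[OF mod_hom_Join[OF mod_hom_comp[OF ab(1) lft_hom] mod_hom_comp[OF cd(1) rgt_hom]]
          mod_hom_Join[OF mod_hom_comp[OF ab(2) lft_hom] mod_hom_comp[OF cd(2) rgt_hom]]])
      (use ab cd in auto)
qed

lemma retract_mod_sum_left: "N \<in> mod_cat L \<Longrightarrow> retract L M (mod_sum M N)"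
  by (rule retractI[OF mod_hom_Join[OF mod_hom_id mod_hom_const_zero] lft_hom]) auto

lemma retract_mod_sum_right: "M \<in> mod_cat L \<Longrightarrow> retract L N (mod_sum M N)"
  by (rule retractI[OF mod_hom_Join[OF mod_hom_const_zero mod_hom_id] rgt_hom]) auto

text \<open>Sums are nested pairs and associative only up to isomorphism; a retraction is enough for
  concatenating powers.\<close>

lemma retract_mod_sum_assoc: "retract L (mod_sum (mod_sum A B) C) (mod_sum A (mod_sum B C))"
  by (rule retractI[OF
        mod_hom_Join[OF mod_hom_lft[OF lft_hom] mod_hom_Join[OF mod_hom_rgt[OF lft_hom] rgt_hom]]
        mod_hom_Join[OF mod_hom_Join[OF lft_hom mod_hom_lft[OF rgt_hom]] mod_hom_rgt[OF rgt_hom]]]) auto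

lemma retract_trivial:
  assumes "W \<in> mod_cat L" "M \<in> mod_cat L" "carrier W \<subseteq> {\<zero>\<^bsub>W\<^esub>}"
  shows "retract L W M"
  by (rule retractI[OF mod_hom_const_zero[OF assms(2)] mod_hom_const_zero[OF assms(1)]]) (use assms(3) in auto)

lemma mod_power_in_mod_cat: "ring L \<Longrightarrow> M \<in> mod_cat L \<Longrightarrow> mod_power L M k \<in> mod_cat L"
  by (induction k) (auto intro: zero_mod_in_mod_cat mod_sum_in_mod_cat)

lemma retract_mod_power:
  assumes "retract L M M'"
  shows "retract L (mod_power L M k) (mod_power L M' k)"
  by (induction k) (auto intro: retract_refl retract_mod_sum assms)

lemma retract_mod_power_add:
  assumes "ring L" "M \<in> mod_cat L"
  shows "retract L (mod_sum (mod_power L M k) (mod_power L M l)) (mod_power L M (k + l))"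
proof (induction k)
  case 0
  have "retract L (mod_sum (zero_mod L) (mod_power L M l)) (mod_power L M l)"
    by (rule retractI[OF rgt_hom mod_hom_Join[OF mod_hom_const_zero[OF zero_mod_in_mod_cat[OF assms(1)]] mod_hom_id]]) auto
  then show ?case by simp
next
  case (Suc k)
  show ?case
    using retract_trans[OF retract_mod_sum_assoc retract_mod_sum[OF retract_refl Suc]] by simp
qed

text \<open>Membership in \<open>add M\<close>, in the form in which sums and enlargement of
  \<open>M\<close> are immediate.\<close>

definition add_retract :: "('a, 'q) ring_scheme \<Rightarrow> ('a, 'a melt) module \<Rightarrow> ('a, 'a melt) module \<Rightarrow> bool" where
  "add_retract L M W \<longleftrightarrow> W \<in> mod_cat L \<and> (\<exists>k. retract L W (mod_power L M k))"

lemma add_retract_mono: "add_retract L M W \<Longrightarrow> retract L M M' \<Longrightarrow> add_retract L M' W"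
  unfolding add_retract_def using retract_trans retract_mod_power by blast

lemma add_retract_mod_sum:
  assumes "ring L" "M \<in> mod_cat L" "add_retract L M W" "add_retract L M W'"
  shows "add_retract L M (mod_sum W W')"
proof -
  obtain k l where "retract L W (mod_power L M k)" "retract L W' (mod_power L M l)"
    using assms(3,4) by (auto simp: add_retract_def)
  from retract_trans[OF retract_mod_sum[OF this] retract_mod_power_add[OF assms(1,2)]]
  show ?thesis using assms(3,4) mod_sum_in_mod_cat unfolding add_retract_def by blast
qed

lemma add_retract_trivial:
  assumes "ring L" "W \<in> mod_cat L" "carrier W \<subseteq> {\<zero>\<^bsub>W\<^esub>}"
  shows "add_retract L M W"
  using retract_trivial[OF assms(2) zero_mod_in_mod_cat[OF assms(1)] assms(3)] assms(2)
  unfolding add_retract_def by (metis mod_power.simps(1))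

lemma add_closure_add_retract:
  assumes W: "W \<in> add_closure L V"
  shows "add_retract L V W"
proof -
  obtain W' k f where *: "W \<in> mod_cat L" "W' \<in> mod_cat L" "f \<in> mod_hom L (mod_sum W W') (mod_power L V k)"
    "bij_betw f (carrier (mod_sum W W')) (carrier (mod_power L V k))"
    using W unfolding add_closure_def mod_iso_def by blast
  note g = mod_hom_inv_into[OF mod_catD[OF mod_sum_in_mod_cat[OF *(1,2)]] *(3,4)]
  interpret W': right_module L W' by (rule mod_catD[OF *(2)])
  have "retract L W (mod_power L V k)"
    by (rule retractI[OF mod_hom_comp[OF *(3) mod_hom_Join[OF mod_hom_id mod_hom_const_zero[OF *(2)]]]
          mod_hom_lft[OF g(1)]]) (use g(2) in auto)
  then show ?thesis using *(1) by (auto simp: add_retract_def)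
qed

text \<open>The regular module, transported into the element type of \<open>mod_cat\<close> by
  \<open>fin_gen_module_representable\<close>. Only the freeness of its generator \<open>u\<close>
  is exported, so the transport stays hidden.\<close>

lemma free_cyclic_module:
  assumes "ring L"
  obtains F u where "F \<in> mod_cat L" "u \<in> carrier F"
    "\<And>P x. P \<in> mod_cat L \<Longrightarrow> x \<in> carrier P \<Longrightarrow> \<exists>h\<in>mod_hom L F P. h u = x"
proof -
  interpret L: ring L by fact
  have rm: "right_module L (rmod L)" by (rule right_module_rmod[OF assms])
  have "fg_sub L (rmod L) (carrier (rmod L))"
  proof (rule fg_subI[of "{\<one>\<^bsub>L\<^esub>}"])
    fix T assume T: "rsub L (rmod L) T" "{\<one>\<^bsub>L\<^esub>} \<subseteq> T"
    show "carrier (rmod L) \<subseteq> T" using rsubD(5)[OF T(1), of _ "\<one>\<^bsub>L\<^esub>"] T(2) by auto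
  qed auto
  then have "fin_gen L (rmod L)" by (simp add: fin_gen_iff[OF rm])
  then obtain F e where F: "F \<in> mod_cat L" "e \<in> mod_hom L (rmod L) F"
    "bij_betw e (carrier (rmod L)) (carrier F)"
    using fin_gen_module_representable[OF rm] unfolding mod_iso_def by blast
  note g = mod_hom_inv_into[OF rm F(2,3)]
  have "\<exists>h\<in>mod_hom L F P. h (e \<one>\<^bsub>L\<^esub>) = x" if P: "P \<in> mod_cat L" "x \<in> carrier P" for P x
  proof -
    interpret P: right_module L P by (rule mod_catD[OF P(1)])
    have "(\<lambda>c. c \<odot>\<^bsub>P\<^esub> x) \<in> mod_hom L (rmod L) P"
      by (rule mod_homI) (use P(2) in \<open>auto simp: P.smult_closed P.smult_l_distr P.smult_assoc\<close>)
    from mod_hom_comp[OF this g(1)] show ?thesis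
      using g(2)[of "\<one>\<^bsub>L\<^esub>"] P(2) by (intro bexI) (auto simp: P.smult_one)
  qed
  moreover have "e \<one>\<^bsub>L\<^esub> \<in> carrier F" using mod_homD(1)[OF F(2), of "\<one>\<^bsub>L\<^esub>"] by simp
  ultimately show ?thesis using that[OF F(1)] by blast
qed

lemma projective_modD:
  assumes "projective_mod L P"
  shows "P \<in> mod_cat L"
    "\<And>M N g f. M \<in> mod_cat L \<Longrightarrow> N \<in> mod_cat L \<Longrightarrow> g \<in> mod_hom L M N \<Longrightarrow> f \<in> mod_hom L P N \<Longrightarrow>
      g ` carrier M = carrier N \<Longrightarrow> \<exists>h\<in>mod_hom L P M. \<forall>x\<in>carrier P. g (h x) = f x"
proof -
  show "P \<in> mod_cat L" using assms by (simp add: projective_mod_def)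
  fix M N g f assume "M \<in> mod_cat L" "N \<in> mod_cat L" "g \<in> mod_hom L M N" "f \<in> mod_hom L P N"
    "g ` carrier M = carrier N"
  then show "\<exists>h\<in>mod_hom L P M. \<forall>x\<in>carrier P. g (h x) = f x"
    using assms unfolding projective_mod_def by blast
qed

text \<open>Finitely many generators of \<open>P\<close> give a surjection from a power of
  \<open>F\<close>, built one generator at a time, and projectivity splits it.\<close>

lemma projective_add_retract:
  assumes L: "ring L" and F: "F \<in> mod_cat L" "u \<in> carrier F"
    "\<And>P x. P \<in> mod_cat L \<Longrightarrow> x \<in> carrier P \<Longrightarrow> \<exists>h\<in>mod_hom L F P. h u = x"
    and P: "projective_mod L P"
  shows "add_retract L F P"
proof -
  have PM: "P \<in> mod_cat L" using P by (simp add: projective_mod_def)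
  interpret P: right_module L P by (rule mod_catD[OF PM])
  interpret F: right_module L F by (rule mod_catD[OF F(1)])
  have Fk: "mod_power L F k \<in> mod_cat L" for k by (rule mod_power_in_mod_cat[OF L F(1)])
  have "fg_sub L P (carrier P)" using PM fin_gen_iff[OF mod_catD[OF PM]] by (simp add: mod_cat_def)
  then obtain S where S: "finite S" "S \<subseteq> carrier P" "\<And>T. rsub L P T \<Longrightarrow> S \<subseteq> T \<Longrightarrow> carrier P \<subseteq> T"
    by (rule fg_subE) blast
  have "\<exists>k. \<exists>h\<in>mod_hom L (mod_power L F k) P. S \<subseteq> h ` carrier (mod_power L F k)"
    using S(1,2)
  proof (induction S rule: finite_induct)
    case empty
    show ?case using mod_hom_const_zero[OF PM] by blast
  next
    case (insert x S)
    then obtain k h where h: "h \<in> mod_hom L (mod_power L F k) P" "S \<subseteq> h ` carrier (mod_power L F k)" by auto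
    obtain g where g: "g \<in> mod_hom L F P" "g u = x" using F(3)[OF PM] insert.prems by blast
    interpret Fk: right_module L "mod_power L F k" by (rule mod_catD[OF Fk])
    have g0: "g \<zero>\<^bsub>F\<^esub> = \<zero>\<^bsub>P\<^esub>" by (rule mod_hom_zero[OF g(1)]) unfold_locales
    have h0: "h \<zero>\<^bsub>mod_power L F k\<^esub> = \<zero>\<^bsub>P\<^esub>" by (rule mod_hom_zero[OF h(1)]) unfold_locales
    let ?h = "\<lambda>z. g (lft z) \<oplus>\<^bsub>P\<^esub> h (rgt z)"
    have "?h \<in> mod_hom L (mod_power L F (Suc k)) P"
      unfolding mod_power.simps
      by (rule mod_hom_add[OF PM mod_hom_comp[OF g(1) lft_hom] mod_hom_comp[OF h(1) rgt_hom]])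
    moreover have "insert x S \<subseteq> ?h ` carrier (mod_power L F (Suc k))"
    proof
      fix y assume "y \<in> insert x S"
      then consider "y = x" | z where "z \<in> carrier (mod_power L F k)" "y = h z" using h(2) by blast
      then show "y \<in> ?h ` carrier (mod_power L F (Suc k))"
      proof cases
        case 1
        then show ?thesis using g(2) h0 F(2) insert.prems
          by (intro image_eqI[of _ _ "Join u \<zero>\<^bsub>mod_power L F k\<^esub>"]) auto
      next
        case 2
        then show ?thesis using g0 mod_homD(1)[OF h(1)]
          by (intro image_eqI[of _ _ "Join \<zero>\<^bsub>F\<^esub> z"]) auto
      qed
    qed
    ultimately show ?case by blast
  qed
  then obtain k h where h: "h \<in> mod_hom L (mod_power L F k) P" "S \<subseteq> h ` carrier (mod_power L F k)" by blast
  have "rsub L P (h ` carrier (mod_power L F k))"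
    by (rule rsub_image[OF mod_catD[OF Fk] mod_catD[OF PM] h(1) rsub_carrier[OF mod_catD[OF Fk]]])
  then have "h ` carrier (mod_power L F k) = carrier P" using S(3) h mod_homD(1)[OF h(1)] by blast
  then have "\<exists>j\<in>mod_hom L P (mod_power L F k). \<forall>x\<in>carrier P. h (j x) = x"
    by (rule projective_modD(2)[OF P Fk PM h(1) mod_hom_id])
  then have "retract L P (mod_power L F k)" using h(1) by (auto simp: retract_def)
  then show ?thesis using PM by (auto simp: add_retract_def)
qed

lemma projective_mod_sum:
  assumes P: "projective_mod L P" and Q: "projective_mod L Q"
  shows "projective_mod L (mod_sum P Q)"
  unfolding projective_mod_def
proof (intro conjI ballI impI)
  note PM = projective_modD(1)[OF P] and QM = projective_modD(1)[OF Q]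
  show "mod_sum P Q \<in> mod_cat L" by (rule mod_sum_in_mod_cat[OF PM QM])
  fix M N g f assume M: "M \<in> mod_cat L" and N: "N \<in> mod_cat L" and g: "g \<in> mod_hom L M N"
    and f: "f \<in> mod_hom L (mod_sum P Q) N" and sur: "g ` carrier M = carrier N"
  interpret P: right_module L P by (rule mod_catD[OF PM])
  interpret Q: right_module L Q by (rule mod_catD[OF QM])
  obtain h where h: "h \<in> mod_hom L P M" "\<forall>x\<in>carrier P. g (h x) = f (Join x \<zero>\<^bsub>Q\<^esub>)"
    using projective_modD(2)[OF P M N g mod_hom_comp[OF f mod_hom_Join[OF mod_hom_id mod_hom_const_zero[OF QM]]] sur] by blast
  obtain k where k: "k \<in> mod_hom L Q M" "\<forall>x\<in>carrier Q. g (k x) = f (Join \<zero>\<^bsub>P\<^esub> x)"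
    using projective_modD(2)[OF Q M N g mod_hom_comp[OF f mod_hom_Join[OF mod_hom_const_zero[OF PM] mod_hom_id]] sur] by blast
  show "\<exists>h\<in>mod_hom L (mod_sum P Q) M. \<forall>x\<in>carrier (mod_sum P Q). g (h x) = f x"
  proof (intro bexI ballI)
    show "(\<lambda>z. h (lft z) \<oplus>\<^bsub>M\<^esub> k (rgt z)) \<in> mod_hom L (mod_sum P Q) M"
      by (rule mod_hom_add[OF M mod_hom_comp[OF h(1) lft_hom] mod_hom_comp[OF k(1) rgt_hom]])
    fix z assume "z \<in> carrier (mod_sum P Q)"
    then obtain x y where z: "z = Join x y" "x \<in> carrier P" "y \<in> carrier Q" by auto
    have "g (h x \<oplus>\<^bsub>M\<^esub> k y) = f (Join x \<zero>\<^bsub>Q\<^esub>) \<oplus>\<^bsub>N\<^esub> f (Join \<zero>\<^bsub>P\<^esub> y)"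
      using mod_homD(2)[OF g mod_homD(1)[OF h(1) z(2)] mod_homD(1)[OF k(1) z(3)]] h(2) k(2) z by simp
    also have "\<dots> = f z"
      using mod_homD(2)[OF f, of "Join x \<zero>\<^bsub>Q\<^esub>" "Join \<zero>\<^bsub>P\<^esub> y"] z by simp
    finally show "g (h (lft z) \<oplus>\<^bsub>M\<^esub> k (rgt z)) = f z" using z(1) by simp
  qed
qed

lemma projective_trivial:
  assumes P: "P \<in> mod_cat L" "carrier P \<subseteq> {\<zero>\<^bsub>P\<^esub>}"
  shows "projective_mod L P"
  unfolding projective_mod_def
proof (intro conjI ballI impI P(1))
  fix M N g f assume M: "M \<in> mod_cat L" and N: "N \<in> mod_cat L" and g: "g \<in> mod_hom L M N"
    and f: "f \<in> mod_hom L P N"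
  have "g \<zero>\<^bsub>M\<^esub> = f x" if "x \<in> carrier P" for x
    using that P(2) mod_hom_zero[OF g mod_cat_abelian[OF M] mod_cat_abelian[OF N]]
      mod_hom_zero[OF f mod_cat_abelian[OF P(1)] mod_cat_abelian[OF N]] by auto
  then show "\<exists>h\<in>mod_hom L P M. \<forall>x\<in>carrier P. g (h x) = f x"
    by (intro bexI[OF _ mod_hom_const_zero[OF M]] ballI) simp
qed

section \<open>Resolutions of modules\<close>

definition mod_ses ::
  "('a, 'q) ring_scheme \<Rightarrow> ('a, 'a melt) module \<Rightarrow> ('a, 'a melt) module \<Rightarrow> ('a, 'a melt) module \<Rightarrow>
   ('a melt \<Rightarrow> 'a melt) \<Rightarrow> ('a melt \<Rightarrow> 'a melt) \<Rightarrow> bool" where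
  "mod_ses L K P M i p \<longleftrightarrow> K \<in> mod_cat L \<and> P \<in> mod_cat L \<and> M \<in> mod_cat L \<and> i \<in> mod_hom L K P \<and>
     p \<in> mod_hom L P M \<and> inj_on i (carrier K) \<and> p ` carrier P = carrier M \<and>
     i ` carrier K = {x \<in> carrier P. p x = \<zero>\<^bsub>M\<^esub>}"

lemma mod_sesI:
  assumes "K \<in> mod_cat L" "P \<in> mod_cat L" "M \<in> mod_cat L" "i \<in> mod_hom L K P" "p \<in> mod_hom L P M"
    "inj_on i (carrier K)" "p ` carrier P = carrier M" "i ` carrier K = {x \<in> carrier P. p x = \<zero>\<^bsub>M\<^esub>}"
  shows "mod_ses L K P M i p"
  using assms by (simp add: mod_ses_def)

lemma mod_sesD:
  assumes "mod_ses L K P M i p"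
  shows "K \<in> mod_cat L" "P \<in> mod_cat L" "M \<in> mod_cat L" "i \<in> mod_hom L K P" "p \<in> mod_hom L P M"
    "inj_on i (carrier K)" "p ` carrier P = carrier M" "i ` carrier K = {x \<in> carrier P. p x = \<zero>\<^bsub>M\<^esub>}"
  using assms by (simp_all add: mod_ses_def)

lemma mod_ses_trivial:
  assumes M: "M \<in> mod_cat L" "carrier M \<subseteq> {\<zero>\<^bsub>M\<^esub>}"
  shows "mod_ses L M M M (\<lambda>x. x) (\<lambda>x. x)"
  using assms by (auto intro!: mod_sesI mod_hom_id)

lemma mod_ses_iso:
  assumes S: "mod_ses L K P M i p" and N: "N \<in> mod_cat L" and f: "f \<in> mod_hom L M N"
    and bij: "bij_betw f (carrier M) (carrier N)"
  shows "mod_ses L K P N i (\<lambda>x. f (p x))"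
proof (rule mod_sesI[OF mod_sesD(1,2)[OF S] N mod_sesD(4)[OF S] mod_hom_comp[OF f mod_sesD(5)[OF S]] mod_sesD(6)[OF S]])
  show "(\<lambda>x. f (p x)) ` carrier P = carrier N"
    using bij mod_sesD(7)[OF S] by (metis bij_betw_def image_image)
  have "f y = \<zero>\<^bsub>N\<^esub> \<longleftrightarrow> y = \<zero>\<^bsub>M\<^esub>" if "y \<in> carrier M" for y
  proof -
    interpret M: abelian_group M by (rule mod_cat_abelian[OF mod_sesD(3)[OF S]])
    have "f \<zero>\<^bsub>M\<^esub> = \<zero>\<^bsub>N\<^esub>"
      by (rule mod_hom_zero[OF f mod_cat_abelian[OF mod_sesD(3)[OF S]] mod_cat_abelian[OF N]])
    then show ?thesis using bij that M.zero_closed by (metis bij_betw_def inj_onD)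
  qed
  then show "i ` carrier K = {x \<in> carrier P. f (p x) = \<zero>\<^bsub>N\<^esub>}"
    using mod_sesD(8)[OF S] mod_homD(1)[OF mod_sesD(5)[OF S]] by auto
qed

text \<open>Adding the identity of \<open>Q\<close> leaves the kernel unchanged. Hence a projective
  summand of a module is absorbed by the first term of its resolution.\<close>

lemma mod_ses_add:
  assumes S: "mod_ses L K P M i p" and Q: "Q \<in> mod_cat L"
  shows "mod_ses L K (mod_sum P Q) (mod_sum M Q) (\<lambda>x. Join (i x) \<zero>\<^bsub>Q\<^esub>) (\<lambda>z. Join (p (lft z)) (rgt z))"
proof (rule mod_sesI)
  note D = mod_sesD[OF S]
  interpret Q: right_module L Q by (rule mod_catD[OF Q])
  show "K \<in> mod_cat L" "mod_sum P Q \<in> mod_cat L" "mod_sum M Q \<in> mod_cat L"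
    using D Q mod_sum_in_mod_cat by auto
  show "(\<lambda>x. Join (i x) \<zero>\<^bsub>Q\<^esub>) \<in> mod_hom L K (mod_sum P Q)"
    by (rule mod_hom_Join[OF D(4) mod_hom_const_zero[OF Q]])
  show "(\<lambda>z. Join (p (lft z)) (rgt z)) \<in> mod_hom L (mod_sum P Q) (mod_sum M Q)"
    by (rule mod_hom_Join[OF mod_hom_comp[OF D(5) lft_hom] rgt_hom])
  show "inj_on (\<lambda>x. Join (i x) \<zero>\<^bsub>Q\<^esub>) (carrier K)" using D(6) by (auto simp: inj_on_def)
  show "(\<lambda>z. Join (p (lft z)) (rgt z)) ` carrier (mod_sum P Q) = carrier (mod_sum M Q)"
  proof
    show "(\<lambda>z. Join (p (lft z)) (rgt z)) ` carrier (mod_sum P Q) \<subseteq> carrier (mod_sum M Q)"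
      using mod_homD(1)[OF D(5)] by auto
    show "carrier (mod_sum M Q) \<subseteq> (\<lambda>z. Join (p (lft z)) (rgt z)) ` carrier (mod_sum P Q)"
    proof
      fix z assume "z \<in> carrier (mod_sum M Q)"
      then obtain m y where "m \<in> carrier M" "y \<in> carrier Q" "z = Join m y" by auto
      moreover from this obtain x where "x \<in> carrier P" "m = p x" using D(7) by blast
      ultimately show "z \<in> (\<lambda>z. Join (p (lft z)) (rgt z)) ` carrier (mod_sum P Q)"
        by (intro image_eqI[of _ _ "Join x y"]) auto
    qed
  qed
  show "(\<lambda>x. Join (i x) \<zero>\<^bsub>Q\<^esub>) ` carrier K =
      {z \<in> carrier (mod_sum P Q). Join (p (lft z)) (rgt z) = \<zero>\<^bsub>mod_sum M Q\<^esub>}" (is "?l = ?r")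
  proof -
    have "?l = (\<lambda>y. Join y \<zero>\<^bsub>Q\<^esub>) ` (i ` carrier K)" by (simp add: image_image)
    also have "\<dots> = ?r" unfolding D(8) by auto
    finally show ?thesis .
  qed
qed

section \<open>Resolutions by \<open>add M0\<close> and their behaviour under syzygies\<close>

context
  fixes L :: "('a, 'q) ring_scheme" and M0 :: "('a, 'a melt) module"
begin

text \<open>The index counts terms, not length: a resolution with terms \<open>W 0\<close> to
  \<open>W m\<close> gives the index \<open>m + 1\<close>, and index 0 is left to the zero module.
  The index is thus also the number of generation steps.\<close>

fun resdim_less :: "nat \<Rightarrow> ('a, 'a melt) module \<Rightarrow> bool" where
  "resdim_less 0 N \<longleftrightarrow> N \<in> mod_cat L \<and> carrier N \<subseteq> {\<zero>\<^bsub>N\<^esub>}"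
| "resdim_less (Suc r) N \<longleftrightarrow> (\<exists>K W i p. add_retract L M0 W \<and> resdim_less r K \<and> mod_ses L K W N i p)"

text \<open>The \<open>k\<close>-th syzygy is taken along any projective resolution, not only the minimal one.\<close>

fun syz_resdim_less :: "nat \<Rightarrow> nat \<Rightarrow> ('a, 'a melt) module \<Rightarrow> bool" where
  "syz_resdim_less r 0 N \<longleftrightarrow> resdim_less r N"
| "syz_resdim_less r (Suc k) N \<longleftrightarrow> (\<exists>K P i p. projective_mod L P \<and> syz_resdim_less r k K \<and> mod_ses L K P N i p)"

end

lemma resdim_less_mod_cat: "resdim_less L M0 r N \<Longrightarrow> N \<in> mod_cat L"
  by (cases r) (auto dest: mod_sesD(3))

lemma syz_mod_cat: "syz_resdim_less L M0 r k N \<Longrightarrow> N \<in> mod_cat L"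
  by (cases k) (auto dest: mod_sesD(3) resdim_less_mod_cat)

lemma resdim_less_trivial:
  assumes "ring L" "N \<in> mod_cat L" "carrier N \<subseteq> {\<zero>\<^bsub>N\<^esub>}"
  shows "resdim_less L M0 r N"
proof (induction r)
  case (Suc r)
  then show ?case using add_retract_trivial[OF assms] mod_ses_trivial[OF assms(2,3)] by auto
qed (use assms in simp)

lemma syz_trivial:
  assumes "ring L" "N \<in> mod_cat L" "carrier N \<subseteq> {\<zero>\<^bsub>N\<^esub>}"
  shows "syz_resdim_less L M0 r k N"
proof (induction k)
  case (Suc k)
  then show ?case using projective_trivial[OF assms(2,3)] mod_ses_trivial[OF assms(2,3)] by auto
qed (use resdim_less_trivial[OF assms] in simp)

text \<open>Resolving trivial modules by trivial ones keeps families over all degrees bounded.\<close>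

lemma resdim_less_step:
  assumes "ring L" "resdim_less L M0 (Suc r) N"
  shows "\<exists>K W i p. add_retract L M0 W \<and> resdim_less L M0 r K \<and> mod_ses L K W N i p \<and>
    (carrier N \<subseteq> {\<zero>\<^bsub>N\<^esub>} \<longrightarrow> carrier K \<subseteq> {\<zero>\<^bsub>K\<^esub>} \<and> carrier W \<subseteq> {\<zero>\<^bsub>W\<^esub>})"
proof (cases "carrier N \<subseteq> {\<zero>\<^bsub>N\<^esub>}")
  case True
  note N = resdim_less_mod_cat[OF assms(2)]
  show ?thesis
    using add_retract_trivial[OF assms(1) N True] resdim_less_trivial[OF assms(1) N True]
      mod_ses_trivial[OF N True] True by blast
next
  case False
  then show ?thesis using assms(2) by (simp only: resdim_less.simps) blast
qed

lemma syz_step: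
  assumes "ring L" "syz_resdim_less L M0 r (Suc k) N"
  shows "\<exists>K P i p. projective_mod L P \<and> syz_resdim_less L M0 r k K \<and> mod_ses L K P N i p \<and>
    (carrier N \<subseteq> {\<zero>\<^bsub>N\<^esub>} \<longrightarrow> carrier K \<subseteq> {\<zero>\<^bsub>K\<^esub>} \<and> carrier P \<subseteq> {\<zero>\<^bsub>P\<^esub>})"
proof (cases "carrier N \<subseteq> {\<zero>\<^bsub>N\<^esub>}")
  case True
  note N = syz_mod_cat[OF assms(2)]
  show ?thesis
    using projective_trivial[OF N True] syz_trivial[OF assms(1) N True]
      mod_ses_trivial[OF N True] True by blast
next
  case False
  then show ?thesis using assms(2) by (simp only: syz_resdim_less.simps) blast
qed

lemma resdim_less_iso:
  assumes "resdim_less L M0 r M" "N \<in> mod_cat L" "f \<in> mod_hom L M N" "bij_betw f (carrier M) (carrier N)"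
  shows "resdim_less L M0 r N"
proof (cases r)
  case 0
  have "f \<zero>\<^bsub>M\<^esub> = \<zero>\<^bsub>N\<^esub>"
    using mod_hom_zero[OF assms(3) mod_cat_abelian mod_cat_abelian] assms(1,2) resdim_less_mod_cat by blast
  then have "carrier N \<subseteq> {\<zero>\<^bsub>N\<^esub>}" using assms(1,4) 0 by (force simp: bij_betw_def)
  then show ?thesis using assms(2) 0 by simp
next
  case (Suc s)
  then show ?thesis using assms(1) mod_ses_iso[OF _ assms(2-4)] by (simp only: resdim_less.simps) blast
qed

lemma syz_iso:
  assumes "syz_resdim_less L M0 r k M" "N \<in> mod_cat L" "f \<in> mod_hom L M N" "bij_betw f (carrier M) (carrier N)"
  shows "syz_resdim_less L M0 r k N"
proof (cases k)
  case 0
  then show ?thesis using assms resdim_less_iso by simp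
next
  case (Suc s)
  then show ?thesis using assms(1) mod_ses_iso[OF _ assms(2-4)] by (simp only: syz_resdim_less.simps) blast
qed

text \<open>\<open>Q\<close> joins the first term of the resolution, which is projective if
  \<open>k\<close> is positive and lies in \<open>add M0\<close> otherwise. The index
  \<open>Suc r\<close> guarantees that such a term exists when \<open>k = 0\<close>.\<close>

lemma syz_add_projective:
  assumes L: "ring L" and M0: "M0 \<in> mod_cat L" and Q: "projective_mod L Q" "add_retract L M0 Q"
    and M: "syz_resdim_less L M0 (Suc r) k M"
  shows "syz_resdim_less L M0 (Suc r) k (mod_sum M Q)"
proof (cases k)
  case 0
  then obtain K W i p where "add_retract L M0 W" "resdim_less L M0 r K" "mod_ses L K W M i p"
    using M by auto
  then show ?thesis
    using 0 add_retract_mod_sum[OF L M0 _ Q(2)] mod_ses_add[OF _ projective_modD(1)[OF Q(1)]] by auto blast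
next
  case (Suc l)
  then obtain K P i p where "projective_mod L P" "syz_resdim_less L M0 (Suc r) l K" "mod_ses L K P M i p"
    using M by auto
  then show ?thesis
    using Suc projective_mod_sum[OF _ Q(1)] mod_ses_add[OF _ projective_modD(1)[OF Q(1)]]
    by (simp only: syz_resdim_less.simps) blast
qed

text \<open>\<open>is_syzygy\<close> grows at the far end of the resolution and
  \<open>syz_resdim_less\<close> at the end of \<open>M\<close>. Letting \<open>k\<close> vary moves
  one projective step across at each stage of the induction.\<close>

lemma syz_of_is_syzygy:
  assumes "is_syzygy L n M N" "syz_resdim_less L M0 r k N"
  shows "syz_resdim_less L M0 r (n + k) M"
  using assms
proof (induction arbitrary: k rule: is_syzygy.induct)
  case (zeroth M)
  then show ?case by simp
next
  case (step n M N P p K j)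
  have "projective_mod L P" "N \<in> mod_cat L" "p \<in> mod_hom L P N" "p ` carrier P = carrier N"
    using step.hyps(2) by (auto simp: projective_cover_def)
  then have "mod_ses L K P N j p"
    using step.hyps projective_modD(1)[of L P] by (intro mod_sesI) (auto simp: mod_ker_def)
  then have "syz_resdim_less L M0 r (Suc k) N"
    using \<open>projective_mod L P\<close> step.prems by auto
  from step.IH[OF this] show ?case by simp
qed

context fg_noetherian
begin

text \<open>The kernel of the augmentation is resolved by the sequence with \<open>W 0\<close>
  removed; it is finitely generated by the noetherian property. For \<open>m = 0\<close> the
  augmentation is bijective and the kernel is the zero module.\<close>

lemma resdim_less_of_exact_resolution:
  assumes "exact_resolution L m W \<delta> N" "\<And>i. i \<le> m \<Longrightarrow> add_retract L M0 (W i)" "N \<in> mod_cat L"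
  shows "resdim_less L M0 (Suc m) N"
  using assms
proof (induction m arbitrary: W \<delta> N)
  case 0
  have W: "W 0 \<in> mod_cat L" using 0(2)[of 0] by (simp add: add_retract_def)
  have \<delta>: "\<delta> 0 \<in> mod_hom L (W 0) N" "\<delta> 0 ` carrier (W 0) = carrier N" "inj_on (\<delta> 0) (carrier (W 0))"
    using 0(1) by (auto simp: exact_resolution_def)
  interpret W: abelian_group "W 0" by (rule mod_cat_abelian[OF W])
  have z: "\<delta> 0 \<zero>\<^bsub>W 0\<^esub> = \<zero>\<^bsub>N\<^esub>" by (rule mod_hom_zero[OF \<delta>(1) mod_cat_abelian[OF W] mod_cat_abelian[OF 0(3)]])
  have "mod_ses L (zero_mod L) (W 0) N (\<lambda>x. \<zero>\<^bsub>W 0\<^esub>) (\<delta> 0)"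
  proof (rule mod_sesI[OF zero_mod_in_mod_cat[OF ring_L] W 0(3) mod_hom_const_zero[OF W] \<delta>(1) _ \<delta>(2)])
    show "(\<lambda>x. \<zero>\<^bsub>W 0\<^esub>) ` carrier (zero_mod L) = {x \<in> carrier (W 0). \<delta> 0 x = \<zero>\<^bsub>N\<^esub>}"
      using \<delta>(3) z by (auto dest: inj_onD[OF _ _ _ W.zero_closed])
  qed simp
  moreover have "resdim_less L M0 0 (zero_mod L)" using zero_mod_in_mod_cat[OF ring_L] by simp
  ultimately show ?case using 0(2)[of 0] by (simp only: resdim_less.simps) blast
next
  case (Suc m)
  have W: "W 0 \<in> mod_cat L" using Suc.prems(2)[of 0] by (simp add: add_retract_def)
  have \<delta>: "\<delta> 0 \<in> mod_hom L (W 0) N" "\<delta> 0 ` carrier (W 0) = carrier N"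
    "\<And>i. i < Suc m \<Longrightarrow> \<delta> (Suc i) \<in> mod_hom L (W (Suc i)) (W i)"
    "\<And>i. i < Suc m \<Longrightarrow> \<delta> (Suc i) ` carrier (W (Suc i)) = mod_ker (W i) (if i = 0 then N else W (i - 1)) (\<delta> i)"
    "inj_on (\<delta> (Suc m)) (carrier (W (Suc m)))"
    using Suc.prems(1) by (auto simp: exact_resolution_def)
  define U where "U = mod_ker (W 0) N (\<delta> 0)"
  have U: "rsub L (W 0) U" unfolding U_def mod_ker_def by (rule rsub_ker[OF mod_catD[OF W] mod_catD[OF Suc.prems(3)] \<delta>(1)])
  have K: "submod (W 0) U \<in> mod_cat L" by (rule noetherian[OF W U])
  have "resdim_less L M0 (Suc m) (submod (W 0) U)"
  proof (rule Suc.IH[OF _ _ K])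
    show "add_retract L M0 (W (Suc i))" if "i \<le> m" for i using Suc.prems(2) that by simp
    show "exact_resolution L m (\<lambda>i. W (Suc i)) (\<lambda>i. \<delta> (Suc i)) (submod (W 0) U)"
      unfolding exact_resolution_def
    proof (intro conjI allI impI)
      have im: "\<delta> (Suc 0) ` carrier (W (Suc 0)) = U" using \<delta>(4)[of 0] by (simp add: U_def)
      then show "\<delta> (Suc 0) ` carrier (W (Suc 0)) = carrier (submod (W 0) U)" by simp
      show "\<delta> (Suc 0) \<in> mod_hom L (W (Suc 0)) (submod (W 0) U)"
        by (rule mod_hom_into_submod[OF \<delta>(3)]) (use im in auto)
      show "\<delta> (Suc (Suc i)) \<in> mod_hom L (W (Suc (Suc i))) (W (Suc i))" if "i < m" for i
        using \<delta>(3)[of "Suc i"] that by simp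
      show "\<delta> (Suc (Suc i)) ` carrier (W (Suc (Suc i))) =
          mod_ker (W (Suc i)) (if i = 0 then submod (W 0) U else W (Suc (i - 1))) (\<delta> (Suc i))" if "i < m" for i
        using \<delta>(4)[of "Suc i"] that by (auto simp: mod_ker_def)
      show "inj_on (\<delta> (Suc m)) (carrier (W (Suc m)))" by (rule \<delta>(5))
    qed
  qed
  moreover have "mod_ses L (submod (W 0) U) (W 0) N (\<lambda>x. x) (\<delta> 0)"
    by (rule mod_sesI[OF K W Suc.prems(3) mod_hom_from_submod[OF mod_hom_id rsubD(1)[OF U]] \<delta>(1) _ \<delta>(2)])
      (auto simp: U_def mod_ker_def)
  ultimately show ?case using Suc.prems(2)[of 0] unfolding resdim_less.simps(2)[of L M0 "Suc m"] by blast
qed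

end

section \<open>Cartan--Eilenberg resolutions\<close>

definition stalk :: "('a, 'q) ring_scheme \<Rightarrow> ('a, 'a melt) module \<Rightarrow> 'a cpx" where
  "stalk L M = zcpx (\<lambda>i. if i = 0 then M else zero_mod L)"

lemma stalk_in_bcpx:
  assumes "ring L" "M \<in> mod_cat L"
  shows "stalk L M \<in> bcpx L"
  unfolding stalk_def
  by (rule zcpx_in_bcpx) (auto simp: assms zero_mod_in_mod_cat bounded_fam_def intro!: exI[of _ 0])

lemma cpx_shift_stalk:
  assumes "ring L" "M \<in> mod_cat L"
  shows "cpx_shift n (stalk L M) = zcpx (\<lambda>i. if i + n = 0 then M else zero_mod L)"
  unfolding stalk_def by (rule cpx_shift_zcpx[where L = L]) (simp add: assms zero_mod_in_mod_cat)

lemma bounded_fam_shift: "bounded_fam N \<Longrightarrow> bounded_fam (\<lambda>i. N (i + n))"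
proof -
  assume "bounded_fam N"
  then obtain b where b: "\<And>i. \<bar>i\<bar> > b \<Longrightarrow> carrier (N i) \<subseteq> {\<zero>\<^bsub>N i\<^esub>}" by (auto simp: bounded_fam_def)
  have "\<forall>i. \<bar>i\<bar> > b + \<bar>n\<bar> \<longrightarrow> carrier (N (i + n)) \<subseteq> {\<zero>\<^bsub>N (i + n)\<^esub>}"
    using b by (intro allI impI) (auto intro!: b)
  then show ?thesis unfolding bounded_fam_def by blast
qed

lemma bounded_fam_mono:
  assumes "bounded_fam N" "\<And>i. carrier (N i) \<subseteq> {\<zero>\<^bsub>N i\<^esub>} \<Longrightarrow> carrier (M i) \<subseteq> {\<zero>\<^bsub>M i\<^esub>}"
  shows "bounded_fam M"
  using assms unfolding bounded_fam_def by blast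

lemma bounded_fam_submod:
  assumes "bounded_fam N" "\<And>i. U i \<subseteq> carrier (N i)"
  shows "bounded_fam (\<lambda>i. submod (N i) (U i))"
  by (rule bounded_fam_mono[OF assms(1)]) (use assms(2) in fastforce)

lemma ses_zcpx:
  assumes "\<And>i. mod_ses L (K i) (P i) (M i) (f i) (p i)" "bounded_fam K" "bounded_fam P" "bounded_fam M"
  shows "ses L (zcpx K) (zcpx P) (zcpx M) f p"
  using mod_sesD[OF assms(1)] assms(2-4)
  by (intro sesI zcpx_in_bcpx chain_map_zcpx) simp_all

text \<open>In the application \<open>M0\<close> is the sum of the Igusa-Todorov module and the
  regular module; the second summand provides \<open>projective_retract\<close>.\<close>

locale module_generator = fg_noetherian L for L :: "('a, 'q) ring_scheme" +
  fixes M0 :: "('a, 'a melt) module"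
  assumes M0_in: "M0 \<in> mod_cat L"
    and projective_retract: "\<And>P. projective_mod L P \<Longrightarrow> add_retract L M0 P"

sublocale module_generator \<subseteq> generator L "stalk L M0"
  by unfold_locales (rule stalk_in_bcpx[OF ring_L M0_in])

section \<open>Sums of shifts of the generator, and lengths of complexes\<close>

context module_generator
begin

abbreviation shifts :: "'a cpx set" where
  "shifts \<equiv> {cpx_shift n Y | n Y. Y \<in> {stalk L M0}}"

abbreviation sum_obj :: "'a cpx list \<Rightarrow> int \<Rightarrow> ('a, 'a melt) module" where
  "sum_obj Ys i \<equiv> cobj (cpx_sum_list L Ys) i"

lemma sum_obj_in_mod_cat: "set Ys \<subseteq> shifts \<Longrightarrow> sum_obj Ys i \<in> mod_cat L"
  by (rule bcpxD(1)[OF shifts_in_bcpx])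

text \<open>The claim is confined to carriers because the empty sum, \<open>cpx_zero\<close>,
  carries the identity as its differential; on a one-point carrier this is the zero map.\<close>

lemma cpx_sum_list_diff:
  assumes "set Ys \<subseteq> shifts" "x \<in> carrier (sum_obj Ys i)"
  shows "cdiff (cpx_sum_list L Ys) i x = \<zero>\<^bsub>sum_obj Ys (i + 1)\<^esub>"
  using assms
proof (induction Ys arbitrary: x)
  case (Cons Y Ys)
  then obtain n where "Y = cpx_shift n (stalk L M0)" by auto
  then have "cdiff Y i y = \<zero>\<^bsub>cobj Y (i + 1)\<^esub>" for y
    by (simp only: cpx_shift_stalk[OF ring_L M0_in] zcpx_simps)
  then show ?case using Cons by auto
qed simp

lemma retract_append:
  assumes "set Ys \<subseteq> shifts" "set Zs \<subseteq> shifts"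
  shows "retract L (sum_obj Ys i) (sum_obj (Ys @ Zs) i)" "retract L (sum_obj Zs i) (sum_obj (Ys @ Zs) i)"
  using assms
proof (induction Ys)
  case Nil
  {
    case 1
    then show ?case
      using retract_trivial[OF zero_mod_in_mod_cat[OF ring_L] sum_obj_in_mod_cat[of Zs]] by simp
  next
    case 2
    then show ?case by (simp add: retract_refl)
  }
next
  case (Cons Y Ys)
  {
    case 1
    then show ?case using Cons(1) by (auto intro: retract_mod_sum retract_refl)
  next
    case 2
    have "Y \<in> shifts" using 2 by simp
    then have "cobj Y i \<in> mod_cat L" using bcpxD(1)[OF cpx_shift_in_bcpx[OF S_in]] by blast
    then show ?case using 2 retract_trans[OF Cons(2) retract_mod_sum_right] by simp
  }
qed

lemma retract_single_degree:
  assumes "add_retract L M0 W"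
  shows "\<exists>Ys. set Ys \<subseteq> shifts \<and> retract L W (sum_obj Ys j)"
proof -
  obtain k where k: "retract L W (mod_power L M0 k)" using assms by (auto simp: add_retract_def)
  \<comment> \<open>Shifting by \<open>- j\<close> places the stalk in degree
    \<open>j\<close>.\<close>
  let ?Ys = "replicate k (cpx_shift (- j) (stalk L M0))"
  have "sum_obj ?Ys j = mod_power L M0 k"
    by (induction k) (auto simp: cpx_shift_stalk[OF ring_L M0_in])
  moreover have "set ?Ys \<subseteq> shifts"
  proof
    fix Y assume "Y \<in> set ?Ys"
    then have "Y = cpx_shift (- j) (stalk L M0)" by (simp add: set_replicate_conv_if split: if_splits)
    then show "Y \<in> shifts" by (intro CollectI exI conjI) (assumption, rule singletonI)
  qed
  ultimately show ?thesis using k by (intro exI[of _ ?Ys]) (simp only: simp_thms)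
qed

text \<open>Lists for the single degrees are concatenated. Summands contributed to a degree by the
  other lists do no harm, since only a retract is asked for.\<close>

lemma retract_finite_degrees:
  assumes "finite J" "\<And>j. j \<in> J \<Longrightarrow> add_retract L M0 (W j)"
  shows "\<exists>Ys. set Ys \<subseteq> shifts \<and> (\<forall>j\<in>J. retract L (W j) (sum_obj Ys j))"
  using assms
proof (induction J rule: finite_induct)
  case empty
  then show ?case by (intro exI[of _ "[]"]) simp
next
  case (insert j J)
  then obtain Ys where Ys: "set Ys \<subseteq> shifts" "\<forall>j\<in>J. retract L (W j) (sum_obj Ys j)" by auto
  obtain Zs where Zs: "set Zs \<subseteq> shifts" "retract L (W j) (sum_obj Zs j)"
    using retract_single_degree insert.prems by blast
  have "retract L (W i) (sum_obj (Ys @ Zs) i)" if "i \<in> insert j J" for i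
  proof (cases "i = j")
    case True
    then show ?thesis using retract_trans[OF Zs(2) retract_append(2)[OF Ys(1) Zs(1)]] by simp
  next
    case False
    then have "retract L (W i) (sum_obj Ys i)" using Ys(2) that by blast
    then show ?thesis by (rule retract_trans[OF _ retract_append(1)[OF Ys(1) Zs(1)]])
  qed
  moreover have "set (Ys @ Zs) \<subseteq> shifts" using Ys(1) Zs(1) by simp
  ultimately show ?case by blast
qed

text \<open>Boundedness leaves finitely many degrees to cover by one sum \<open>?T\<close> of
  shifts; elsewhere the modules are trivial. Both differentials vanish, so the degreewise retraction
  \<open>g\<close> is a chain map and its kernel is the complement: \<open>t\<close> decomposes into
  \<open>g t\<close> and \<open>t - f (g t)\<close>.\<close>

lemma level_one_zcpx:
  assumes W: "\<And>i. add_retract L M0 (W i)" and b: "bounded_fam W"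
  shows "level_one (zcpx W)"
proof -
  have WM: "W i \<in> mod_cat L" for i using W by (simp add: add_retract_def)
  obtain b where b': "\<And>i. \<bar>i\<bar> > b \<Longrightarrow> carrier (W i) \<subseteq> {\<zero>\<^bsub>W i\<^esub>}" using b by (auto simp: bounded_fam_def)
  obtain Ys where Ys: "set Ys \<subseteq> shifts" "\<forall>j\<in>{-b..b}. retract L (W j) (sum_obj Ys j)"
    using retract_finite_degrees[of "{-b..b}" W] W by auto
  let ?T = "cpx_sum_list L Ys"
  have T: "?T \<in> bcpx L" by (rule shifts_in_bcpx[OF Ys(1)])
  have C: "zcpx W \<in> bcpx L" by (rule zcpx_in_bcpx[OF WM b])
  have "retract L (W i) (sum_obj Ys i)" for i
  proof (cases "i \<in> {-b..b}")
    case False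
    then have "\<bar>i\<bar> > b" by auto
    then show ?thesis by (intro retract_trivial WM bcpxD(1)[OF T] b')
  qed (use Ys(2) in blast)
  then have "\<forall>i. \<exists>f g. f \<in> mod_hom L (W i) (sum_obj Ys i) \<and> g \<in> mod_hom L (sum_obj Ys i) (W i) \<and>
      (\<forall>x\<in>carrier (W i). g (f x) = x)" unfolding retract_def by blast
  then obtain f g where f: "\<And>i. f i \<in> mod_hom L (W i) (sum_obj Ys i)"
    and g: "\<And>i. g i \<in> mod_hom L (sum_obj Ys i) (W i)"
    and gf: "\<And>i x. x \<in> carrier (W i) \<Longrightarrow> g i (f i x) = x" by metis
  have f0: "f i \<zero>\<^bsub>W i\<^esub> = \<zero>\<^bsub>sum_obj Ys i\<^esub>" and g0: "g i \<zero>\<^bsub>sum_obj Ys i\<^esub> = \<zero>\<^bsub>W i\<^esub>" for i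
    using mod_hom_zero[OF f mod_cat_abelian[OF WM] bcpxD(3)[OF T]]
      mod_hom_zero[OF g bcpxD(3)[OF T] mod_cat_abelian[OF WM]] by auto
  have cg: "chain_map L ?T (zcpx W) g"
    by (rule chain_mapI) (use g in \<open>simp_all add: cpx_sum_list_diff[OF Ys(1)] g0\<close>)
  let ?U = "\<lambda>i. {x \<in> carrier (sum_obj Ys i). g i x = \<zero>\<^bsub>cobj (zcpx W) i\<^esub>}"
  let ?C' = "subcpx ?T ?U"
  have C': "?C' \<in> bcpx L" by (rule ker_subcpx[OF T C cg])
  let ?h = "\<lambda>i z. f i (lft z) \<oplus>\<^bsub>sum_obj Ys i\<^esub> rgt z"
  have S: "cpx_sum (zcpx W) ?C' \<in> bcpx L" by (rule cpx_sum_in_bcpx[OF C C'])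
  have h: "?h i \<in> mod_hom L (cobj (cpx_sum (zcpx W) ?C') i) (sum_obj Ys i)" for i
    unfolding cpx_sum_simps subcpx_simps zcpx_simps
    by (rule mod_hom_add[OF bcpxD(1)[OF T] mod_hom_comp[OF f lft_hom] mod_hom_out_submod[OF rgt_hom]]) auto
  interpret T: abelian_group "sum_obj Ys i" for i by (rule bcpxD(3)[OF T])
  interpret W: abelian_group "W i" for i by (rule mod_cat_abelian[OF WM])
  have gh: "g i (f i x \<oplus>\<^bsub>sum_obj Ys i\<^esub> y) = x" if "x \<in> carrier (W i)" "y \<in> ?U i" for i x y
    using mod_homD(2)[OF g mod_homD(1)[OF f that(1)], of y] that gf by simp
  have "qis L (cpx_sum (zcpx W) ?C') ?T ?h"
  proof (rule qis_bij[OF S T])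
    show "chain_map L (cpx_sum (zcpx W) ?C') ?T ?h"
    proof (rule chain_mapI[OF h])
      fix i z assume "z \<in> carrier (cobj (cpx_sum (zcpx W) ?C') i)"
      then have "rgt z \<in> carrier (sum_obj Ys i)" "f i (lft z) \<in> carrier (sum_obj Ys i)"
        using mod_homD(1)[OF f] by auto
      then show "?h (i + 1) (cdiff (cpx_sum (zcpx W) ?C') i z) = cdiff ?T i (?h i z)"
        by (simp add: cpx_sum_list_diff[OF Ys(1)] f0)
    qed
    show "inj_on (?h i) (carrier (cobj (cpx_sum (zcpx W) ?C') i))" for i
    proof (rule inj_onI)
      fix z z' assume "z \<in> carrier (cobj (cpx_sum (zcpx W) ?C') i)" "z' \<in> carrier (cobj (cpx_sum (zcpx W) ?C') i)"
        and eq: "?h i z = ?h i z'"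
      then obtain x y x' y' where z: "z = Join x y" "x \<in> carrier (W i)" "y \<in> ?U i"
        "z' = Join x' y'" "x' \<in> carrier (W i)" "y' \<in> ?U i" by auto
      have "x = x'" using gh[OF z(2,3)] gh[OF z(5,6)] eq z(1,4) by simp
      then show "z = z'" using eq z mod_homD(1)[OF f z(2)] by auto
    qed
    show "?h i ` carrier (cobj (cpx_sum (zcpx W) ?C') i) = carrier (sum_obj Ys i)" for i
    proof
      show "?h i ` carrier (cobj (cpx_sum (zcpx W) ?C') i) \<subseteq> carrier (sum_obj Ys i)"
        using mod_homD(1)[OF h] by blast
      show "carrier (sum_obj Ys i) \<subseteq> ?h i ` carrier (cobj (cpx_sum (zcpx W) ?C') i)"
      proof
        fix t assume t: "t \<in> carrier (sum_obj Ys i)"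
        have gt: "g i t \<in> carrier (W i)" and fgt: "f i (g i t) \<in> carrier (sum_obj Ys i)"
          using mod_homD(1)[OF g t] mod_homD(1)[OF f] by auto
        have "g i (t \<ominus>\<^bsub>sum_obj Ys i\<^esub> f i (g i t)) = g i t \<ominus>\<^bsub>W i\<^esub> g i (f i (g i t))"
          by (rule mod_hom_diff[OF g T.abelian_group_axioms W.abelian_group_axioms t fgt])
        also have "\<dots> = \<zero>\<^bsub>W i\<^esub>" using gf[OF gt] gt by (simp add: a_minus_def W.r_neg)
        finally have "t \<ominus>\<^bsub>sum_obj Ys i\<^esub> f i (g i t) \<in> ?U i" using t fgt by simp
        moreover have "t = f i (g i t) \<oplus>\<^bsub>sum_obj Ys i\<^esub> (t \<ominus>\<^bsub>sum_obj Ys i\<^esub> f i (g i t))"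
          using t fgt by (simp add: a_minus_def T.a_lcomm T.r_neg)
        ultimately show "t \<in> ?h i ` carrier (cobj (cpx_sum (zcpx W) ?C') i)"
          using gt by (intro image_eqI[of _ _ "Join (g i t) (t \<ominus>\<^bsub>sum_obj Ys i\<^esub> f i (g i t))"]) simp_all
      qed
    qed
  qed
  then show ?thesis unfolding level_one_def using C C' Ys(1) S qis_gid[OF S] by blast
qed

text \<open>The kernels of the first steps, taken in all degrees, again form a complex with zero
  differential, and so does its shift; the induction stays within \<open>zcpx\<close>. Boundedness
  survives because trivial modules are resolved by trivial ones.\<close>

lemma length_le_zcpx:
  assumes "\<And>i. resdim_less L M0 r (N i)" "bounded_fam N"
  shows "length_le (zcpx N) r"
  using assms
proof (induction r arbitrary: N)
  case 0
  then show ?case by (intro length_le_trivial zcpx_in_bcpx) simp_all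
next
  case (Suc r)
  have "\<forall>i. \<exists>K W f p. add_retract L M0 W \<and> resdim_less L M0 r K \<and> mod_ses L K W (N i) f p \<and>
    (carrier (N i) \<subseteq> {\<zero>\<^bsub>N i\<^esub>} \<longrightarrow> carrier K \<subseteq> {\<zero>\<^bsub>K\<^esub>} \<and> carrier W \<subseteq> {\<zero>\<^bsub>W\<^esub>})"
    using resdim_less_step[OF ring_L Suc.prems(1)] by blast
  then obtain K W f p where *: "\<And>i. add_retract L M0 (W i)" "\<And>i. resdim_less L M0 r (K i)"
    "\<And>i. mod_ses L (K i) (W i) (N i) (f i) (p i)"
    "\<And>i. carrier (N i) \<subseteq> {\<zero>\<^bsub>N i\<^esub>} \<Longrightarrow> carrier (K i) \<subseteq> {\<zero>\<^bsub>K i\<^esub>}"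
    "\<And>i. carrier (N i) \<subseteq> {\<zero>\<^bsub>N i\<^esub>} \<Longrightarrow> carrier (W i) \<subseteq> {\<zero>\<^bsub>W i\<^esub>}" by metis
  have bK: "bounded_fam K" and bW: "bounded_fam W"
    using bounded_fam_mono[OF Suc.prems(2)] *(4,5) by blast+
  have "length_le (cpx_shift 1 (zcpx K)) r"
    unfolding cpx_shift_zcpx[of K, OF mod_sesD(1)[OF *(3)]]
    by (rule Suc.IH[OF *(2) bounded_fam_shift[OF bK]])
  then show ?case
    by (rule length_le_resolve[OF ses_zcpx[OF *(3) bK bW Suc.prems(2)] length_le_one[OF level_one_zcpx[OF *(1) bW]]])
qed

text \<open>The quotient map is the differential itself, a chain map onto the shifted coboundaries
  once these carry zero differential. Each of the two factors contributes \<open>r\<close>.\<close>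

lemma length_le_cocycles_coboundaries:
  assumes X: "X \<in> bcpx L"
    and Z: "\<And>i. resdim_less L M0 r (submod (cobj X i) (cocycles X i))"
    and B: "\<And>i. resdim_less L M0 r (submod (cobj X i) (coboundaries X i))"
  shows "length_le X (2 * r)"
proof -
  let ?Z = "\<lambda>i. submod (cobj X i) (cocycles X i)" and ?B = "\<lambda>i. submod (cobj X (i + 1)) (coboundaries X (i + 1))"
  have b: "bounded_fam ?Z" "bounded_fam ?B"
    by (intro bounded_fam_submod bounded_fam_shift bounded_fam_bcpx[OF X] rsubD(1)[OF rsub_cocycles[OF X]]
        rsubD(1)[OF rsub_coboundaries[OF X]])+
  have lZ: "length_le (zcpx ?Z) r" by (rule length_le_zcpx[OF Z b(1)])
  have lB: "length_le (zcpx ?B) r" by (rule length_le_zcpx[OF B b(2)])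
  have u: "chain_map L X (zcpx ?B) (cdiff X)"
  proof (rule chain_mapI)
    show "cdiff X i \<in> mod_hom L (cobj X i) (cobj (zcpx ?B) i)" for i
      unfolding zcpx_simps
      by (rule mod_hom_into_submod[OF bcpxD(4)[OF X]]) (auto simp: coboundaries_def)
    show "cdiff X (i + 1) (cdiff X i x) = cdiff (zcpx ?B) i (cdiff X i x)" if "x \<in> carrier (cobj X i)" for i x
      using bcpxD(6)[OF X _ that] by simp
  qed
  have "length_le X (r + r)"
  proof (rule length_le_extension[OF X lB u])
    show "cdiff X i ` carrier (cobj X i) = carrier (cobj (zcpx ?B) i)" for i by (simp add: coboundaries_def)
    let ?U = "\<lambda>i. {c \<in> carrier (cobj X i). cdiff X i c = \<zero>\<^bsub>cobj (zcpx ?B) i\<^esub>}"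
    have U: "?U i = cocycles X i" for i by (simp add: cocycles_def mod_ker_def)
    show "length_le (subcpx X ?U) r"
    proof (rule length_le_cong[OF lZ])
      have "rsub L (cobj X i) (?U i)" for i unfolding U by (rule rsub_cocycles[OF X])
      then show "subcpx X ?U \<in> bcpx L"
        using bcpxD(7)[OF X, of "i + 1" for i] bcpx_zero_closed[OF X]
        by (intro subcpx_in_bcpx[OF X]) auto
      show "cobj (subcpx X ?U) i = cobj (zcpx ?Z) i" for i by (simp add: cocycles_def mod_ker_def)
      show "cdiff (subcpx X ?U) i x = cdiff (zcpx ?Z) i x" if "x \<in> carrier (cobj (zcpx ?Z) i)" for i x
        using that by (simp add: cocycles_def mod_ker_def)
    qed
  qed
  then show ?thesis by (simp add: mult_2)
qed

text \<open>The sign in the shifted differential changes neither kernel nor image.\<close>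

lemma cocycles_shift:
  assumes "X \<in> bcpx L"
  shows "cocycles (cpx_shift 1 X) i = cocycles X (i + 1)"
    and "coboundaries (cpx_shift 1 X) i = coboundaries X (i + 1)"
proof -
  interpret X: abelian_group "cobj X i" for i by (rule bcpxD(3)[OF assms])
  have "\<ominus>\<^bsub>cobj X (i + 2)\<^esub> y = \<zero>\<^bsub>cobj X (i + 2)\<^esub> \<longleftrightarrow> y = \<zero>\<^bsub>cobj X (i + 2)\<^esub>" if "y \<in> carrier (cobj X (i + 2))" for y
    using that by (metis X.minus_minus abelian_group_minus_zero X.abelian_group_axioms)
  then show "cocycles (cpx_shift 1 X) i = cocycles X (i + 1)"
    using bcpxD(5)[OF assms, of "i + 2" "i + 1"] by (auto simp: cocycles_def mod_ker_def)
  have "(\<lambda>x. \<ominus>\<^bsub>cobj X (i + 1)\<^esub> cdiff X i x) ` carrier (cobj X i) = cdiff X i ` carrier (cobj X i)"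
  proof -
    have m: "\<ominus>\<^bsub>cobj X (i + 1)\<^esub> cdiff X i x = cdiff X i (\<ominus>\<^bsub>cobj X i\<^esub> x)" if "x \<in> carrier (cobj X i)" for x
      by (rule mod_hom_minus[OF bcpxD(4)[OF assms] bcpxD(3)[OF assms] bcpxD(3)[OF assms] that, symmetric]) simp
    have "cdiff X i x \<in> (\<lambda>x. \<ominus>\<^bsub>cobj X (i + 1)\<^esub> cdiff X i x) ` carrier (cobj X i)" if "x \<in> carrier (cobj X i)" for x
      using m[of "\<ominus>\<^bsub>cobj X i\<^esub> x"] that by (intro image_eqI[of _ _ "\<ominus>\<^bsub>cobj X i\<^esub> x"]) auto
    then show ?thesis using m by auto
  qed
  then show "coboundaries (cpx_shift 1 X) i = coboundaries X (i + 1)"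
    by (simp add: coboundaries_def)
qed

text \<open>One step of a Cartan--Eilenberg resolution: \<open>X\<close> is covered by a sum of stalks covering its cocycles
  and of contractible two-term complexes covering its coboundaries.\<close>

lemma length_le_cartan_eilenberg:
  assumes "X \<in> bcpx L"
    and "\<And>i. syz_resdim_less L M0 (Suc r) k (submod (cobj X i) (cocycles X i))"
    and "\<And>i. syz_resdim_less L M0 (Suc r) k (submod (cobj X i) (coboundaries X i))"
  shows "length_le X (k + 2 * Suc r)"
  using assms
proof (induction k arbitrary: X)
  case 0
  then show ?case using length_le_cocycles_coboundaries[of X "Suc r"] by simp
next
  case (Suc k)
  note X = Suc.prems(1)
  define Z where "Z i = submod (cobj X i) (cocycles X i)" for i
  define B where "B i = submod (cobj X i) (coboundaries X i)" for i
  have ZM: "Z i \<in> mod_cat L" and BM: "B i \<in> mod_cat L" for i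
    unfolding Z_def B_def by (intro noetherian bcpxD(1)[OF X] rsub_cocycles[OF X] rsub_coboundaries[OF X])+
  have b: "bounded_fam Z" "bounded_fam B"
    unfolding Z_def B_def
    by (intro bounded_fam_submod bounded_fam_bcpx[OF X] rsubD(1)[OF rsub_cocycles[OF X]]
        rsubD(1)[OF rsub_coboundaries[OF X]])+
  \<comment> \<open>The final clause of the choice makes \<open>P\<close> trivial wherever the
    cocycles are, so that the choices made independently in each degree still form bounded
    complexes.\<close>
  have "\<forall>i. \<exists>K P f p. projective_mod L P \<and> syz_resdim_less L M0 (Suc r) k K \<and> mod_ses L K P (Z i) f p \<and>
    (carrier (Z i) \<subseteq> {\<zero>\<^bsub>Z i\<^esub>} \<longrightarrow> carrier K \<subseteq> {\<zero>\<^bsub>K\<^esub>} \<and> carrier P \<subseteq> {\<zero>\<^bsub>P\<^esub>})"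
    using syz_step[OF ring_L Suc.prems(2)] unfolding Z_def by blast
  then obtain KZ P \<iota> \<zeta> where P: "\<And>i. projective_mod L (P i)" "\<And>i. syz_resdim_less L M0 (Suc r) k (KZ i)"
    "\<And>i. mod_ses L (KZ i) (P i) (Z i) (\<iota> i) (\<zeta> i)"
    "\<And>i. carrier (Z i) \<subseteq> {\<zero>\<^bsub>Z i\<^esub>} \<Longrightarrow> carrier (P i) \<subseteq> {\<zero>\<^bsub>P i\<^esub>}" by metis
  have "\<forall>i. \<exists>K P f p. projective_mod L P \<and> syz_resdim_less L M0 (Suc r) k K \<and> mod_ses L K P (B i) f p \<and>
    (carrier (B i) \<subseteq> {\<zero>\<^bsub>B i\<^esub>} \<longrightarrow> carrier K \<subseteq> {\<zero>\<^bsub>K\<^esub>} \<and> carrier P \<subseteq> {\<zero>\<^bsub>P\<^esub>})"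
    using syz_step[OF ring_L Suc.prems(3)] unfolding B_def by blast
  then obtain KB Q \<kappa> \<beta> where Q: "\<And>i. projective_mod L (Q i)" "\<And>i. syz_resdim_less L M0 (Suc r) k (KB i)"
    "\<And>i. mod_ses L (KB i) (Q i) (B i) (\<kappa> i) (\<beta> i)"
    "\<And>i. carrier (B i) \<subseteq> {\<zero>\<^bsub>B i\<^esub>} \<Longrightarrow> carrier (Q i) \<subseteq> {\<zero>\<^bsub>Q i\<^esub>}" by metis
  have bP: "bounded_fam P" by (rule bounded_fam_mono[OF b(1)]) (rule P(4))
  have bQ: "bounded_fam Q" by (rule bounded_fam_mono[OF b(2)]) (rule Q(4))
  note PM = projective_modD(1)[OF P(1)] and QM = projective_modD(1)[OF Q(1)]
  interpret Xi: right_module L "cobj X i" for i by (rule bcpxD(2)[OF X])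
  interpret Pi: right_module L "P i" for i by (rule mod_catD[OF PM])
  interpret Qi: right_module L "Q i" for i by (rule mod_catD[OF QM])
  interpret KZi: right_module L "KZ i" for i by (rule mod_catD[OF mod_sesD(1)[OF P(3)]])
  have Zc: "carrier (Z i) = {x \<in> carrier (cobj X i). cdiff X i x = \<zero>\<^bsub>cobj X (i + 1)\<^esub>}" "\<zero>\<^bsub>Z i\<^esub> = \<zero>\<^bsub>cobj X i\<^esub>" for i
    by (simp_all add: Z_def cocycles_def mod_ker_def)
  have Bc: "carrier (B i) = cdiff X (i - 1) ` carrier (cobj X (i - 1))" "\<zero>\<^bsub>B i\<^esub> = \<zero>\<^bsub>cobj X i\<^esub>" for i
    by (simp_all add: B_def coboundaries_def)
  have BZ: "carrier (B i) \<subseteq> carrier (Z i)" for i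
    using bcpxD(5,6)[OF X, of i "i - 1"] by (auto simp: Zc Bc)
  have BX: "carrier (B i) \<subseteq> carrier (cobj X i)" for i using BZ Zc by blast
  have \<zeta>: "\<zeta> i \<in> mod_hom L (P i) (cobj X i)" for i
    by (rule mod_hom_out_submod[OF mod_sesD(5)[OF P(3), unfolded Z_def] rsubD(1)[OF rsub_cocycles[OF X]]])
  have \<beta>: "\<beta> i \<in> mod_hom L (Q i) (cobj X i)" for i
    by (rule mod_hom_out_submod[OF mod_sesD(5)[OF Q(3), unfolded B_def] rsubD(1)[OF rsub_coboundaries[OF X]]])
  have \<beta>Z: "\<beta> i \<in> mod_hom L (Q i) (Z i)" for i
    unfolding Z_def using BZ mod_homD(1)[OF mod_sesD(5)[OF Q(3)]]
    by (intro mod_hom_into_submod[OF \<beta>]) (auto simp: Z_def)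
  have \<zeta>d: "cdiff X i (\<zeta> i p) = \<zero>\<^bsub>cobj X (i + 1)\<^esub>" if "p \<in> carrier (P i)" for i p
    using mod_homD(1)[OF mod_sesD(5)[OF P(3)] that] by (simp add: Zc)
  have \<beta>d: "cdiff X i (\<beta> i q) = \<zero>\<^bsub>cobj X (i + 1)\<^esub>" if "q \<in> carrier (Q i)" for i q
    using mod_homD(1)[OF \<beta>Z that] by (simp add: Zc)
  have \<zeta>sur: "\<exists>p\<in>carrier (P i). x = \<zeta> i p" if "x \<in> carrier (cobj X i)" "cdiff X i x = \<zero>\<^bsub>cobj X (i + 1)\<^esub>" for i x
    using mod_sesD(7)[OF P(3), of i] that unfolding Zc by blast
  \<comment> \<open>The differential maps \<open>cobj X i\<close> onto the coboundaries in degree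
    \<open>i + 1\<close>, so \<beta> lifts along it; \<theta> covers the part of \<open>X\<close>
    that is not closed.\<close>
  have "\<exists>h\<in>mod_hom L (Q (i + 1)) (cobj X i). \<forall>q\<in>carrier (Q (i + 1)). cdiff X i (h q) = \<beta> (i + 1) q" for i
  proof (rule projective_modD(2)[OF Q(1) bcpxD(1)[OF X] BM _ mod_sesD(5)[OF Q(3)]])
    show "cdiff X i \<in> mod_hom L (cobj X i) (B (i + 1))"
      unfolding B_def by (rule mod_hom_into_submod[OF bcpxD(4)[OF X]]) (auto simp: coboundaries_def)
    show "cdiff X i ` carrier (cobj X i) = carrier (B (i + 1))" by (simp add: Bc)
  qed
  then obtain \<theta> where \<theta>: "\<And>i. \<theta> i \<in> mod_hom L (Q (i + 1)) (cobj X i)"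
    and d\<theta>: "\<And>i q. q \<in> carrier (Q (i + 1)) \<Longrightarrow> cdiff X i (\<theta> i q) = \<beta> (i + 1) q" by metis
  \<comment> \<open>Coboundaries are cocycles, so \<beta> also lifts along the cover \<zeta> of the
    cocycles. The lift \<tau> will split a projective summand off the cocycles of the
    kernel.\<close>
  have "\<exists>h\<in>mod_hom L (Q i) (P i). \<forall>q\<in>carrier (Q i). \<zeta> i (h q) = \<beta> i q" for i
    by (rule projective_modD(2)[OF Q(1) PM ZM mod_sesD(5)[OF P(3)] \<beta>Z mod_sesD(7)[OF P(3)]])
  then obtain \<tau> where \<tau>: "\<And>i. \<tau> i \<in> mod_hom L (Q i) (P i)"
    and \<zeta>\<tau>: "\<And>i q. q \<in> carrier (Q i) \<Longrightarrow> \<zeta> i (\<tau> i q) = \<beta> i q" by metis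
  have z0 [simp]: "\<zeta> i \<zero>\<^bsub>P i\<^esub> = \<zero>\<^bsub>cobj X i\<^esub>" "\<beta> i \<zero>\<^bsub>Q i\<^esub> = \<zero>\<^bsub>cobj X i\<^esub>" "\<theta> i \<zero>\<^bsub>Q (i + 1)\<^esub> = \<zero>\<^bsub>cobj X i\<^esub>" for i
    using mod_hom_zero[OF \<zeta> mod_cat_abelian[OF PM] bcpxD(3)[OF X]]
      mod_hom_zero[OF \<beta> mod_cat_abelian[OF QM] bcpxD(3)[OF X]]
      mod_hom_zero[OF \<theta> mod_cat_abelian[OF QM] bcpxD(3)[OF X]] by auto
  note \<zeta>c [simp] = mod_homD(1)[OF \<zeta>] and \<beta>c [simp] = mod_homD(1)[OF \<beta>] and \<theta>c [simp] = mod_homD(1)[OF \<theta>]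
  \<comment> \<open>Each \<open>Q (i + 1)\<close> occurs in the degrees \<open>i\<close> and
    \<open>i + 1\<close>, joined by the identity: these are the contractible two-term complexes.
    \<open>P i\<close> carries zero differential.\<close>
  define E where "E = \<lparr>cobj = (\<lambda>i. mod_sum (mod_sum (P i) (Q i)) (Q (i + 1))),
    cdiff = (\<lambda>i z. Join (Join \<zero>\<^bsub>P (i + 1)\<^esub> (rgt z)) \<zero>\<^bsub>Q (i + 2)\<^esub>)\<rparr>"
  have E_obj [simp]: "cobj E i = mod_sum (mod_sum (P i) (Q i)) (Q (i + 1))" for i by (simp add: E_def)
  have E_diff [simp]: "cdiff E i z = Join (Join \<zero>\<^bsub>P (i + 1)\<^esub> (rgt z)) \<zero>\<^bsub>Q (i + 2)\<^esub>" for i z by (simp add: E_def)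
  have E: "E \<in> bcpx L"
  proof -
    obtain c where c: "\<forall>i. \<bar>i\<bar> > c \<longrightarrow> carrier (P i) \<subseteq> {\<zero>\<^bsub>P i\<^esub>}" using bP unfolding bounded_fam_def by blast
    obtain e where e: "\<forall>i. \<bar>i\<bar> > e \<longrightarrow> carrier (Q i) \<subseteq> {\<zero>\<^bsub>Q i\<^esub>}" using bQ unfolding bounded_fam_def by blast
    show ?thesis
    proof (rule bcpxI[of _ _ "max c e + 1"])
      show "cobj E i \<in> mod_cat L" for i unfolding E_obj by (intro mod_sum_in_mod_cat PM QM)
      show "cdiff E i \<in> mod_hom L (cobj E i) (cobj E (i + 1))" for i
        using mod_hom_Join[OF mod_hom_Join[OF mod_hom_const_zero[OF PM] rgt_hom] mod_hom_const_zero[OF QM]]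
        by (simp add: E_def)
      show "cdiff E (i + 1) (cdiff E i z) = \<zero>\<^bsub>cobj E (i + 2)\<^esub>" if "z \<in> carrier (cobj E i)" for i z by simp
      show "carrier (cobj E i) \<subseteq> {\<zero>\<^bsub>cobj E i\<^esub>}" if "max c e + 1 < \<bar>i\<bar>" for i
      proof -
        have "carrier (P i) \<subseteq> {\<zero>\<^bsub>P i\<^esub>}" "carrier (Q i) \<subseteq> {\<zero>\<^bsub>Q i\<^esub>}" "carrier (Q (i + 1)) \<subseteq> {\<zero>\<^bsub>Q (i + 1)\<^esub>}"
          using that c[rule_format, of i] e[rule_format, of i] e[rule_format, of "i + 1"] by auto
        then show ?thesis by auto
      qed
    qed
  qed
  have E_cases: "\<exists>p q q'. z = Join (Join p q) q' \<and> p \<in> carrier (P i) \<and> q \<in> carrier (Q i) \<and> q' \<in> carrier (Q (i + 1))"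
    if "z \<in> carrier (cobj E i)" for i z using that by auto
  define s where "s i z = \<zeta> i (lft (lft z)) \<oplus>\<^bsub>cobj X i\<^esub> (\<beta> i (rgt (lft z)) \<oplus>\<^bsub>cobj X i\<^esub> \<theta> i (rgt z))" for i z
  have ds: "cdiff X i (s i (Join (Join p q) q')) = \<beta> (i + 1) q'"
    if "p \<in> carrier (P i)" "q \<in> carrier (Q i)" "q' \<in> carrier (Q (i + 1))" for i p q q'
    using mod_homD(2)[OF bcpxD(4)[OF X, of "i + 1" i]] that \<zeta>d \<beta>d d\<theta> by (simp add: s_def)
  have s: "chain_map L E X s"
  proof (rule chain_mapI)
    show "s i \<in> mod_hom L (cobj E i) (cobj X i)" for i
      unfolding s_def E_obj
      by (intro mod_hom_add bcpxD(1)[OF X] mod_hom_comp[OF \<zeta> mod_hom_lft[OF lft_hom]]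
          mod_hom_comp[OF \<beta> mod_hom_rgt[OF lft_hom]] mod_hom_comp[OF \<theta> rgt_hom])
    fix i z assume "z \<in> carrier (cobj E i)"
    then obtain p q q' where z: "z = Join (Join p q) q'" "p \<in> carrier (P i)" "q \<in> carrier (Q i)" "q' \<in> carrier (Q (i + 1))"
      using E_cases by blast
    show "s (i + 1) (cdiff E i z) = cdiff X i (s i z)"
      using ds[OF z(2-4)] z z0(3)[of "i + 1"] by (simp add: s_def)
  qed
  have s_sur: "s i ` carrier (cobj E i) = carrier (cobj X i)" for i
  proof
    show "s i ` carrier (cobj E i) \<subseteq> carrier (cobj X i)" using chain_mapD(2)[OF s] by blast
    show "carrier (cobj X i) \<subseteq> s i ` carrier (cobj E i)"
    proof
      fix x assume x: "x \<in> carrier (cobj X i)"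
      then have "cdiff X i x \<in> carrier (B (i + 1))" by (simp add: Bc)
      \<comment> \<open>Subtracting \<theta> of a \<open>q\<close> over the boundary of
        \<open>x\<close> leaves a cocycle, which \<zeta> covers.\<close>
      then obtain q where q: "q \<in> carrier (Q (i + 1))" "cdiff X i x = \<beta> (i + 1) q"
        using mod_sesD(7)[OF Q(3), of "i + 1"] by blast
      have "cdiff X i (x \<ominus>\<^bsub>cobj X i\<^esub> \<theta> i q) = cdiff X i x \<ominus>\<^bsub>cobj X (i + 1)\<^esub> cdiff X i (\<theta> i q)"
        by (rule mod_hom_diff[OF bcpxD(4)[OF X] bcpxD(3)[OF X] bcpxD(3)[OF X] x]) (use q in simp_all)
      also have "\<dots> = \<zero>\<^bsub>cobj X (i + 1)\<^esub>" using q d\<theta> by (simp add: a_minus_def Xi.r_neg)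
      finally obtain p where p: "p \<in> carrier (P i)" "x \<ominus>\<^bsub>cobj X i\<^esub> \<theta> i q = \<zeta> i p"
        using \<zeta>sur[of "x \<ominus>\<^bsub>cobj X i\<^esub> \<theta> i q" i] x q by auto
      have "x = \<zeta> i p \<oplus>\<^bsub>cobj X i\<^esub> \<theta> i q"
        unfolding p(2)[symmetric] using x q by (simp add: a_minus_def Xi.a_assoc Xi.l_neg)
      then show "x \<in> s i ` carrier (cobj E i)"
        using p q by (intro image_eqI[of _ _ "Join (Join p \<zero>\<^bsub>Q i\<^esub>) q"]) (simp_all add: s_def)
    qed
  qed
  \<comment> \<open>The contractible parts cancel: a cocycle of \<open>E\<close> has zero last
    component, and its middle component is a boundary. Hence \<open>E\<close> costs no more than
    \<open>zcpx P\<close>, one step.\<close>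
  have "qis L (zcpx P) E (\<lambda>i p. Join (Join p \<zero>\<^bsub>Q i\<^esub>) \<zero>\<^bsub>Q (i + 1)\<^esub>)"
  proof (rule qisI)
    show "chain_map L (zcpx P) E (\<lambda>i p. Join (Join p \<zero>\<^bsub>Q i\<^esub>) \<zero>\<^bsub>Q (i + 1)\<^esub>)"
    proof (rule chain_mapI)
      show "(\<lambda>p. Join (Join p \<zero>\<^bsub>Q i\<^esub>) \<zero>\<^bsub>Q (i + 1)\<^esub>) \<in> mod_hom L (cobj (zcpx P) i) (cobj E i)" for i
        unfolding E_obj zcpx_simps by (intro mod_hom_Join mod_hom_id mod_hom_const_zero QM)
    qed simp
    show "\<exists>w\<in>carrier (cobj (zcpx P) (i - 1)). x = cdiff (zcpx P) (i - 1) w"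
      if "x \<in> carrier (cobj (zcpx P) i)" "Join (Join x \<zero>\<^bsub>Q i\<^esub>) \<zero>\<^bsub>Q (i + 1)\<^esub> = cdiff E (i - 1) y" for i x y
      using that(2) by (intro bexI[of _ "\<zero>\<^bsub>P (i - 1)\<^esub>"]) simp_all
    show "\<exists>x\<in>carrier (cobj (zcpx P) i). cdiff (zcpx P) i x = \<zero>\<^bsub>cobj (zcpx P) (i + 1)\<^esub> \<and>
          (\<exists>w\<in>carrier (cobj E (i - 1)). y = Join (Join x \<zero>\<^bsub>Q i\<^esub>) \<zero>\<^bsub>Q (i + 1)\<^esub> \<oplus>\<^bsub>cobj E i\<^esub> cdiff E (i - 1) w)"
      if "y \<in> carrier (cobj E i)" "cdiff E i y = \<zero>\<^bsub>cobj E (i + 1)\<^esub>" for i y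
    proof -
      obtain p q q' where y: "y = Join (Join p q) q'" "p \<in> carrier (P i)" "q \<in> carrier (Q i)" "q' \<in> carrier (Q (i + 1))"
        using E_cases \<open>y \<in> carrier (cobj E i)\<close> by blast
      have "q' = \<zero>\<^bsub>Q (i + 1)\<^esub>" using that(2) y(1) by simp
      then show ?thesis using y
        by (intro bexI[of _ p] conjI bexI[of _ "Join (Join \<zero>\<^bsub>P (i - 1)\<^esub> \<zero>\<^bsub>Q (i - 1)\<^esub>) q"]) simp_all
    qed
  qed
  then have "level_one E"
    by (rule level_one_qis[OF level_one_zcpx[OF projective_retract[OF P(1)] bP] _ E])
  then have E1: "length_le E 1" by (rule length_le_one)
  let ?U = "\<lambda>i. {z \<in> carrier (cobj E i). s i z = \<zero>\<^bsub>cobj X i\<^esub>}"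
  let ?K = "subcpx E ?U"
  have S: "ses L ?K E X gid s" by (rule ses_ker[OF E X s s_sur])
  have K: "?K \<in> bcpx L" by (rule sesD(1)[OF S])
  have KM: "submod (cobj ?K i) (cocycles ?K i) \<in> mod_cat L" "submod (cobj ?K i) (coboundaries ?K i) \<in> mod_cat L" for i
    by (intro noetherian bcpxD(1)[OF K] rsub_cocycles[OF K] rsub_coboundaries[OF K])+
  have KZ: "syz_resdim_less L M0 (Suc r) k (submod (cobj ?K i) (cocycles ?K i))" for i
  proof (rule syz_iso[OF syz_add_projective[OF ring_L M0_in Q(1) projective_retract[OF Q(1)] P(2)] KM(1)])
    \<comment> \<open>A cocycle of the kernel is a pair \<open>(p, q)\<close> with \<zeta> p +
      \<beta> q = 0. Since \<beta> factors through \<tau>, the substitution \<open>p\<close> =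
      \<iota> x - \<tau> q turns this into the condition that \<iota> x is killed by \<zeta>. So the
      cocycles are the syzygy \<open>KZ i\<close> plus the free parameter \<open>q\<close> in the
      projective \<open>Q i\<close>.\<close>
    let ?f = "\<lambda>z. Join (Join (\<iota> i (lft z) \<ominus>\<^bsub>P i\<^esub> \<tau> i (rgt z)) (rgt z)) \<zero>\<^bsub>Q (i + 1)\<^esub>"
    note \<iota> = mod_sesD(4)[OF P(3), of i]
    have cocyc: "cocycles ?K i = {Join (Join p q) \<zero>\<^bsub>Q (i + 1)\<^esub> | p q. p \<in> carrier (P i) \<and> q \<in> carrier (Q i) \<and>
        \<zeta> i p \<oplus>\<^bsub>cobj X i\<^esub> \<beta> i q = \<zero>\<^bsub>cobj X i\<^esub>}"
      by (auto simp: cocycles_def mod_ker_def s_def)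
    have \<zeta>f: "\<zeta> i (\<iota> i x \<ominus>\<^bsub>P i\<^esub> \<tau> i q) \<oplus>\<^bsub>cobj X i\<^esub> \<beta> i q = \<zero>\<^bsub>cobj X i\<^esub>"
      if "x \<in> carrier (KZ i)" "q \<in> carrier (Q i)" for x q
    proof -
      have "\<zeta> i (\<iota> i x) = \<zero>\<^bsub>cobj X i\<^esub>" using mod_sesD(8)[OF P(3), of i] that(1) Zc(2) by auto
      moreover have "\<zeta> i (\<iota> i x \<ominus>\<^bsub>P i\<^esub> \<tau> i q) = \<zeta> i (\<iota> i x) \<ominus>\<^bsub>cobj X i\<^esub> \<zeta> i (\<tau> i q)"
        by (rule mod_hom_diff[OF \<zeta> mod_cat_abelian[OF PM] bcpxD(3)[OF X]])
          (use that mod_homD(1)[OF \<iota>] mod_homD(1)[OF \<tau>] in auto)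
      ultimately show ?thesis using that \<zeta>\<tau> by (simp add: a_minus_def Xi.l_neg)
    qed
    have hom: "?f \<in> mod_hom L (mod_sum (KZ i) (Q i)) (cobj E i)"
      unfolding E_obj
      by (intro mod_hom_Join mod_hom_sub PM mod_hom_comp[OF \<iota> lft_hom] mod_hom_comp[OF \<tau> rgt_hom] rgt_hom
          mod_hom_const_zero QM)
    have mem: "?f z \<in> cocycles ?K i" if "z \<in> carrier (mod_sum (KZ i) (Q i))" for z
      using that \<zeta>f mod_homD(1)[OF \<iota>] mod_homD(1)[OF \<tau>] unfolding cocyc by auto
    have "cocycles ?K i \<subseteq> ?U i" by (auto simp: cocycles_def mod_ker_def)
    then show "?f \<in> mod_hom L (mod_sum (KZ i) (Q i)) (submod (cobj ?K i) (cocycles ?K i))"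
      unfolding subcpx_simps using mem by (intro mod_hom_into_submod hom) auto
    show "bij_betw ?f (carrier (mod_sum (KZ i) (Q i))) (carrier (submod (cobj ?K i) (cocycles ?K i)))"
      unfolding bij_betw_def
    proof
      show "inj_on ?f (carrier (mod_sum (KZ i) (Q i)))"
        using mod_homD(1)[OF \<iota>] mod_homD(1)[OF \<tau>] mod_sesD(6)[OF P(3), of i]
        by (auto intro!: inj_onI simp: a_minus_def dest: inj_onD)
      show "?f ` carrier (mod_sum (KZ i) (Q i)) = carrier (submod (cobj ?K i) (cocycles ?K i))"
      proof
        show "?f ` carrier (mod_sum (KZ i) (Q i)) \<subseteq> carrier (submod (cobj ?K i) (cocycles ?K i))"
          using mem by auto
        show "carrier (submod (cobj ?K i) (cocycles ?K i)) \<subseteq> ?f ` carrier (mod_sum (KZ i) (Q i))"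
        proof
          fix z assume "z \<in> carrier (submod (cobj ?K i) (cocycles ?K i))"
          then obtain p q where z: "z = Join (Join p q) \<zero>\<^bsub>Q (i + 1)\<^esub>" "p \<in> carrier (P i)" "q \<in> carrier (Q i)"
            "\<zeta> i p \<oplus>\<^bsub>cobj X i\<^esub> \<beta> i q = \<zero>\<^bsub>cobj X i\<^esub>" unfolding submod_simps cocyc by blast
          have tq: "\<tau> i q \<in> carrier (P i)" using mod_homD(1)[OF \<tau> z(3)] .
          have "\<zeta> i (p \<oplus>\<^bsub>P i\<^esub> \<tau> i q) = \<zero>\<^bsub>Z i\<^esub>"
            using mod_homD(2)[OF \<zeta> z(2) tq] \<zeta>\<tau>[OF z(3)] z(4) Zc(2) by simp
          then obtain x where x: "x \<in> carrier (KZ i)" "p \<oplus>\<^bsub>P i\<^esub> \<tau> i q = \<iota> i x"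
            using mod_sesD(8)[OF P(3), of i] z(2) tq by blast
          have "p = \<iota> i x \<ominus>\<^bsub>P i\<^esub> \<tau> i q" unfolding x(2)[symmetric] a_minus_def
            using z(2) tq by (simp add: Pi.a_assoc Pi.r_neg)
          then show "z \<in> ?f ` carrier (mod_sum (KZ i) (Q i))"
            using z x(1) by (intro image_eqI[of _ _ "Join x q"]) simp_all
        qed
      qed
    qed
  qed
  have KB: "syz_resdim_less L M0 (Suc r) k (submod (cobj ?K i) (coboundaries ?K i))" for i
  proof (rule syz_iso[OF Q(2) KM(2)])
    \<comment> \<open>The coboundaries of the kernel are exactly the syzygy \<open>KB i\<close>,
      with no projective summand added.\<close>
    let ?f = "\<lambda>x. Join (Join \<zero>\<^bsub>P i\<^esub> (\<kappa> i x)) \<zero>\<^bsub>Q (i + 1)\<^esub>"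
    note \<kappa> = mod_sesD(4)[OF Q(3), of i]
    have hom: "?f \<in> mod_hom L (KB i) (cobj E i)"
      unfolding E_obj by (intro mod_hom_Join mod_hom_const_zero PM QM \<kappa>)
    have image: "?f ` carrier (KB i) = coboundaries ?K i"
    proof
      show "?f ` carrier (KB i) \<subseteq> coboundaries ?K i"
      proof
        fix z assume "z \<in> ?f ` carrier (KB i)"
        then obtain x where x: "x \<in> carrier (KB i)" "z = ?f x" by blast
        let ?q = "\<kappa> i x"
        have q: "?q \<in> carrier (Q i)" "\<beta> i ?q = \<zero>\<^bsub>cobj X i\<^esub>"
          using mod_sesD(8)[OF Q(3), of i] x(1) Bc(2) by auto
        have \<theta>q: "\<theta> (i - 1) ?q \<in> carrier (cobj X (i - 1))" using \<theta>c[of ?q "i - 1"] q(1) by simp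
        have "cdiff X (i - 1) (\<ominus>\<^bsub>cobj X (i - 1)\<^esub> \<theta> (i - 1) ?q) = \<ominus>\<^bsub>cobj X i\<^esub> cdiff X (i - 1) (\<theta> (i - 1) ?q)"
          by (rule mod_hom_minus[OF bcpxD(4)[OF X] bcpxD(3)[OF X] bcpxD(3)[OF X] \<theta>q]) simp
        also have "\<dots> = \<zero>\<^bsub>cobj X i\<^esub>"
          using d\<theta>[of ?q "i - 1"] q abelian_group_minus_zero[OF bcpxD(3)[OF X]] by simp
        finally obtain p where p: "p \<in> carrier (P (i - 1))" "\<ominus>\<^bsub>cobj X (i - 1)\<^esub> \<theta> (i - 1) ?q = \<zeta> (i - 1) p"
          using \<zeta>sur[of "\<ominus>\<^bsub>cobj X (i - 1)\<^esub> \<theta> (i - 1) ?q" "i - 1"] \<theta>q by auto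
        \<comment> \<open>An element \<open>q\<close> killed by \<beta> has closed image under
          \<theta>, so some \<open>p\<close> with \<zeta> p = - \<theta> q completes it to an
          element of the kernel, whose boundary is \<open>q\<close> in the middle component.\<close>
        have "Join (Join p \<zero>\<^bsub>Q (i - 1)\<^esub>) ?q \<in> ?U (i - 1)"
          using p q(1) \<theta>q by (simp add: s_def Xi.l_neg flip: p(2))
        then show "z \<in> coboundaries ?K i"
          unfolding coboundaries_def x(2)
          by (intro image_eqI[of _ _ "Join (Join p \<zero>\<^bsub>Q (i - 1)\<^esub>) ?q"]) simp_all
      qed
      show "coboundaries ?K i \<subseteq> ?f ` carrier (KB i)"
      proof
        fix z assume "z \<in> coboundaries ?K i"
        then obtain w where w: "w \<in> ?U (i - 1)" "z = cdiff E (i - 1) w"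
          unfolding coboundaries_def subcpx_simps submod_simps by (rule imageE) blast
        obtain p q' q where wq: "w = Join (Join p q') q" "p \<in> carrier (P (i - 1))" "q' \<in> carrier (Q (i - 1))" "q \<in> carrier (Q i)"
          using E_cases[of w "i - 1"] w(1) by auto
        have "\<beta> i q = cdiff X (i - 1) (s (i - 1) w)"
          using ds[of p "i - 1" q' q] wq by simp
        then have "\<beta> i q = \<zero>\<^bsub>B i\<^esub>" using w(1) bcpxD(7)[OF X, of "i - 1"] Bc(2) by simp
        then obtain x where "x \<in> carrier (KB i)" "q = \<kappa> i x" using mod_sesD(8)[OF Q(3), of i] wq(4) by blast
        then show "z \<in> ?f ` carrier (KB i)" using w(2) wq(1) by (intro image_eqI[of _ _ x]) simp_all
      qed
    qed
    have "coboundaries ?K i \<subseteq> ?U i"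
      using rsubD(1)[OF rsub_coboundaries[OF K, of i]] by simp
    then show "?f \<in> mod_hom L (KB i) (submod (cobj ?K i) (coboundaries ?K i))"
      unfolding subcpx_simps using image by (intro mod_hom_into_submod hom) auto
    show "bij_betw ?f (carrier (KB i)) (carrier (submod (cobj ?K i) (coboundaries ?K i)))"
      unfolding bij_betw_def using image mod_sesD(6)[OF Q(3), of i] by (auto simp: inj_on_def)
  qed
  \<comment> \<open>The kernel enters the resolution step shifted by one; the shift merely renumbers
    its cocycles and coboundaries, over which the hypotheses are quantified.\<close>
  have "length_le (cpx_shift 1 ?K) (k + 2 * Suc r)"
    by (rule Suc.IH[OF cpx_shift_in_bcpx[OF K]])
      (use KZ KB in \<open>simp_all only: cocycles_shift[OF K] cpx_shift_simps\<close>)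
  from length_le_resolve[OF S E1 this] show ?case by simp
qed

end

theorem theorem1p2:
  fixes K :: "('k, 'p) ring_scheme" and L :: "('a, 'q) ring_scheme"
    and \<phi> :: "'k \<Rightarrow> 'a" and m n :: nat
  assumes "artin_algebra K L \<phi>"
    and "igusa_todorov m n L"
  shows "tri_dim_db L \<le> enat (2 * m + n + 1)"
proof -
  have ring: "ring L" using assms(1) by (simp add: artin_algebra_def)
  interpret fg_noetherian L
  proof (rule fg_noetherian.intro)
    show "ring L" by (rule ring)
    show "submod M U \<in> mod_cat L" if "M \<in> mod_cat L" "rsub L M U" for M U
      using that right_module_submod artin_algebra_noetherian[OF assms(1)] by (auto simp: mod_cat_def)
  qed
  obtain V where V: "V \<in> mod_cat L"
    and IT: "\<And>M. M \<in> mod_cat L \<Longrightarrow> \<exists>N. is_syzygy L n M N \<and>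
        (\<exists>W \<delta>. (\<forall>i\<le>m. W i \<in> add_closure L V) \<and> exact_resolution L m W \<delta> N)"
    using assms(2) unfolding igusa_todorov_def by blast
  obtain F u where F: "F \<in> mod_cat L" "u \<in> carrier F"
    "\<And>P x. P \<in> mod_cat L \<Longrightarrow> x \<in> carrier P \<Longrightarrow> \<exists>h\<in>mod_hom L F P. h u = x"
    using free_cyclic_module[OF ring] by blast
  \<comment> \<open>\<open>V\<close> supplies the terms of the Igusa-Todorov resolutions,
    \<open>F\<close> all projectives.\<close>
  let ?M = "mod_sum V F"
  interpret module_generator L ?M
  proof
    show "?M \<in> mod_cat L" by (rule mod_sum_in_mod_cat[OF V F(1)])
    show "add_retract L ?M P" if "projective_mod L P" for P
      by (rule add_retract_mono[OF projective_add_retract[OF ring F that] retract_mod_sum_right[OF V]])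
  qed
  have syz: "syz_resdim_less L ?M (Suc m) n M" if M: "M \<in> mod_cat L" for M
  proof -
    obtain N W \<delta> where N: "is_syzygy L n M N" "\<forall>i\<le>m. W i \<in> add_closure L V" "exact_resolution L m W \<delta> N"
      using IT[OF M] by blast
    have "add_retract L ?M (W i)" if "i \<le> m" for i
      using N(2) that by (intro add_retract_mono[OF add_closure_add_retract retract_mod_sum_left[OF F(1)]]) auto
    moreover have "N \<in> mod_cat L" using N(1) by cases auto
    ultimately have "resdim_less L ?M (Suc m) N" by (rule resdim_less_of_exact_resolution[OF N(3)])
    \<comment> \<open>The \<open>n\<close> projective covers are put in front of the resolution of
      \<open>N\<close>; the argument 0 says that \<open>N\<close> itself is resolved by
      \<open>add ?M\<close> at once. The index \<open>Suc m\<close> counts its \<open>m + 1\<close>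
      terms.\<close>
    then show ?thesis using syz_of_is_syzygy[OF N(1), of ?M "Suc m" 0] by simp
  qed
  have "X \<in> db_gen L {stalk L ?M} (2 * m + n + 1 + 1)" if X: "X \<in> bcpx L" for X
  proof -
    \<comment> \<open>The hypothesis on modules is applied to the cocycles and coboundaries of
      \<open>X\<close> in every degree, which are finitely generated. The count exceeds the claimed
      dimension by one, as in the definition of \<open>tri_dim_db\<close>.\<close>
    have "X \<in> level (n + 2 * Suc m)"
      by (intro length_le_level length_le_cartan_eilenberg X syz noetherian bcpxD(1)[OF X] rsub_cocycles[OF X] rsub_coboundaries[OF X])
    also have "n + 2 * Suc m = Suc (2 * m + n + 1)" by simp
    finally show ?thesis using level_db_gen by (simp only: Suc_eq_plus1)
  qed
  then have "db_gen L {stalk L ?M} (2 * m + n + 1 + 1) = bcpx L"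
    using db_gen_subset_bcpx by blast
  then show ?thesis
    unfolding tri_dim_db_def using S_in by (intro Inf_lower) blast
qed

end
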